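(* The unique solution $F$ of the ODE $$F_{uu}+\frac{2}{u}F_u-\frac{2z}{u(u-1)^2}F=0,\qquad F(0,z)=1,\quad F_u(0,z)=z,$$ which is satisfied by the bivariate generating function $F(u,z)=\sum_{n=0}^\infty G_n(z)u^n$ of the random convex chains, is $$F(u,z)=\frac{{}_2F_1(1-\alpha,-\alpha;2;u)}{(1-u)^{\alpha}},\qquad \alpha:=\frac{\sqrt{8z+1}-1}{2}.$$ It extends to a jointly analytic function on $\{(u,z)\in\mathbb{C}^2: u\notin[1,\infty),\ z\notin(-\infty,-1/8]\}$.
   Context: Let $T\subset\mathbb{R}^2$ be the triangle with vertices $(0,0)$, $\mathbf{v}_1=(1,0)$, $\mathbf{v}_2=(0,1)$. For $n\ge 0$ let $\mathbf{X}_1,\dots,\mathbf{X}_n$ be independent uniformly distributed random points in $T$ and $T_n:=\operatorname{conv}\{\mathbf{v}_1,\mathbf{v}_2,\mathbf{X}_1,\dots,\mathbf{X}_n\}$. Let $f_0(T_n)$ be the number of vertices of $T_n$ (including $\mathbf{v}_1,\mathbf{v}_2$) and $p_k^{(n)}:=\mathbb{P}(f_0(T_n)=k+2)$ for $k\in\{0,\dots,n\}$. Set $G_0(z):=1$, $G_1(z):=z$, $G_n(z):=\sum_{k=1}^n p_k^{(n)}z^k$ for $n\ge2$, and $F(u,z):=\sum_{n=0}^\infty G_n(z)u^n$, an element of $\mathbb{C}[[u,z]]$. Subscripts $u$ denote $\partial/\partial u$. The Gaussian hypergeometric function is ${}_2F_1(a,b;c;u)=\sum_{n\ge0}\frac{a^{\overline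 n}b^{\overline n}}{c^{\overline n}}\frac{u^n}{n!}$ for $|u|<1$, where $q^{\overline n}=q(q+1)\cdots(q+n-1)$, $q^{\overline 0}=1$, $c\notin\{0,-1,-2,\dots\}$, extended analytically to $\mathbb{C}\setminus[1,\infty)$. The square root is the principal branch (cut along $(-\infty,-1/8]$ in $z$), and $(1-u)^\alpha$ is the principal power with cut $[1,\infty)$ in $u$. *)

theory Defs
  imports
    "HOL-Probability.Probability"
    "HOL-Complex_Analysis.Complex_Analysis"
    "HOL-Computational_Algebra.Computational_Algebra"
begin

definition triangle :: "(real \<times> real) set" where
  "triangle = convex hull {(0, 0), (1, 0), (0, 1)}"

definition chain_hull :: "(nat \<Rightarrow> 'w \<Rightarrow> real \<times> real) \<Rightarrow> nat \<Rightarrow> 'w \<Rightarrow> (real \<times> real) set" where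
  "chain_hull Y n \<omega> = convex hull ({(1, 0), (0, 1)} \<union> (\<lambda>i. Y i \<omega>) ` {1..n})"

definition num_vertices :: "(real \<times> real) set \<Rightarrow> nat" where
  "num_vertices P = card {v. v extreme_point_of P}"

definition vertex_prob :: "'w measure \<Rightarrow> (nat \<Rightarrow> 'w \<Rightarrow> real \<times> real) \<Rightarrow> nat \<Rightarrow> nat \<Rightarrow> real" where
  "vertex_prob N Y n k = measure N {\<omega> \<in> space N. num_vertices (chain_hull Y n \<omega>) = k + 2}"

text \<open>For every \<open>n\<close> the random points \<open>X n 1, \<dots>, X n n\<close> live on a probability space
  \<open>M n\<close> of their own; one infinite sequence on a single space is the case where neither
  \<open>M n\<close> nor \<open>X n\<close> depends on \<open>n\<close>.\<close>

definition uniform_points :: "(nat \<Rightarrow> 'w measure) \<Rightarrow> (nat \<Rightarrow> nat \<Rightarrow> 'w \<Rightarrow> real \<times> real) \<Rightarrow> bool" where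
  "uniform_points M X \<longleftrightarrow>
     (\<forall>n. prob_space (M n) \<and>
          prob_space.indep_vars (M n) (\<lambda>_. borel) (X n) {1..n} \<and>
          (\<forall>i\<in>{1..n}. distr (M n) borel (X n i) = uniform_measure lborel triangle))"

definition chain_poly ::
    "(nat \<Rightarrow> 'w measure) \<Rightarrow> (nat \<Rightarrow> nat \<Rightarrow> 'w \<Rightarrow> real \<times> real) \<Rightarrow> nat \<Rightarrow> complex poly" where
  "chain_poly M X n =
     (if n = 0 then 1
      else if n = 1 then [:0, 1:]
      else \<Sum>k=1..n. monom (complex_of_real (vertex_prob (M n) (X n) n k)) k)"

text \<open>The ring of formal power series in \<open>u\<close> and \<open>z\<close> is represented by the type
  \<^typ>\<open>complex fps fps\<close>: the outer variable is \<open>u\<close> and the inner variable is \<open>z\<close>, so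
  \<^term>\<open>fps_X :: complex fps fps\<close> is \<open>u\<close>, \<^term>\<open>fps_const fps_X :: complex fps fps\<close> is \<open>z\<close>,
  and \<^const>\<open>fps_deriv\<close> is the derivative with respect to \<open>u\<close>.\<close>

definition chain_gf ::
    "(nat \<Rightarrow> 'w measure) \<Rightarrow> (nat \<Rightarrow> nat \<Rightarrow> 'w \<Rightarrow> real \<times> real) \<Rightarrow> complex fps fps" where
  "chain_gf M X = Abs_fps (\<lambda>n. fps_of_poly (chain_poly M X n))"

text \<open>As \<open>u\<close> is not invertible in this ring, the formal equation is multiplied by
  \<open>u (u - 1)\<^sup>2\<close>, which is not a zero divisor.\<close>

definition formal_chain_ode :: "complex fps fps \<Rightarrow> bool" where
  "formal_chain_ode H \<longleftrightarrow>
     fps_X * (fps_X - 1)\<^sup>2 * fps_deriv (fps_deriv H) + 2 * (fps_X - 1)\<^sup>2 * fps_deriv H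
       - 2 * fps_const fps_X * H = 0 \<and>
     fps_nth H 0 = 1 \<and> fps_nth (fps_deriv H) 0 = fps_X"

definition chain_ode :: "complex \<Rightarrow> complex set \<Rightarrow> (complex \<Rightarrow> complex) \<Rightarrow> bool" where
  "chain_ode z S f \<longleftrightarrow>
     f holomorphic_on S \<and>
     (\<forall>u\<in>S - {0}. deriv (deriv f) u + 2 / u * deriv f u - 2 * z / (u * (u - 1)\<^sup>2) * f u = 0) \<and>
     f 0 = 1 \<and> deriv f 0 = z"

definition u_domain :: "complex set" where
  "u_domain = - (complex_of_real ` {1..})"

definition z_domain :: "complex set" where
  "z_domain = - (complex_of_real ` {..-1/8})"

definition is_hypergeo_2F1 ::
    "complex \<Rightarrow> complex \<Rightarrow> complex \<Rightarrow> (complex \<Rightarrow> complex) \<Rightarrow> bool" where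
  "is_hypergeo_2F1 a b c f \<longleftrightarrow>
     f holomorphic_on u_domain \<and>
     (\<forall>u. norm u < 1 \<longrightarrow>
        f u = (\<Sum>n. pochhammer a n * pochhammer b n / pochhammer c n * (u ^ n / fact n)))"

text \<open>The analytic continuation is unique on \<^const>\<open>u_domain\<close> by the lemma below; outside
  this domain the value of \<open>hypergeo_2F1 a b c\<close> has no meaning.\<close>

definition hypergeo_2F1 :: "complex \<Rightarrow> complex \<Rightarrow> complex \<Rightarrow> complex \<Rightarrow> complex" where
  "hypergeo_2F1 a b c = (SOME f. is_hypergeo_2F1 a b c f)"

lemma is_hypergeo_2F1_unique:
  assumes "is_hypergeo_2F1 a b c f" "is_hypergeo_2F1 a b c g" "u \<in> u_domain"
  shows "f u = g u"
proof (rule analytic_continuation_open[where s = "ball 0 1" and s' = u_domain and f = f and g = g])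
  show "open u_domain"
    unfolding u_domain_def
    by (intro open_Compl closed_injective_linear_image closed_atLeast
          bounded_linear.linear[OF bounded_linear_of_real]) (auto intro: inj_of_real)
  show "connected u_domain"
    unfolding u_domain_def
    by (intro starlike_imp_connected starlike_slotted_complex_plane_right)
  show "ball 0 1 \<subseteq> u_domain"
    by (auto simp: u_domain_def)
qed (use assms in \<open>auto simp: is_hypergeo_2F1_def\<close>)

text \<open>Both the square root and the power are principal branches.\<close>

definition chain_fun :: "complex \<Rightarrow> complex \<Rightarrow> complex" where
  "chain_fun u z =
     (let \<alpha> = (csqrt (8 * z + 1) - 1) / 2
      in hypergeo_2F1 (1 - \<alpha>) (- \<alpha>) 2 u / (1 - u) powr \<alpha>)"

text \<open>Analyticity in two complex variables: near every point the function is the sum of a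
  double power series.\<close>

definition jointly_analytic_on ::
    "(complex \<Rightarrow> complex \<Rightarrow> complex) \<Rightarrow> (complex \<times> complex) set \<Rightarrow> bool" where
  "jointly_analytic_on f D \<longleftrightarrow>
     (\<forall>(u0, z0)\<in>D. \<exists>r>0. \<exists>a :: nat \<Rightarrow> nat \<Rightarrow> complex.
        \<forall>u\<in>ball u0 r. \<forall>z\<in>ball z0 r.
          ((\<lambda>(j, k). a j k * (u - u0) ^ j * (z - z0) ^ k) has_sum f u z) UNIV)"

end

theory Submission
  imports Defs
begin

text \<open>
  The generating function satisfies the differential equation because of a recursion for the law
  of the number of vertices. Let \<open>Y\<close> be the one of the \<open>n + 1\<close> random points for which the line
  through \<open>(1, 0)\<close> meets the other leg of the triangle in the lowest point \<open>(0, s)\<close>, and write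
  \<open>Y = (1 - t, t s)\<close>. Then \<open>Y\<close> is the neighbour of \<open>(1, 0)\<close> on the chain. The segment from \<open>Y\<close> to
  \<open>(0, 1)\<close> cuts the part of the triangle above the line into two triangles. The one with vertex
  \<open>(1, 0)\<close> has relative area \<open>t (1 - s)\<close>; its points lie in the hull of \<open>(1, 0)\<close>, \<open>Y\<close> and \<open>(0, 1)\<close>,
  so they do not matter. The other has relative area \<open>(1 - t) (1 - s)\<close> and is an affine copy of the
  whole triangle, with \<open>Y\<close> in the role of \<open>(1, 0)\<close>; the points in it form a chain of the same kind,
  and \<open>(1, 0)\<close> contributes one more vertex. For a uniform point, \<open>s\<close> is uniform on the unit interval
  and \<open>t\<close> is independent of \<open>s\<close> with density \<open>2 t\<close>. Summing over the number \<open>m\<close> of points in the copy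
  and evaluating a Beta integral gives
  \<open>(n + 1) (n + 2) G\<^bsub>n+1\<^esub>(z) = 2 z (\<Sum>m\<le>n. (n - m + 1) G\<^sub>m(z))\<close>.
  The weights are linear in \<open>n\<close>, so a second difference turns this into a three-term recurrence,
  which is the differential equation read off coefficientwise (\<open>chain_prob_Suc\<close>,
  \<open>chain_coeff_recurrence\<close>, \<open>chain_recurrence_iff_fps_ode\<close>). The recurrence determines all
  coefficients from the first one, which gives both uniqueness statements.

  On the analytic side, \<open>u F'' + 2 F' = (u F)''\<close>, so the equation says
  \<open>(u F)'' = 2 z F / (1 - u)\<^sup>2\<close> and can be solved by Picard iteration along rays from the origin.
  The slit plane is starlike, hence every iterate is holomorphic there, and the increments decay like
  \<open>B\<^sup>k / k!\<close> on compact sets. The solution is therefore \<open>F(u, z) = \<Sum>k. z\<^sup>k \<phi>\<^sub>k(u)\<close>, holomorphic in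
  \<open>u\<close> on the slit plane and entire in \<open>z\<close>, and expanding it in Taylor series first in \<open>u\<close> and then
  in \<open>z\<close> gives joint analyticity (\<open>norm_sol_coeff_le\<close>, \<open>jointly_analytic_sol_at\<close>).

  If \<open>\<alpha> (\<alpha> + 1) = 2 z\<close>, then \<open>F(u, z) (1 - u)\<^sup>\<alpha>\<close> satisfies the hypergeometric equation with
  parameters \<open>1 - \<alpha>\<close>, \<open>-\<alpha>\<close>, \<open>2\<close>, so its Taylor coefficients are those of the hypergeometric series.
  This function is thus the analytic continuation of the series, whose existence is obtained in this
  way, and dividing by the power gives the closed form (\<open>is_hypergeo_sol\<close>).
\<close>

section \<open>Vertices of planar hulls\<close>

lemma extreme_point_of_finite_hull_iff:
  fixes F :: "'a::euclidean_space set"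
  assumes "finite F"
  shows "e extreme_point_of (convex hull F) \<longleftrightarrow> e \<in> F \<and> e \<notin> convex hull (F - {e})"
proof
  assume e: "e extreme_point_of (convex hull F)"
  then have "e \<in> F" by (rule extreme_point_of_convex_hull)
  moreover have "convex (convex hull F - {e})"
    using e by (simp add: extreme_point_of_stillconvex)
  then have "convex hull (F - {e}) \<subseteq> convex hull F - {e}"
    by (intro hull_minimal) (auto simp: hull_inc)
  ultimately show "e \<in> F \<and> e \<notin> convex hull (F - {e})" by blast
next
  assume "e \<in> F \<and> e \<notin> convex hull (F - {e})"
  then show "e extreme_point_of (convex hull F)"
    using extreme_point_of_convex_hull_insert[of "F - {e}" e] assms
    by (simp add: insert_absorb)
qed

lemma extreme_points_of_injective_linear_image:
  fixes L :: "'a::real_normed_vector \<Rightarrow> 'b::real_normed_vector"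
  assumes "linear L" "inj L"
  shows "{v. v extreme_point_of (L ` K)} = L ` {v. v extreme_point_of K}"
proof -
  have "L v extreme_point_of (L ` K) \<longleftrightarrow> v extreme_point_of K" for v
    using face_of_linear_image[OF assms, of "{v}" K] by (simp add: face_of_singleton)
  moreover have "v \<in> L ` K" if "v extreme_point_of (L ` K)" for v
    using that by (simp add: extreme_point_of_def)
  ultimately show ?thesis by blast
qed

lemma num_vertices_affine_image:
  fixes L :: "real \<times> real \<Rightarrow> real \<times> real"
  assumes "linear L" "inj L"
  shows "num_vertices (convex hull ((\<lambda>x. c + L x) ` F)) = num_vertices (convex hull F)"
proof -
  have "convex hull ((\<lambda>x. c + L x) ` F) = (\<lambda>x. c + x) ` (L ` (convex hull F))"
    unfolding convex_hull_linear_image[OF assms(1)] convex_hull_translation[symmetric]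
    by (simp add: image_image)
  then have "{v. v extreme_point_of (convex hull ((\<lambda>x. c + L x) ` F))}
      = (\<lambda>x. c + x) ` L ` {v. v extreme_point_of (convex hull F)}"
    by (simp only: extreme_points_of_translation extreme_points_of_injective_linear_image[OF assms])
  moreover have "inj_on (\<lambda>x. c + x) X" "inj_on L X" for X
    using assms(2) by (auto simp: inj_on_def)
  ultimately show ?thesis
    unfolding num_vertices_def
    by (simp only: card_image)
qed

lemma convex_hull_fst_snd_ge:
  fixes S :: "(real \<times> real) set"
  assumes "p \<in> convex hull S" "\<And>q. q \<in> S \<Longrightarrow> a * fst q + b * snd q \<ge> c"
  shows "a * fst p + b * snd p \<ge> c"
proof -
  have "convex {q :: real \<times> real. (a, b) \<bullet> q \<ge> c}"
    by (rule convex_halfspace_ge)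
  then have "convex hull S \<subseteq> {q. (a, b) \<bullet> q \<ge> c}"
    by (intro hull_minimal) (use assms(2) in \<open>auto simp: inner_prod_def\<close>)
  then show ?thesis using assms(1) by (auto simp: inner_prod_def)
qed

lemma convex_hull_snd_pos:
  fixes S :: "(real \<times> real) set"
  assumes "p \<in> convex hull S" "\<And>q. q \<in> S \<Longrightarrow> snd q > 0"
  shows "snd p > 0"
proof -
  have "convex {q :: real \<times> real. (0, 1) \<bullet> q > 0}"
    by (rule convex_halfspace_gt)
  then have "convex hull S \<subseteq> {q. (0, 1) \<bullet> q > 0}"
    by (intro hull_minimal) (use assms(2) in \<open>auto simp: inner_prod_def\<close>)
  then show ?thesis using assms(1) by (auto simp: inner_prod_def)
qed

definition open_triangle :: "(real \<times> real) set" where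
  "open_triangle = {p. 0 < fst p \<and> 0 < snd p \<and> fst p + snd p < 1}"

text \<open>Adding a far point on the axis could destroy an old vertex \<open>e\<close> only if \<open>e\<close> lies on a segment
  from \<open>(c, 0)\<close> to a point \<open>k\<close> of the hull of the other points. Such a segment enters the triangle
  through a point of the hypotenuse. If \<open>e\<close> is not an end point of the hypotenuse, that point belongs
  to the hull as well, so \<open>e\<close> would already be a convex combination of the others. The end point
  \<open>(1, 0)\<close> survives because all other points lie strictly above the axis, and \<open>(0, 1)\<close> because all
  points of the segment other than \<open>k\<close> have a positive first coordinate.\<close>

lemma num_vertices_insert_on_axis:
  fixes S :: "(real \<times> real) set"
  assumes "finite S" "S \<subseteq> open_triangle" "c > 1"
  shows "num_vertices (convex hull (insert (c, 0) ({(1, 0), (0, 1)} \<union> S)))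
         = Suc (num_vertices (convex hull ({(1, 0), (0, 1)} \<union> S)))"
proof -
  define F where "F = {(1, 0), (0, 1)} \<union> S"
  have fin: "finite F" using assms by (simp add: F_def)
  have F_ge: "fst q \<ge> 0 \<and> snd q \<ge> 0 \<and> fst q + snd q \<le> 1" if "q \<in> F" for q
    using that assms(2) by (auto simp: F_def open_triangle_def)
  have K_ge: "fst q \<ge> 0 \<and> snd q \<ge> 0 \<and> fst q + snd q \<le> 1" if "q \<in> convex hull F" for q
  proof -
    have "1 * fst q + 0 * snd q \<ge> 0" "0 * fst q + 1 * snd q \<ge> 0" "(-1) * fst q + (-1) * snd q \<ge> -1"
      by (rule convex_hull_fst_snd_ge[OF that]; use F_ge in force)+
    then show ?thesis by simp
  qed
  have v: "(c, 0) \<notin> convex hull F" using K_ge[of "(c, 0)"] assms(3) by auto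
  then have "(c, 0) \<notin> F" using hull_inc by metis
  have iff: "e \<notin> convex hull (insert (c, 0) (F - {e})) \<longleftrightarrow> e \<notin> convex hull (F - {e})"
    if "e \<in> F" for e
  proof
    show "e \<notin> convex hull insert (c, 0) (F - {e}) \<Longrightarrow> e \<notin> convex hull (F - {e})"
      using hull_mono[of "F - {e}" "insert (c,0) (F - {e})" convex] by blast
    assume e: "e \<notin> convex hull (F - {e})"
    show "e \<notin> convex hull (insert (c, 0) (F - {e}))"
    proof
      assume e_in: "e \<in> convex hull (insert (c, 0) (F - {e}))"
      have "card F \<ge> 2"
        using card_mono[OF fin, of "{(1, 0), (0, 1)}"] by (auto simp: F_def)
      then have ne: "F - {e} \<noteq> {}"
        by (metis One_nat_def card.empty card_Suc_Diff1 fin not_less_eq_eq numeral_2_eq_2 order_refl that)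
      from e_in obtain l k \<mu> where k: "k \<in> convex hull (F - {e})" and "0 \<le> l" "0 \<le> \<mu>" "l + \<mu> = 1"
        and e_eq': "e = l *\<^sub>R (c, 0) + \<mu> *\<^sub>R k"
        unfolding convex_hull_insert[OF ne] by blast
      then have \<mu>: "0 \<le> \<mu>" "\<mu> \<le> 1" and l: "l = 1 - \<mu>" by auto
      note e_eq = e_eq'[unfolded l]
      have kK: "k \<in> convex hull F" using k hull_mono[of "F - {e}" F convex] by blast
      have "\<mu> \<noteq> 0" using e_eq v that \<open>(c, 0) \<notin> F\<close> by auto
      moreover have "\<mu> \<noteq> 1" using e_eq k e by (auto simp flip: zero_prod_def)
      ultimately have \<mu>: "0 < \<mu>" "\<mu> < 1" using \<mu> by auto
      have e1: "fst e = (1 - \<mu>) * c + \<mu> * fst k" and e2: "snd e = \<mu> * snd k"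
        using e_eq by auto
      have k_ge: "fst k \<ge> 0" "snd k \<ge> 0" "fst k + snd k \<le> 1" using K_ge[OF kK] by auto
      have "fst e > 0" unfolding e1 using \<mu> k_ge assms(3) by (simp add: add_pos_nonneg)
      then have ne2: "e \<noteq> (0, 1)" by auto
      show False
      proof (cases "e = (1, 0)")
        case True
        have "snd q > 0" if "q \<in> F - {e}" for q
          using that True assms(2) by (auto simp: F_def open_triangle_def)
        then have "snd k > 0" using convex_hull_snd_pos[OF k] by blast
        then show False using e2 True \<mu> by auto
      next
        case False
        \<comment> \<open>The segment from \<open>(c, 0)\<close> to \<open>k\<close> enters the triangle through its hypotenuse at \<open>w\<close>,
          and \<open>e\<close> lies between \<open>w\<close> and \<open>k\<close>.\<close>
        define d where "d = c - fst k - snd k"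
        have d: "d > 0" using k_ge assms(3) by (simp add: d_def)
        define \<nu> where "\<nu> = (c - 1) / d"
        have \<nu>: "0 < \<nu>" "\<nu> \<le> 1" using d assms(3) k_ge by (auto simp: \<nu>_def d_def)
        have "fst e + snd e \<le> 1" using F_ge[OF that] by auto
        then have "c - \<mu> * d \<le> 1" unfolding e1 e2 d_def by (simp add: algebra_simps)
        then have le: "\<nu> \<le> \<mu>" using d by (simp add: \<nu>_def field_simps)
        define w where "w = (1 - \<nu>) *\<^sub>R (c, 0) + \<nu> *\<^sub>R k"
        have w_sum: "fst w + snd w = 1"
        proof -
          have "fst w + snd w = c - \<nu> * d" by (simp add: w_def d_def algebra_simps)
          also have "\<nu> * d = c - 1" using d by (simp add: \<nu>_def)
          finally show ?thesis by simp
        qed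
        have w_ge: "fst w \<ge> 0" "snd w \<ge> 0" using \<nu> k_ge assms(3) by (auto simp: w_def)
        have "w = fst w *\<^sub>R (1, 0) + snd w *\<^sub>R (0, 1)" by (simp add: prod_eq_iff)
        moreover have "(1, 0) \<in> convex hull (F - {e})" "(0, 1) \<in> convex hull (F - {e})"
          using False ne2 by (auto intro!: hull_inc simp: F_def)
        ultimately have w_in: "w \<in> convex hull (F - {e})"
          using convexD[OF convex_convex_hull _ _ w_ge w_sum] by metis
        define \<tau> where "\<tau> = (1 - \<mu>) / (1 - \<nu>)"
        have \<nu>1: "\<nu> < 1" using le \<mu> by simp
        have \<tau>: "0 \<le> \<tau>" "\<tau> \<le> 1" using \<mu> \<nu>1 le by (auto simp: \<tau>_def)
        have "e = \<tau> *\<^sub>R w + (1 - \<tau>) *\<^sub>R k"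
        proof -
          have *: "\<tau> * (1 - \<nu>) = 1 - \<mu>" using \<nu>1 by (simp add: \<tau>_def)
          then have **: "\<tau> * \<nu> + (1 - \<tau>) = \<mu>" by (simp add: algebra_simps)
          have "\<tau> * ((1 - \<nu>) * a + \<nu> * b) + (1 - \<tau>) * b
              = (\<tau> * (1 - \<nu>)) * a + (\<tau> * \<nu> + (1 - \<tau>)) * b" for a b
            by (simp add: algebra_simps)
          then have "\<tau> * ((1 - \<nu>) * a + \<nu> * b) + (1 - \<tau>) * b = (1 - \<mu>) * a + \<mu> * b" for a b
            unfolding * ** .
          from this[of c "fst k"] this[of 0 "snd k"] show ?thesis
            unfolding w_def e_eq by (simp add: prod_eq_iff)
        qed
        then have "e \<in> convex hull (F - {e})"
          using convexD[OF convex_convex_hull w_in k, of \<tau> "1 - \<tau>"] \<tau> by simp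
        then show False using e by simp
      qed
    qed
  qed
  have "{x. x extreme_point_of (convex hull (insert (c, 0) F))}
      = insert (c, 0) {x. x extreme_point_of (convex hull F)}"
  proof -
    have "insert (c, 0) F - {e} = insert (c, 0) (F - {e})" if "e \<in> F" for e
      using that \<open>(c, 0) \<notin> F\<close> by auto
    moreover have "insert (c, 0) F - {(c, 0)} = F" using \<open>(c, 0) \<notin> F\<close> by auto
    ultimately show ?thesis
      using iff v fin \<open>(c, 0) \<notin> F\<close> by (auto simp: extreme_point_of_finite_hull_iff)
  qed
  moreover have "finite {x. x extreme_point_of (convex hull F)}"
    by (rule finite_subset[OF _ fin]) (auto dest: extreme_point_of_convex_hull)
  moreover have "(c, 0) \<notin> {x. x extreme_point_of (convex hull F)}"
    using v by (auto simp: extreme_point_of_def)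
  ultimately show ?thesis
    unfolding num_vertices_def F_def[symmetric] by simp
qed

lemma num_vertices_ge_2:
  assumes "finite S" "S \<subseteq> open_triangle"
  shows "num_vertices (convex hull ({(1, 0), (0, 1)} \<union> S)) \<ge> 2"
proof -
  define F where "F = {(1, 0), (0, 1)} \<union> S"
  have fin: "finite F" using assms by (simp add: F_def)
  have 1: "(1, 0) \<notin> convex hull (F - {(1, 0)})"
    using convex_hull_snd_pos[of "(1, 0)" "F - {(1, 0)}"] assms(2)
    by (force simp: F_def open_triangle_def)
  have 2: "(0, 1) \<notin> convex hull (F - {(0, 1)})"
  proof
    \<comment> \<open>Swapping the coordinates reduces this to the argument for the other end point.\<close>
    let ?s = "\<lambda>(x, y). (y, x) :: real \<times> real"
    assume "(0, 1) \<in> convex hull (F - {(0, 1)})"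
    then have "?s (0, 1) \<in> ?s ` (convex hull (F - {(0, 1)}))" by blast
    also have "\<dots> = convex hull (?s ` (F - {(0, 1)}))"
      by (intro convex_hull_linear_image linearI) auto
    finally show False
      using convex_hull_snd_pos[of "(1, 0)" "?s ` (F - {(0, 1)})"] assms(2)
      by (force simp: F_def open_triangle_def)
  qed
  have "{(1, 0), (0, 1)} \<subseteq> {x. x extreme_point_of (convex hull F)}"
    using 1 2 fin by (auto simp: extreme_point_of_finite_hull_iff F_def)
  moreover have "finite {x. x extreme_point_of (convex hull F)}"
    by (rule finite_subset[OF _ fin]) (auto dest: extreme_point_of_convex_hull)
  ultimately have "card {(1, 0), (0, 1) :: real \<times> real} \<le> num_vertices (convex hull F)"
    unfolding num_vertices_def by (rule card_mono[rotated])
  then show ?thesis by (simp add: F_def)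
qed

lemma num_vertices_segment: "num_vertices (convex hull {(1, 0), (0, 1)}) = 2"
  by (simp add: num_vertices_def extreme_point_of_convex_hull_2 Collect_disj_eq)

text \<open>The extreme points are the smallest generating set, so having at most \<open>m\<close> vertices means
  being generated by some \<open>m\<close> of the points. This form makes measurability visible.\<close>

lemma num_vertices_le_iff:
  fixes S :: "(real \<times> real) set"
  assumes "finite S"
  shows "num_vertices (convex hull S) \<le> m \<longleftrightarrow> (\<exists>J\<subseteq>S. card J \<le> m \<and> S \<subseteq> convex hull J)"
proof
  let ?E = "{v. v extreme_point_of (convex hull S)}"
  have "?E \<subseteq> S" by (auto dest: extreme_point_of_convex_hull)
  moreover have "S \<subseteq> convex hull ?E"
    using Krein_Milman_polytope[OF assms] hull_subset[of S convex] by simp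
  ultimately show "num_vertices (convex hull S) \<le> m \<Longrightarrow> \<exists>J\<subseteq>S. card J \<le> m \<and> S \<subseteq> convex hull J"
    unfolding num_vertices_def by blast
next
  assume "\<exists>J\<subseteq>S. card J \<le> m \<and> S \<subseteq> convex hull J"
  then obtain J where J: "J \<subseteq> S" "card J \<le> m" "S \<subseteq> convex hull J" by blast
  then have "convex hull S = convex hull J"
    by (metis convex_hull_subset hull_mono subset_antisym)
  then have "{v. v extreme_point_of (convex hull S)} \<subseteq> J"
    by (auto dest: extreme_point_of_convex_hull)
  then show "num_vertices (convex hull S) \<le> m"
    unfolding num_vertices_def
    using J card_mono finite_subset[OF J(1) assms] by (meson order_trans)
qed


text \<open>For finitely many points the directions that separate \<open>v\<close> from their hull form an open set, so
  it suffices to test a countable dense set of directions. Membership in the hull thus becomes a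
  countable combination of half-space conditions on the points.\<close>

lemma in_hull_iff_countable_directions:
  fixes p :: "'i \<Rightarrow> 'a::euclidean_space"
  assumes "finite K" and D: "\<And>U :: 'a set. open U \<Longrightarrow> U \<noteq> {} \<Longrightarrow> \<exists>d\<in>D. d \<in> U"
  shows "v \<in> convex hull (p ` K) \<longleftrightarrow> (\<forall>d\<in>D. \<exists>k\<in>K. d \<bullet> (p k - v) \<le> 0)"
proof
  assume v: "v \<in> convex hull (p ` K)"
  show "\<forall>d\<in>D. \<exists>k\<in>K. d \<bullet> (p k - v) \<le> 0"
  proof (rule ccontr)
    assume "\<not> ?thesis"
    then obtain d where "\<forall>k\<in>K. d \<bullet> p k > d \<bullet> v" by (auto simp: inner_diff_right not_le)
    then have "convex hull (p ` K) \<subseteq> {x. d \<bullet> x > d \<bullet> v}"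
      by (intro hull_minimal convex_halfspace_gt) auto
    then show False using v by blast
  qed
next
  assume *: "\<forall>d\<in>D. \<exists>k\<in>K. d \<bullet> (p k - v) \<le> 0"
  show "v \<in> convex hull (p ` K)"
  proof (rule ccontr)
    assume "v \<notin> convex hull (p ` K)"
    moreover have "closed (convex hull (p ` K))"
      using assms(1) by (simp add: compact_imp_closed compact_convex_hull finite_imp_compact)
    ultimately obtain a b where ab: "a \<bullet> v < b" "\<And>x. x \<in> convex hull (p ` K) \<Longrightarrow> a \<bullet> x > b"
      using separating_hyperplane_closed_point[of "convex hull (p ` K)" v] by blast
    let ?U = "\<Inter>k\<in>K. {d. d \<bullet> (p k - v) > 0}"
    have "a \<bullet> (p k - v) > 0" if "k \<in> K" for k
      using ab(1) ab(2)[OF hull_inc[of "p k"]] that by (simp add: inner_diff_right)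
    then have "?U \<noteq> {}" by blast
    moreover have "open ?U"
    proof (intro open_INT assms ballI)
      show "open {d. d \<bullet> (p k - v) > 0}" for k
        by (intro open_Collect_less continuous_intros)
    qed
    ultimately show False using D[of ?U] * by force
  qed
qed

lemma measurable_num_vertices_le:
  assumes "finite I" and [measurable]: "\<And>i. i \<in> I \<Longrightarrow> p i \<in> measurable N borel"
  shows "Measurable.pred N (\<lambda>w. num_vertices (convex hull ((\<lambda>i. p i w) ` I)) \<le> m)"
proof -
  obtain D :: "(real \<times> real) set" where D: "countable D"
    "\<And>U. open U \<Longrightarrow> U \<noteq> {} \<Longrightarrow> \<exists>d\<in>D. d \<in> U"
    using countable_dense_exists[where 'a = "real \<times> real"] by blast
  have "num_vertices (convex hull ((\<lambda>i. p i w) ` I)) \<le> m \<longleftrightarrow>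
      (\<exists>K\<in>{K. K \<subseteq> I \<and> card K \<le> m}. \<forall>i\<in>I. \<forall>d\<in>D. \<exists>k\<in>K. d \<bullet> (p k w - p i w) \<le> 0)" for w
  proof -
    have "(\<exists>J\<subseteq>(\<lambda>i. p i w) ` I. card J \<le> m \<and> (\<lambda>i. p i w) ` I \<subseteq> convex hull J) \<longleftrightarrow>
        (\<exists>K\<subseteq>I. card K \<le> m \<and> (\<lambda>i. p i w) ` I \<subseteq> convex hull ((\<lambda>i. p i w) ` K))" (is "?l \<longleftrightarrow> ?r")
    proof
      assume ?l
      then obtain J where J: "J \<subseteq> (\<lambda>i. p i w) ` I" "card J \<le> m" "(\<lambda>i. p i w) ` I \<subseteq> convex hull J"
        by blast
      then obtain K where "K \<subseteq> I" "inj_on (\<lambda>i. p i w) K" "J = (\<lambda>i. p i w) ` K"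
        by (auto simp: subset_image_inj)
      then show ?r using J by (metis card_image)
    next
      assume ?r
      then obtain K where "K \<subseteq> I" "card K \<le> m" "(\<lambda>i. p i w) ` I \<subseteq> convex hull ((\<lambda>i. p i w) ` K)"
        by blast
      then show ?l
        by (intro exI[of _ "(\<lambda>i. p i w) ` K"])
          (auto intro: order_trans[OF card_image_le] finite_subset[OF _ assms(1)])
    qed
    also have "?r \<longleftrightarrow>
      (\<exists>K\<in>{K. K \<subseteq> I \<and> card K \<le> m}. \<forall>i\<in>I. \<forall>d\<in>D. \<exists>k\<in>K. d \<bullet> (p k w - p i w) \<le> 0)"
      by (auto simp: image_subset_iff
          in_hull_iff_countable_directions[OF finite_subset[OF _ assms(1)] D(2)])
    finally show ?thesis using num_vertices_le_iff[of "(\<lambda>i. p i w) ` I" m] assms(1) by simp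
  qed
  moreover have "Measurable.pred N (\<lambda>w. \<exists>K\<in>{K. K \<subseteq> I \<and> card K \<le> m}. \<forall>i\<in>I. \<forall>d\<in>D. \<exists>k\<in>K.
      d \<bullet> (p k w - p i w) \<le> 0)"
  proof (rule pred_intros_finite(4), goal_cases)
    case (2 K)
    show ?case
    proof (rule pred_intros_finite(3)[OF assms(1)])
      fix i assume "i \<in> I"
      note K = 2
      have "Measurable.pred N (\<lambda>w. \<exists>k\<in>K. d \<bullet> (p k w - p i w) \<le> 0)" for d
      proof (intro pred_intros_finite(4))
        show "finite K" using K finite_subset[OF _ assms(1)] by blast
        fix k assume "k \<in> K"
        then have [measurable]: "p k \<in> measurable N borel" "p i \<in> measurable N borel"
          using K \<open>i \<in> I\<close> assms(2) by auto
        show "Measurable.pred N (\<lambda>w. d \<bullet> (p k w - p i w) \<le> 0)" by measurable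
      qed
      then have "Measurable.pred N (\<lambda>w. \<forall>n. \<exists>k\<in>K. from_nat_into D n \<bullet> (p k w - p i w) \<le> 0)"
        by (intro pred_intros_countable(1))
      moreover have "D \<noteq> {}" using D(2)[of UNIV] by auto
      then have "(\<forall>d\<in>D. Q d) \<longleftrightarrow> (\<forall>n. Q (from_nat_into D n))" for Q
        by (metis D(1) from_nat_into from_nat_into_surj)
      ultimately show "Measurable.pred N (\<lambda>w. \<forall>d\<in>D. \<exists>k\<in>K. d \<bullet> (p k w - p i w) \<le> 0)" by simp
    qed
  qed (use assms(1) in simp)
  ultimately show ?thesis by simp
qed

lemma measurable_num_vertices_eq:
  assumes "finite I" "\<And>i. i \<in> I \<Longrightarrow> p i \<in> measurable N borel"
  shows "Measurable.pred N (\<lambda>w. num_vertices (convex hull ({(1, 0), (0, 1)} \<union> (\<lambda>i. p i w) ` I)) = m)"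
proof -
  \<comment> \<open>Two extra indices stand for the two fixed vertices.\<close>
  define J where "J = insert None (insert (Some None) (Some ` Some ` I))"
  define q where "q = case_option (\<lambda>_. (1, 0)) (case_option (\<lambda>_. (0, 1)) p)"
  have "finite J" using assms by (simp add: J_def)
  moreover have "q j \<in> measurable N borel" if "j \<in> J" for j
    using that assms(2) by (auto simp: J_def q_def)
  ultimately have le: "Measurable.pred N (\<lambda>w. num_vertices (convex hull ((\<lambda>j. q j w) ` J)) \<le> m)" for m
    by (rule measurable_num_vertices_le)
  have img: "(\<lambda>j. q j w) ` J = {(1, 0), (0, 1)} \<union> (\<lambda>i. p i w) ` I" for w
    by (auto simp: J_def q_def image_image)
  have "num_vertices (convex hull ((\<lambda>j. q j w) ` J)) = m \<longleftrightarrow>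
      num_vertices (convex hull ((\<lambda>j. q j w) ` J)) \<le> m \<and>
      \<not> (m \<noteq> 0 \<and> num_vertices (convex hull ((\<lambda>j. q j w) ` J)) \<le> m - 1)" for w
    by auto
  then show ?thesis unfolding img[symmetric] using le by simp
qed

section \<open>Expectations of functionals of finite random sets\<close>

text \<open>A functional \<open>g\<close> of finite sets is made measurable by composing it with the map that sends \<open>n\<close>
  points to the set of these points. The parameter \<open>p\<close> is what allows Fubini's theorem to be used
  when some of the points are integrated separately.\<close>

definition measurable_set_functional ::
    "'p measure \<Rightarrow> ('p \<Rightarrow> 'a::topological_space set \<Rightarrow> ennreal) \<Rightarrow> bool" where
  "measurable_set_functional P g \<longleftrightarrow>
     (\<forall>n. (\<lambda>(p, x). g p (x ` {..<n})) \<in> borel_measurable (P \<Otimes>\<^sub>M (\<Pi>\<^sub>M i\<in>{..<n::nat}. borel)))"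

definition set_expectation :: "'a measure \<Rightarrow> nat \<Rightarrow> ('a set \<Rightarrow> ennreal) \<Rightarrow> ennreal" where
  "set_expectation \<mu> n g = (\<integral>\<^sup>+ x. g (x ` {..<n}) \<partial>(\<Pi>\<^sub>M i\<in>{..<n}. \<mu>))"

lemma measurable_set_functional_compose:
  assumes "measurable_set_functional P g" and [measurable]: "f \<in> measurable Q P"
  shows "measurable_set_functional Q (\<lambda>q. g (f q))"
  unfolding measurable_set_functional_def
proof
  fix n :: nat
  have [measurable]: "(\<lambda>(p, x). g p (x ` {..<n})) \<in> borel_measurable (P \<Otimes>\<^sub>M (\<Pi>\<^sub>M i\<in>{..<n}. borel))"
    using assms(1) by (simp add: measurable_set_functional_def)
  have "(\<lambda>w. (\<lambda>(p, x). g p (x ` {..<n})) (f (fst w), snd w))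
      \<in> borel_measurable (Q \<Otimes>\<^sub>M (\<Pi>\<^sub>M i\<in>{..<n}. borel))"
    by measurable
  then show "(\<lambda>(p, x). g (f p) (x ` {..<n})) \<in> borel_measurable (Q \<Otimes>\<^sub>M (\<Pi>\<^sub>M i\<in>{..<n}. borel))"
    by (simp add: case_prod_beta')
qed

text \<open>The last of \<open>n + 1\<close> points may be treated as a parameter.\<close>

lemma measurable_set_functional_insert:
  assumes "measurable_set_functional P g"
  shows "measurable_set_functional (P \<Otimes>\<^sub>M borel) (\<lambda>w S. g (fst w) (insert (snd w) S))"
  unfolding measurable_set_functional_def
proof
  fix n :: nat
  let ?N = "(P \<Otimes>\<^sub>M borel) \<Otimes>\<^sub>M (\<Pi>\<^sub>M i\<in>{..<n}. borel)"
  have [measurable]: "(\<lambda>(p, x). g p (x ` {..<Suc n}))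
      \<in> borel_measurable (P \<Otimes>\<^sub>M (\<Pi>\<^sub>M i\<in>{..<Suc n}. borel))"
    using assms by (simp add: measurable_set_functional_def)
  have "(\<lambda>w. (snd w)(n := snd (fst w))) \<in> measurable ?N (\<Pi>\<^sub>M i\<in>insert n {..<n}. borel)"
    using measurable_compose[OF _ measurable_add_dim, of "\<lambda>w. (snd w, snd (fst w))" ?N "{..<n}" "\<lambda>_. borel" n]
    by simp
  then have [measurable]: "(\<lambda>w. (snd w)(n := snd (fst w))) \<in> measurable ?N (\<Pi>\<^sub>M i\<in>{..<Suc n}. borel)"
    by (simp add: lessThan_Suc)
  have "(\<lambda>w. (\<lambda>(p, x). g p (x ` {..<Suc n})) (fst (fst w), (snd w)(n := snd (fst w))))
      \<in> borel_measurable ?N"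
    by measurable
  moreover have "(x(n := y)) ` {..<Suc n} = insert y (x ` {..<n})" for x :: "nat \<Rightarrow> 'b" and y
    by (auto simp: lessThan_Suc)
  ultimately show "(\<lambda>(p, x). g (fst p) (insert (snd p) (x ` {..<n}))) \<in> borel_measurable ?N"
    by (simp add: case_prod_beta')
qed

lemma measurable_set_functional_insert':
  assumes "measurable_set_functional P g" "f \<in> measurable Q P" "h \<in> measurable Q borel"
  shows "measurable_set_functional Q (\<lambda>q S. g (f q) (insert (h q) S))"
  using measurable_set_functional_compose[OF measurable_set_functional_insert[OF assms(1)],
      of "\<lambda>q. (f q, h q)" Q] assms(2,3) by simp

lemma measurable_set_functional_mult:
  assumes "measurable_set_functional P g" "measurable_set_functional P h"
  shows "measurable_set_functional P (\<lambda>p S. g p S * h p S)"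
  using assms unfolding measurable_set_functional_def case_prod_beta'
  by (intro allI borel_measurable_times_ennreal) (erule spec)+

lemma measurable_set_functional_all:
  assumes "\<And>n. Measurable.pred (P \<Otimes>\<^sub>M (\<Pi>\<^sub>M i\<in>{..<n::nat}. borel)) (\<lambda>w. \<forall>i<n. R (fst w) (snd w i))"
  shows "measurable_set_functional P (\<lambda>p S. indicator {S. \<forall>x\<in>S. R p x} S)"
  unfolding measurable_set_functional_def
proof
  fix n :: nat
  have "(\<lambda>w. if \<forall>i<n. R (fst w) (snd w i) then 1 else 0 :: ennreal)
      \<in> borel_measurable (P \<Otimes>\<^sub>M (\<Pi>\<^sub>M i\<in>{..<n}. borel))"
    by (rule measurable_If[OF measurable_const measurable_const predE[OF assms[of n]]]) auto
  also have "(\<lambda>w. if \<forall>i<n. R (fst w) (snd w i) then 1 else 0 :: ennreal)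
      = (\<lambda>(p, x). indicator {S. \<forall>x\<in>S. R p x} (x ` {..<n}))"
    by (auto simp: fun_eq_iff indicator_def)
  finally show "(\<lambda>(p, x). indicator {S. \<forall>x\<in>S. R p x} (x ` {..<n}) :: ennreal)
      \<in> borel_measurable (P \<Otimes>\<^sub>M (\<Pi>\<^sub>M i\<in>{..<n}. borel))" .
qed

lemma measurable_set_functional_image:
  assumes "measurable_set_functional P g" and [measurable]: "V \<in> measurable borel borel"
  shows "measurable_set_functional P (\<lambda>p S. g p (V ` S))"
  unfolding measurable_set_functional_def
proof
  fix n :: nat
  let ?N = "P \<Otimes>\<^sub>M (\<Pi>\<^sub>M i\<in>{..<n}. borel)"
  have [measurable]: "(\<lambda>(p, x). g p (x ` {..<n})) \<in> borel_measurable (P \<Otimes>\<^sub>M (\<Pi>\<^sub>M i\<in>{..<n}. borel))"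
    using assms(1) by (simp add: measurable_set_functional_def)
  have "(\<lambda>w. (\<lambda>(p, x). g p (x ` {..<n})) (fst w, \<lambda>i\<in>{..<n}. V (snd w i))) \<in> borel_measurable ?N"
    by measurable
  moreover have "(\<lambda>i\<in>{..<n}. V (x i)) ` {..<n} = V ` x ` {..<n}" for x :: "nat \<Rightarrow> _"
    by (auto simp: image_iff)
  ultimately show "(\<lambda>(p, x). g p (V ` (x ` {..<n}))) \<in> borel_measurable ?N"
    by (simp add: case_prod_beta')
qed

abbreviation measurable_functional :: "('a::topological_space set \<Rightarrow> ennreal) \<Rightarrow> bool" where
  "measurable_functional g \<equiv> measurable_set_functional (borel :: 'a measure) (\<lambda>_. g)"

locale borel_prob_space = prob_space \<mu> for \<mu> :: "'a::topological_space measure" +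
  assumes sets_eq_borel [measurable_cong]: "sets \<mu> = sets borel"
begin

lemma sets_PiM_eq: "sets (\<Pi>\<^sub>M i\<in>I. \<mu>) = sets (\<Pi>\<^sub>M i\<in>I. borel)"
  by (intro sets_PiM_cong) (auto simp: sets_eq_borel)

lemma measurable_functionalD:
  "measurable_functional g \<Longrightarrow> (\<lambda>x. g (x ` {..<n})) \<in> borel_measurable (\<Pi>\<^sub>M i\<in>{..<n::nat}. \<mu>)"
  unfolding measurable_set_functional_def measurable_cong_sets[OF sets_PiM_eq refl]
  by (drule spec[of _ n], drule measurable_compose[rotated, where f = "\<lambda>x. (undefined, x)"]) auto

lemma borel_measurable_set_expectation:
  assumes "measurable_set_functional P g"
  shows "(\<lambda>p. set_expectation \<mu> n (g p)) \<in> borel_measurable P"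
proof -
  interpret product_prob_space "\<lambda>_::nat. \<mu>" "{..<n}" ..
  have "(\<lambda>(p, x). g p (x ` {..<n})) \<in> borel_measurable (P \<Otimes>\<^sub>M (\<Pi>\<^sub>M i\<in>{..<n}. \<mu>))"
    using assms unfolding measurable_set_functional_def
      measurable_cong_sets[OF sets_pair_measure_cong[OF refl sets_PiM_eq] refl] by blast
  then show ?thesis
    unfolding set_expectation_def by (rule borel_measurable_nn_integral)
qed

lemma set_expectation_0: "set_expectation \<mu> 0 g = g {}"
  by (simp add: set_expectation_def PiM_empty nn_integral_count_space_finite)

lemma set_expectation_Suc:
  assumes "measurable_functional g"
  shows "set_expectation \<mu> (Suc n) g = (\<integral>\<^sup>+ y. set_expectation \<mu> n (\<lambda>S. g (insert y S)) \<partial>\<mu>)"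
proof -
  interpret product_sigma_finite "\<lambda>_::nat. \<mu>" ..
  have "(\<integral>\<^sup>+ x. g (x ` {..<Suc n}) \<partial>(\<Pi>\<^sub>M i\<in>insert n {..<n}. \<mu>))
      = (\<integral>\<^sup>+ y. \<integral>\<^sup>+ x. g ((x(n := y)) ` {..<Suc n}) \<partial>(\<Pi>\<^sub>M i\<in>{..<n}. \<mu>) \<partial>\<mu>)"
    using measurable_functionalD[OF assms, of "Suc n"]
    by (intro product_nn_integral_insert_rev) (auto simp: lessThan_Suc)
  moreover have "(x(n := y)) ` {..<Suc n} = insert y (x ` {..<n})" for x :: "nat \<Rightarrow> 'a" and y
    by (auto simp: lessThan_Suc)
  ultimately show ?thesis by (simp add: set_expectation_def lessThan_Suc)
qed

lemma set_expectation_cong_AE: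
  assumes "AE y in \<mu>. y \<in> T" "\<And>S. finite S \<Longrightarrow> S \<subseteq> T \<Longrightarrow> g S = h S"
  shows "set_expectation \<mu> n g = set_expectation \<mu> n h"
proof -
  have "AE x in (\<Pi>\<^sub>M i\<in>{..<n}. \<mu>). \<forall>i\<in>{..<n}. x i \<in> T"
    using assms(1) by (intro AE_finite_allI AE_PiM_component) (auto intro: prob_space_axioms)
  then show ?thesis
    unfolding set_expectation_def
    by (intro nn_integral_cong_AE, elim eventually_mono) (auto intro!: assms(2))
qed

lemma set_expectation_cong:
  "(\<And>S. finite S \<Longrightarrow> g S = h S) \<Longrightarrow> set_expectation \<mu> n g = set_expectation \<mu> n h"
  by (rule set_expectation_cong_AE[of UNIV]) auto

lemma set_expectation_zero: "set_expectation \<mu> n (\<lambda>S. 0) = 0"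
  by (simp add: set_expectation_def)

lemma measurable_functional_insert:
  "measurable_functional g \<Longrightarrow> measurable_set_functional borel (\<lambda>y S. g (insert y S))"
  using measurable_set_functional_insert'[of borel "\<lambda>_. g" "\<lambda>x. x" borel "\<lambda>x. x"] by simp


lemma AE_not_eq_imp_split:
  assumes "AE z in \<mu>. \<sigma> z \<noteq> (c::real)" and [measurable]: "\<sigma> \<in> borel_measurable borel"
    "f \<in> borel_measurable borel"
  shows "(\<integral>\<^sup>+ z. f z \<partial>\<mu>) = (\<integral>\<^sup>+ z. (if c > \<sigma> z then f z else 0) \<partial>\<mu>) + (\<integral>\<^sup>+ z. (if \<sigma> z > c then f z else 0) \<partial>\<mu>)"
proof -
  have "(\<integral>\<^sup>+ z. f z \<partial>\<mu>) = (\<integral>\<^sup>+ z. (if c > \<sigma> z then f z else 0) + (if \<sigma> z > c then f z else 0) \<partial>\<mu>)"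
    using assms(1) by (intro nn_integral_cong_AE) (auto elim!: eventually_mono)
  also have "\<dots> = (\<integral>\<^sup>+ z. (if c > \<sigma> z then f z else 0) \<partial>\<mu>) + (\<integral>\<^sup>+ z. (if \<sigma> z > c then f z else 0) \<partial>\<mu>)"
    by (rule nn_integral_add) measurable
  finally show ?thesis .
qed

text \<open>Ties are null events and the points are exchangeable, so each of the \<open>n + 1\<close> points is the lowest
  one with the same weight. The induction proves this without permuting coordinates: the first point
  \<open>y\<close> is compared with the lowest point \<open>z\<close> of the others. If \<open>y\<close> is above \<open>z\<close>, it just joins the
  points above \<open>z\<close>; if it is below, the induction hypothesis is applied once more, backwards, to the
  functional that records that all other points are above \<open>y\<close>.\<close>

lemma set_expectation_select_min:
  fixes \<sigma> :: "'a \<Rightarrow> real"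
  assumes \<sigma> [measurable]: "\<sigma> \<in> borel_measurable borel" and atomless: "\<And>c. AE x in \<mu>. \<sigma> x \<noteq> c"
    and "measurable_functional g"
  shows "set_expectation \<mu> (Suc n) g = of_nat (Suc n) *
     (\<integral>\<^sup>+ y. set_expectation \<mu> n (\<lambda>S. indicator {S. \<forall>x\<in>S. \<sigma> x > \<sigma> y} S * g (insert y S)) \<partial>\<mu>)"
  using assms(3)
proof (induction n arbitrary: g)
  case 0
  then show ?case by (simp add: set_expectation_0 set_expectation_Suc)
next
  case (Suc n)
  interpret pair_sigma_finite \<mu> \<mu> ..
  define m where "m y S = (indicator {S. \<forall>x\<in>S. \<sigma> x > \<sigma> y} S :: ennreal)" for y S
  have m_insert: "m y (insert x S) = (if \<sigma> x > \<sigma> y then m y S else 0)" for x y S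
    by (auto simp: m_def indicator_def)
  have m_msf: "measurable_set_functional borel m"
    unfolding m_def
    by (rule measurable_set_functional_all) measurable
  have g1: "measurable_set_functional borel (\<lambda>y S. g (insert y S))"
    by (rule measurable_functional_insert[OF Suc.prems])
  have gf: "measurable_functional (\<lambda>S. g (insert y S))" for y
    using measurable_set_functional_compose[OF g1, of "\<lambda>_. y" borel] by simp
  define h where "h y S = m y S * g (insert y S)" for y S
  have h_msf: "measurable_set_functional borel h"
    unfolding h_def by (rule measurable_set_functional_mult[OF m_msf g1])
  have hf: "measurable_functional (h y)" for y
    using measurable_set_functional_compose[OF h_msf, of "\<lambda>_. y" borel] by simp
  define q where "q y z S = m z S * g (insert y (insert z S))" for y z S
  have q_msf: "measurable_set_functional (borel \<Otimes>\<^sub>M borel) (\<lambda>w. q (fst w) (snd w))"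
    unfolding q_def
    by (rule measurable_set_functional_mult[OF measurable_set_functional_compose[OF m_msf measurable_snd]
        measurable_set_functional_insert'[OF g1 measurable_fst measurable_snd]])
  have qf: "measurable_functional (q y z)" for y z
    using measurable_set_functional_compose[OF q_msf, of "\<lambda>_. (y, z)" borel] by simp
  define Q where "Q y z = set_expectation \<mu> n (q y z)" for y z
  have Q2 [measurable]: "(\<lambda>w. Q (fst w) (snd w)) \<in> borel_measurable (borel \<Otimes>\<^sub>M borel)"
    unfolding Q_def by (rule borel_measurable_set_expectation[OF q_msf])
  have [measurable]: "(\<lambda>w. Q (snd w) (fst w)) \<in> borel_measurable (borel \<Otimes>\<^sub>M borel)"
    using measurable_compose[OF measurable_pair_swap' Q2] by (simp add: case_prod_beta')
  have Q_meas: "(\<lambda>z. Q y z) \<in> borel_measurable borel" for y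
    using measurable_compose[OF _ Q2, of "\<lambda>z. (y, z)" borel] by simp
  have Q_if: "(if b then Q y z else 0) = set_expectation \<mu> n (\<lambda>S. (if b then 1 else 0) * q y z S)" for b y z
    by (simp add: Q_def set_expectation_zero)

  have "set_expectation \<mu> (Suc (Suc n)) g
      = (\<integral>\<^sup>+ y. of_nat (Suc n) * (\<integral>\<^sup>+ z. Q y z \<partial>\<mu>) \<partial>\<mu>)"
    using Suc.IH[OF gf] unfolding set_expectation_Suc[OF Suc.prems] Q_def q_def m_def by simp
  also have "\<dots> = of_nat (Suc n) * (\<integral>\<^sup>+ y. (\<integral>\<^sup>+ z. Q y z \<partial>\<mu>) \<partial>\<mu>)"
    by (rule nn_integral_cmult) measurable
  also have "(\<integral>\<^sup>+ y. (\<integral>\<^sup>+ z. Q y z \<partial>\<mu>) \<partial>\<mu>)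
      = (\<integral>\<^sup>+ y. (\<integral>\<^sup>+ z. (if \<sigma> y > \<sigma> z then Q y z else 0) \<partial>\<mu>)
              + (\<integral>\<^sup>+ z. (if \<sigma> z > \<sigma> y then Q y z else 0) \<partial>\<mu>) \<partial>\<mu>)"
    by (intro nn_integral_cong AE_not_eq_imp_split atomless \<sigma> Q_meas)
  also have "\<dots> = (\<integral>\<^sup>+ y. (\<integral>\<^sup>+ z. (if \<sigma> y > \<sigma> z then Q y z else 0) \<partial>\<mu>) \<partial>\<mu>)
              + (\<integral>\<^sup>+ y. (\<integral>\<^sup>+ z. (if \<sigma> z > \<sigma> y then Q y z else 0) \<partial>\<mu>) \<partial>\<mu>)"
    by (rule nn_integral_add) measurable
  also have "(\<integral>\<^sup>+ y. (\<integral>\<^sup>+ z. (if \<sigma> y > \<sigma> z then Q y z else 0) \<partial>\<mu>) \<partial>\<mu>)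
      = (\<integral>\<^sup>+ z. (\<integral>\<^sup>+ y. (if \<sigma> y > \<sigma> z then Q y z else 0) \<partial>\<mu>) \<partial>\<mu>)"
    by (rule Fubini') measurable
  also have "\<dots> = (\<integral>\<^sup>+ z. set_expectation \<mu> (Suc n) (h z) \<partial>\<mu>)"
  proof (intro nn_integral_cong)
    fix z
    have "h z (insert y S) = (if \<sigma> y > \<sigma> z then 1 else 0) * q y z S" for y S
      by (simp add: h_def q_def m_insert insert_commute)
    then show "(\<integral>\<^sup>+ y. (if \<sigma> y > \<sigma> z then Q y z else 0) \<partial>\<mu>) = set_expectation \<mu> (Suc n) (h z)"
      by (simp add: Q_if set_expectation_Suc[OF hf])
  qed
  also have "of_nat (Suc n) * (\<dots> + (\<integral>\<^sup>+ y. (\<integral>\<^sup>+ z. (if \<sigma> z > \<sigma> y then Q y z else 0) \<partial>\<mu>) \<partial>\<mu>))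
      = of_nat (Suc n) * \<dots>
        + (\<integral>\<^sup>+ y. of_nat (Suc n) * (\<integral>\<^sup>+ z. (if \<sigma> z > \<sigma> y then Q y z else 0) \<partial>\<mu>) \<partial>\<mu>)"
    by (subst nn_integral_cmult, measurable) (simp add: distrib_left)
  also have "(\<integral>\<^sup>+ y. of_nat (Suc n) * (\<integral>\<^sup>+ z. (if \<sigma> z > \<sigma> y then Q y z else 0) \<partial>\<mu>) \<partial>\<mu>)
      = (\<integral>\<^sup>+ y. set_expectation \<mu> (Suc n) (h y) \<partial>\<mu>)"
  proof (intro nn_integral_cong)
    fix y
    have "m z S * h y (insert z S) = (if \<sigma> z > \<sigma> y then 1 else 0) * q y z S" for z S
    proof -
      have "m z S * m y S = m z S" if "\<sigma> z > \<sigma> y"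
        using that by (force simp: m_def indicator_def)
      then show ?thesis by (simp add: h_def q_def m_insert mult.assoc[symmetric])
    qed
    then show "of_nat (Suc n) * (\<integral>\<^sup>+ z. (if \<sigma> z > \<sigma> y then Q y z else 0) \<partial>\<mu>)
        = set_expectation \<mu> (Suc n) (h y)"
      unfolding Suc.IH[OF hf] m_def[symmetric] by (simp add: Q_if)
  qed
  also have "of_nat (Suc n) * (\<integral>\<^sup>+ y. set_expectation \<mu> (Suc n) (h y) \<partial>\<mu>)
        + (\<integral>\<^sup>+ y. set_expectation \<mu> (Suc n) (h y) \<partial>\<mu>)
      = of_nat (Suc (Suc n)) * (\<integral>\<^sup>+ y. set_expectation \<mu> (Suc n) (h y) \<partial>\<mu>)"
    by (simp only: of_nat_Suc[of "Suc n"] distrib_right mult_1_left) (simp only: add.commute)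
  finally show ?case unfolding h_def m_def .
qed

lemma pascal_step:
  fixes a b :: "'b::comm_semiring_1"
  shows "a * (\<Sum>m\<le>n. of_nat (n choose m) * a ^ (n - m) * b ^ m * w m)
     + b * (\<Sum>m\<le>n. of_nat (n choose m) * a ^ (n - m) * b ^ m * w (Suc m))
     = (\<Sum>m\<le>Suc n. of_nat (Suc n choose m) * a ^ (Suc n - m) * b ^ m * w m)"
proof -
  have "(\<Sum>m\<le>Suc n. of_nat (Suc n choose m) * a ^ (Suc n - m) * b ^ m * w m)
      = a ^ Suc n * w 0 + (\<Sum>m\<le>n. of_nat (Suc n choose Suc m) * a ^ (n - m) * b ^ Suc m * w (Suc m))"
    by (simp only: sum.atMost_Suc_shift) simp
  also have "\<dots> = a ^ Suc n * w 0 + (\<Sum>m\<le>n. of_nat (n choose Suc m) * a ^ (n - m) * b ^ Suc m * w (Suc m))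
      + (\<Sum>m\<le>n. of_nat (n choose m) * a ^ (n - m) * b ^ Suc m * w (Suc m))"
    by (simp add: algebra_simps sum.distrib)
  also have "a ^ Suc n * w 0 + (\<Sum>m\<le>n. of_nat (n choose Suc m) * a ^ (n - m) * b ^ Suc m * w (Suc m))
      = (\<Sum>m\<le>Suc n. of_nat (n choose m) * a ^ (Suc n - m) * b ^ m * w m)"
    by (simp only: sum.atMost_Suc_shift) simp
  also have "\<dots> = (\<Sum>m\<le>n. of_nat (n choose m) * a ^ (Suc n - m) * b ^ m * w m)"
    by (simp add: binomial_eq_0)
  finally show ?thesis
    by (simp add: sum_distrib_left Suc_diff_le algebra_simps)
qed

text \<open>Binomial thinning. Every point in \<open>D\<close> is either in \<open>A\<close>, where it has no influence on \<open>g\<close>, or in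
  the rest of \<open>D\<close>, where it is distributed like the image under \<open>V\<close> of a point with law \<open>\<mu>\<close> and
  carries total mass \<open>b\<close>.\<close>

lemma set_expectation_thinning:
  assumes [measurable]: "A \<in> sets borel" "D \<in> sets borel" "V \<in> measurable borel borel"
    and "A \<subseteq> D" "AE x in \<mu>. V x \<in> D"
    and split: "\<And>f. f \<in> borel_measurable borel \<Longrightarrow>
      (\<integral>\<^sup>+ x. indicator D x * f x \<partial>\<mu>) = (\<integral>\<^sup>+ x. indicator A x * f x \<partial>\<mu>) + b * (\<integral>\<^sup>+ x. f (V x) \<partial>\<mu>)"
    and "measurable_functional g" "\<And>x S. finite S \<Longrightarrow> S \<subseteq> D \<Longrightarrow> x \<in> A \<Longrightarrow> g (insert x S) = g S"
  shows "set_expectation \<mu> n (\<lambda>S. indicator (Pow D) S * g S) =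
    (\<Sum>m\<le>n. of_nat (n choose m) * emeasure \<mu> A ^ (n - m) * b ^ m * set_expectation \<mu> m (\<lambda>S. g (V ` S)))"
  using assms(7,8)
proof (induction n arbitrary: g)
  case 0
  then show ?case by (simp add: set_expectation_0)
next
  case (Suc n)
  have g1: "measurable_set_functional borel (\<lambda>y S. g (insert y S))"
    by (rule measurable_functional_insert[OF Suc.prems(1)])
  have gf: "measurable_functional (\<lambda>S. g (insert y S))" for y
    using measurable_set_functional_compose[OF g1, of "\<lambda>_. y" borel] by simp
  have PowD: "measurable_set_functional P (\<lambda>_. indicator (Pow D))" for P :: "'c measure"
  proof -
    have "measurable_set_functional P (\<lambda>_ S. indicator {S. \<forall>x\<in>S. x \<in> D} S)"
      by (rule measurable_set_functional_all) measurable
    moreover have "{S. \<forall>x\<in>S. x \<in> D} = Pow D" by auto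
    ultimately show ?thesis by simp
  qed
  define H where "H y = set_expectation \<mu> n (\<lambda>S. indicator (Pow D) S * g (insert y S))" for y
  have H [measurable]: "H \<in> borel_measurable borel"
    unfolding H_def
    by (intro borel_measurable_set_expectation measurable_set_functional_mult g1 PowD)
  define w where "w m = set_expectation \<mu> m (\<lambda>S. g (V ` S))" for m
  have "set_expectation \<mu> (Suc n) (\<lambda>S. indicator (Pow D) S * g S) = (\<integral>\<^sup>+ y. indicator D y * H y \<partial>\<mu>)"
  proof (subst set_expectation_Suc)
    show "measurable_functional (\<lambda>S. indicator (Pow D) S * g S)"
      by (intro measurable_set_functional_mult PowD Suc.prems(1))
    show "(\<integral>\<^sup>+ y. set_expectation \<mu> n (\<lambda>S. indicator (Pow D) (insert y S) * g (insert y S)) \<partial>\<mu>)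
        = (\<integral>\<^sup>+ y. indicator D y * H y \<partial>\<mu>)"
    proof (intro nn_integral_cong)
      fix y
      show "set_expectation \<mu> n (\<lambda>S. indicator (Pow D) (insert y S) * g (insert y S)) = indicator D y * H y"
        by (cases "y \<in> D") (auto simp: H_def set_expectation_zero indicator_def)
    qed
  qed
  also have "\<dots> = (\<integral>\<^sup>+ y. indicator A y * H y \<partial>\<mu>) + b * (\<integral>\<^sup>+ y. H (V y) \<partial>\<mu>)"
    by (rule split[OF H])
  also have "(\<integral>\<^sup>+ y. indicator A y * H y \<partial>\<mu>)
      = (\<integral>\<^sup>+ y. set_expectation \<mu> n (\<lambda>S. indicator (Pow D) S * g S) * indicator A y \<partial>\<mu>)"
  proof (intro nn_integral_cong)
    fix y
    have "H y = set_expectation \<mu> n (\<lambda>S. indicator (Pow D) S * g S)" if "y \<in> A"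
      unfolding H_def by (rule set_expectation_cong) (use that Suc.prems(2) in \<open>auto simp: indicator_def\<close>)
    then show "indicator A y * H y = set_expectation \<mu> n (\<lambda>S. indicator (Pow D) S * g S) * indicator A y"
      by (auto simp: indicator_def)
  qed
  also have "\<dots> = emeasure \<mu> A * set_expectation \<mu> n (\<lambda>S. indicator (Pow D) S * g S)"
    by (subst nn_integral_cmult) (auto simp: mult.commute)
  also have "\<dots> = emeasure \<mu> A * (\<Sum>m\<le>n. of_nat (n choose m) * emeasure \<mu> A ^ (n - m) * b ^ m * w m)"
    using Suc.IH[OF Suc.prems] by (simp add: w_def)
  also have "(\<integral>\<^sup>+ y. H (V y) \<partial>\<mu>) = (\<integral>\<^sup>+ y. (\<Sum>m\<le>n. of_nat (n choose m) * emeasure \<mu> A ^ (n - m) * b ^ m *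
      set_expectation \<mu> m (\<lambda>S. g (V ` insert y S))) \<partial>\<mu>)"
    using assms(5)
  proof (intro nn_integral_cong_AE, elim eventually_mono)
    fix y assume "V y \<in> D"
    then have "g (insert (V y) (insert x S)) = g (insert (V y) S)" if "finite S" "S \<subseteq> D" "x \<in> A" for x S
      using Suc.prems(2)[of "insert (V y) S" x] that by (simp add: insert_commute)
    then show "H (V y) = (\<Sum>m\<le>n. of_nat (n choose m) * emeasure \<mu> A ^ (n - m) * b ^ m *
      set_expectation \<mu> m (\<lambda>S. g (V ` insert y S)))"
      using Suc.IH[OF gf[of "V y"]] by (simp add: H_def)
  qed
  also have "\<dots> = (\<Sum>m\<le>n. of_nat (n choose m) * emeasure \<mu> A ^ (n - m) * b ^ m * w (Suc m))"
  proof -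
    have mV: "measurable_functional (\<lambda>S. g (V ` S))"
      by (rule measurable_set_functional_image[OF Suc.prems(1)]) measurable
    then have "(\<lambda>y. set_expectation \<mu> m (\<lambda>S. g (V ` insert y S))) \<in> borel_measurable borel" for m
      using borel_measurable_set_expectation[OF measurable_functional_insert] by blast
    then show ?thesis
      by (subst nn_integral_sum) (auto simp: w_def nn_integral_cmult set_expectation_Suc[OF mV] simp del: image_insert intro!: sum.cong)
  qed
  also have "emeasure \<mu> A * (\<Sum>m\<le>n. of_nat (n choose m) * emeasure \<mu> A ^ (n - m) * b ^ m * w m)
      + b * (\<Sum>m\<le>n. of_nat (n choose m) * emeasure \<mu> A ^ (n - m) * b ^ m * w (Suc m))
      = (\<Sum>m\<le>Suc n. of_nat (Suc n choose m) * emeasure \<mu> A ^ (Suc n - m) * b ^ m * w m)"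
    by (rule pascal_step)
  finally show ?case unfolding w_def .
qed

text \<open>Only the number of independent points matters, not the set that indexes them.\<close>

lemma nn_integral_PiM_image:
  assumes "finite I" "\<And>J :: nat set. finite J \<Longrightarrow> (\<lambda>x. g (x ` J)) \<in> borel_measurable (\<Pi>\<^sub>M i\<in>J. borel)"
  shows "(\<integral>\<^sup>+ x. g (x ` I) \<partial>(\<Pi>\<^sub>M i\<in>(I :: nat set). \<mu>)) = set_expectation \<mu> (card I) g"
  using assms
proof (induction I arbitrary: g rule: finite_induct)
  case empty
  interpret product_sigma_finite "\<lambda>_::nat. \<mu>" ..
  show ?case by (simp add: PiM_empty nn_integral_count_space_finite set_expectation_0)
next
  case (insert i I)
  interpret product_sigma_finite "\<lambda>_::nat. \<mu>" ..
  have gi: "(\<lambda>x. g (insert y (x ` J))) \<in> borel_measurable (\<Pi>\<^sub>M i\<in>J. borel)" if J: "finite J" for y and J :: "nat set"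
  proof -
    obtain k where k: "k \<notin> J" using ex_new_if_finite[OF infinite_UNIV_nat J] by blast
    have "(\<lambda>x. x(k := y)) \<in> measurable (\<Pi>\<^sub>M i\<in>J. borel) (\<Pi>\<^sub>M i\<in>insert k J. borel)"
      using measurable_compose[OF _ measurable_add_dim, of "\<lambda>x. (x, y)" "\<Pi>\<^sub>M i\<in>J. borel" J "\<lambda>_. borel" k]
      by simp
    from measurable_compose[OF this insert.prems[of "insert k J"]] J
    have "(\<lambda>x. g ((x(k := y)) ` insert k J)) \<in> borel_measurable (\<Pi>\<^sub>M i\<in>J. borel)" by simp
    moreover have "(x(k := y)) ` insert k J = insert y (x ` J)" for x :: "nat \<Rightarrow> 'a"
      using k by (auto simp: image_iff)
    ultimately show ?thesis by simp
  qed
  have "measurable_functional g"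
    unfolding measurable_set_functional_def
  proof
    fix n :: nat
    from measurable_compose[OF measurable_snd insert.prems[of "{..<n}"]]
    show "(\<lambda>(p, x). g (x ` {..<n})) \<in> borel_measurable (borel \<Otimes>\<^sub>M (\<Pi>\<^sub>M i\<in>{..<n}. borel))"
      by (simp add: case_prod_beta')
  qed
  note Suc = set_expectation_Suc[OF this]
  have "(\<integral>\<^sup>+ x. g (x ` insert i I) \<partial>(\<Pi>\<^sub>M i\<in>insert i I. \<mu>))
      = (\<integral>\<^sup>+ y. (\<integral>\<^sup>+ x. g ((x(i := y)) ` insert i I) \<partial>(\<Pi>\<^sub>M i\<in>I. \<mu>)) \<partial>\<mu>)"
  proof (rule product_nn_integral_insert_rev)
    have "sets (\<Pi>\<^sub>M i\<in>insert i I. \<mu>) = sets (\<Pi>\<^sub>M i\<in>insert i I. borel)"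
      by (intro sets_PiM_cong) (auto simp: sets_eq_borel)
    then show "(\<lambda>x. g (x ` insert i I)) \<in> borel_measurable (\<Pi>\<^sub>M i\<in>insert i I. \<mu>)"
      using insert.prems[of "insert i I"] insert.hyps by (simp cong: measurable_cong_sets)
  qed (use insert.hyps in auto)
  also have "\<dots> = (\<integral>\<^sup>+ y. (\<integral>\<^sup>+ x. g (insert y (x ` I)) \<partial>(\<Pi>\<^sub>M i\<in>I. \<mu>)) \<partial>\<mu>)"
  proof -
    have "(x(i := y)) ` insert i I = insert y (x ` I)" for x :: "nat \<Rightarrow> 'a" and y
      using insert.hyps by (auto simp: image_iff)
    then show ?thesis by simp
  qed
  also have "\<dots> = (\<integral>\<^sup>+ y. set_expectation \<mu> (card I) (\<lambda>S. g (insert y S)) \<partial>\<mu>)"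
    using insert.IH[of "\<lambda>S. g (insert _ S)", OF gi] by simp
  finally show ?case using insert.hyps by (simp add: Suc)
qed

end

section \<open>Uniform points in the triangle\<close>

abbreviation uniform_triangle :: "(real \<times> real) measure" where
  "uniform_triangle \<equiv> uniform_measure lborel triangle"

lemma triangle_eq: "triangle = {p. 0 \<le> fst p \<and> 0 \<le> snd p \<and> fst p + snd p \<le> 1}"
proof (intro set_eqI iffI)
  fix p :: "real \<times> real"
  assume p: "p \<in> triangle"
  have "1 * fst p + 0 * snd p \<ge> 0" "0 * fst p + 1 * snd p \<ge> 0" "(-1) * fst p + (-1) * snd p \<ge> -1"
    by (rule convex_hull_fst_snd_ge[OF p[unfolded triangle_def]]; force)+
  then show "p \<in> {p. 0 \<le> fst p \<and> 0 \<le> snd p \<and> fst p + snd p \<le> 1}" by simp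
next
  fix p :: "real \<times> real"
  assume p: "p \<in> {p. 0 \<le> fst p \<and> 0 \<le> snd p \<and> fst p + snd p \<le> 1}"
  then have "p = (1 - fst p - snd p) *\<^sub>R (0, 0) + fst p *\<^sub>R (1, 0) + snd p *\<^sub>R (0, 1)"
    by (simp add: prod_eq_iff)
  then show "p \<in> triangle"
    using p unfolding triangle_def convex_hull_3
    by (intro CollectI exI[of _ "1 - fst p - snd p"] exI[of _ "fst p"] exI[of _ "snd p"] conjI) auto
qed

lemma triangle_borel [measurable]: "triangle \<in> sets borel"
  unfolding triangle_eq by (intro borel_closed closed_Collect_conj closed_Collect_le continuous_intros)

lemma open_triangle_borel [measurable]: "open_triangle \<in> sets borel"
  unfolding open_triangle_def by (intro borel_open open_Collect_conj open_Collect_less continuous_intros)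

lemma AE_lborel_not_on_line:
  assumes "a \<noteq> 0 \<or> b \<noteq> 0"
  shows "AE p in lborel. a * fst p + b * snd p \<noteq> (c::real)"
proof -
  have "{p. (a, b) \<bullet> p = c} \<in> null_sets lborel"
    using negligible_hyperplane[of "(a, b)" c] assms
    by (simp add: negligible_iff_null_sets null_sets_completion_iff zero_prod_def)
  then have "AE p in lborel. p \<notin> {p. (a, b) \<bullet> p = c}" by (rule AE_not_in)
  then show ?thesis by (simp add: inner_prod_def)
qed

lemma AE_triangle_iff_open: "AE p in lborel. p \<in> triangle \<longleftrightarrow> p \<in> open_triangle"
proof -
  have "AE p in lborel. 1 * fst p + 0 * snd p \<noteq> (0::real)" "AE p in lborel. 0 * fst p + 1 * snd p \<noteq> (0::real)"
    "AE p in lborel. 1 * fst p + 1 * snd p \<noteq> (1::real)"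
    by (rule AE_lborel_not_on_line; simp)+
  then show ?thesis
    by eventually_elim (auto simp: triangle_eq open_triangle_def)
qed

lemma nn_integral_lborel_real_prod:
  assumes [measurable]: "f \<in> borel_measurable borel"
  shows "(\<integral>\<^sup>+ p. f p \<partial>(lborel :: (real \<times> real) measure)) = (\<integral>\<^sup>+ x. \<integral>\<^sup>+ y. f (x, y) \<partial>lborel \<partial>lborel)"
proof -
  have "(\<integral>\<^sup>+ p. f p \<partial>(lborel :: (real \<times> real) measure)) = (\<integral>\<^sup>+ p. f p \<partial>(lborel \<Otimes>\<^sub>M lborel))"
    by (simp only: lborel_prod)
  also have "\<dots> = (\<integral>\<^sup>+ x. \<integral>\<^sup>+ y. f (x, y) \<partial>lborel \<partial>lborel)"
    by (rule lborel.nn_integral_fst[symmetric]) (simp add: lborel_prod)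
  finally show ?thesis .
qed

lemma borel_measurable_inner_lborel:
  fixes f :: "real \<times> real \<Rightarrow> ennreal"
  assumes "f \<in> borel_measurable borel"
  shows "(\<lambda>x. \<integral>\<^sup>+ y. f (x, y) \<partial>lborel) \<in> borel_measurable borel"
proof (rule lborel.borel_measurable_nn_integral)
  have eq: "sets (borel \<Otimes>\<^sub>M lborel) = sets (borel :: (real \<times> real) measure)"
    unfolding borel_prod[symmetric] by (intro sets_pair_measure_cong) auto
  show "(\<lambda>(x, y). f (x, y)) \<in> borel_measurable (borel \<Otimes>\<^sub>M lborel)"
    unfolding measurable_cong_sets[OF eq refl] using assms by simp
qed

text \<open>The coordinates \<open>(x, y) = (1 - t, t s)\<close>, where \<open>s\<close> tells the line through \<open>(1, 0)\<close> and \<open>t\<close> the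
  position on it; their Jacobian is \<open>t\<close>.\<close>

lemma nn_integral_open_triangle:
  assumes [measurable]: "f \<in> borel_measurable borel"
  shows "(\<integral>\<^sup>+ p. f p * indicator open_triangle p \<partial>lborel) =
    (\<integral>\<^sup>+ t. \<integral>\<^sup>+ s. ennreal t * indicator {0<..<1} t * (indicator {0<..<1} s * f (1 - t, t * s)) \<partial>lborel \<partial>lborel)"
proof -
  have "(\<integral>\<^sup>+ p. f p * indicator open_triangle p \<partial>lborel)
      = (\<integral>\<^sup>+ x. \<integral>\<^sup>+ y. f (x, y) * indicator open_triangle (x, y) \<partial>lborel \<partial>lborel)"
    by (rule nn_integral_lborel_real_prod) measurable
  also have "\<dots> = \<bar>-1::real\<bar> * (\<integral>\<^sup>+ t. \<integral>\<^sup>+ y. f (1 + (-1) * t, y) * indicator open_triangle (1 + (-1) * t, y)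
      \<partial>lborel \<partial>lborel)"
    by (rule nn_integral_real_affine[OF borel_measurable_inner_lborel]) auto
  also have "\<dots> = (\<integral>\<^sup>+ t. \<integral>\<^sup>+ y. f (1 - t, y) * indicator open_triangle (1 - t, y) \<partial>lborel \<partial>lborel)"
    by simp
  also have "\<dots> = (\<integral>\<^sup>+ t. \<integral>\<^sup>+ s. ennreal t * indicator {0<..<1} t * (indicator {0<..<1} s * f (1 - t, t * s))
      \<partial>lborel \<partial>lborel)"
  proof (rule nn_integral_cong)
    fix t :: real
    show "(\<integral>\<^sup>+ y. f (1 - t, y) * indicator open_triangle (1 - t, y) \<partial>lborel)
      = (\<integral>\<^sup>+ s. ennreal t * indicator {0<..<1} t * (indicator {0<..<1} s * f (1 - t, t * s)) \<partial>lborel)"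
    proof (cases "t \<in> {0<..<1}")
      case True
      have ind: "indicator open_triangle (1 - t, t * s) = (indicator {0<..<1} s :: ennreal)" for s
        using True by (auto simp: open_triangle_def indicator_def zero_less_mult_iff)
      have "(\<integral>\<^sup>+ y. f (1 - t, y) * indicator open_triangle (1 - t, y) \<partial>lborel)
          = \<bar>t\<bar> * (\<integral>\<^sup>+ s. f (1 - t, 0 + t * s) * indicator open_triangle (1 - t, 0 + t * s) \<partial>lborel)"
        using True by (intro nn_integral_real_affine) auto
      also have "\<dots> = (\<integral>\<^sup>+ s. ennreal t * (f (1 - t, t * s) * indicator open_triangle (1 - t, t * s)) \<partial>lborel)"
        using True by (subst nn_integral_cmult) auto
      finally show ?thesis using True unfolding ind by (simp add: mult_ac)
    next
      case False
      then have "indicator open_triangle (1 - t, y) = (0 :: ennreal)" for y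
        by (auto simp: open_triangle_def indicator_def)
      then show ?thesis using False by simp
    qed
  qed
  finally show ?thesis .
qed

lemma nn_integral_power_mult_power:
  "(\<integral>\<^sup>+ t. ennreal (t ^ a * (1 - t) ^ b) * indicator {0<..<1} t \<partial>lborel)
     = ennreal (fact a * fact b / fact (a + b + 1))"
proof -
  have "((\<lambda>t. t powr (real (Suc a) - 1) * (1 - t) powr (real (Suc b) - 1)) has_integral
      Beta (real (Suc a)) (real (Suc b))) {0..1}"
    by (rule has_integral_Beta_real) auto
  also have "Beta (real (Suc a)) (real (Suc b)) = fact a * fact b / fact (a + b + 1)"
    using Gamma_fact[of a, where 'a = real] Gamma_fact[of b, where 'a = real]
      Gamma_fact[of "a + b + 1", where 'a = real] by (simp add: Beta_def add_ac)
  finally have "((\<lambda>t. t powr (real (Suc a) - 1) * (1 - t) powr (real (Suc b) - 1)) has_integral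
      fact a * fact b / fact (a + b + 1)) {0<..<1}"
    by (simp only: has_integral_Icc_iff_Ioo)
  then have "((\<lambda>t. t ^ a * (1 - t) ^ b) has_integral fact a * fact b / fact (a + b + 1)) {0<..<1::real}"
    by (rule has_integral_eq[rotated]) (auto simp: powr_realpow)
  then show ?thesis
    by (intro nn_integral_has_integral_lebesgue') auto
qed

lemma emeasure_open_triangle: "emeasure lborel open_triangle = ennreal (1 / 2)"
proof -
  have "emeasure lborel open_triangle = (\<integral>\<^sup>+ p. 1 * indicator open_triangle p \<partial>lborel)" by simp
  also have "\<dots> = (\<integral>\<^sup>+ t. \<integral>\<^sup>+ s. ennreal t * indicator {0<..<1} t * (indicator {0<..<1::real} s * 1) \<partial>lborel \<partial>lborel)"
    by (rule nn_integral_open_triangle) simp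
  also have "\<dots> = (\<integral>\<^sup>+ t. ennreal t * indicator {0<..<1} t \<partial>lborel)"
    by (simp add: nn_integral_cmult)
  also have "\<dots> = ennreal (1 / 2)"
    using nn_integral_power_mult_power[of 1 0] by (simp add: fact_numeral)
  finally show ?thesis .
qed

lemma emeasure_triangle: "emeasure lborel triangle = ennreal (1 / 2)"
proof -
  have "emeasure lborel triangle = emeasure lborel open_triangle"
    by (rule emeasure_eq_AE) (use AE_triangle_iff_open in auto)
  then show ?thesis by (simp add: emeasure_open_triangle)
qed

lemma nn_integral_uniform_triangle:
  assumes [measurable]: "f \<in> borel_measurable borel"
  shows "(\<integral>\<^sup>+ p. f p \<partial>uniform_triangle) = 2 * (\<integral>\<^sup>+ p. f p * indicator open_triangle p \<partial>lborel)"
proof -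
  have "(\<integral>\<^sup>+ p. f p \<partial>uniform_triangle) = (\<integral>\<^sup>+ p. f p * indicator triangle p \<partial>lborel) / ennreal (1 / 2)"
    unfolding emeasure_triangle[symmetric] by (rule nn_integral_uniform_measure) auto
  also have "(\<integral>\<^sup>+ p. f p * indicator triangle p \<partial>lborel) = (\<integral>\<^sup>+ p. f p * indicator open_triangle p \<partial>lborel)"
    using AE_triangle_iff_open
    by (intro nn_integral_cong_AE) (auto elim!: eventually_mono simp: indicator_def)
  also have "x / ennreal (1 / 2) = 2 * x" for x
    by (simp only: divide_ennreal_def) (subst inverse_ennreal, auto simp: mult.commute)
  finally show ?thesis .
qed

lemma AE_uniform_triangleI:
  assumes "AE p in lborel. P p" shows "AE p in uniform_triangle. P p"
  by (rule AE_uniform_measureI) (use assms in auto)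

lemma AE_uniform_triangle_open: "AE p in uniform_triangle. p \<in> open_triangle"
  by (rule AE_uniform_measureI) (use AE_triangle_iff_open in auto)

interpretation uniform_triangle: borel_prob_space uniform_triangle
proof -
  interpret prob_space uniform_triangle
    by (rule prob_space_uniform_measure) (simp_all add: emeasure_triangle)
  show "borel_prob_space uniform_triangle"
    by unfold_locales simp
qed

text \<open>A point \<open>(1 - t, t s)\<close> lies on the segment from \<open>(1, 0)\<close> to \<open>(0, s)\<close>. The map below sends
  the triangle with vertices \<open>(0, 0)\<close>, \<open>(1, 0)\<close>, \<open>(0, 1)\<close> to the one with vertices
  \<open>(0, s)\<close>, \<open>(1 - t, t s)\<close>, \<open>(0, 1)\<close>.\<close>

definition corner_map :: "real \<Rightarrow> real \<Rightarrow> real \<times> real \<Rightarrow> real \<times> real" where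
  "corner_map t s p = (fst p * (1 - t), s + (snd p * (1 - s) - fst p * (s * (1 - t))))"

lemma corner_map_measurable [measurable]: "corner_map t s \<in> measurable borel borel"
  unfolding corner_map_def[abs_def]
  by (intro borel_measurable_continuous_onI continuous_intros)

lemma nn_integral_corner_map:
  assumes [measurable]: "f \<in> borel_measurable borel" and "t < 1" "s < 1"
  shows "(\<integral>\<^sup>+ p. f p \<partial>lborel) = ennreal ((1 - t) * (1 - s)) * (\<integral>\<^sup>+ p. f (corner_map t s p) \<partial>lborel)"
proof -
  have "(\<integral>\<^sup>+ p. f p \<partial>lborel) = (\<integral>\<^sup>+ x. \<integral>\<^sup>+ y. f (x, y) \<partial>lborel \<partial>lborel)"
    by (rule nn_integral_lborel_real_prod) measurable
  also have "\<dots> = \<bar>1 - t\<bar> * (\<integral>\<^sup>+ x. \<integral>\<^sup>+ y. f (0 + (1 - t) * x, y) \<partial>lborel \<partial>lborel)"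
    by (rule nn_integral_real_affine) (measurable, use assms in simp)
  also have "(\<integral>\<^sup>+ x. \<integral>\<^sup>+ y. f (0 + (1 - t) * x, y) \<partial>lborel \<partial>lborel)
      = (\<integral>\<^sup>+ x. \<bar>1 - s\<bar> * (\<integral>\<^sup>+ y. f (0 + (1 - t) * x, (s - x * (s * (1 - t))) + (1 - s) * y) \<partial>lborel) \<partial>lborel)"
    by (intro nn_integral_cong nn_integral_real_affine) (measurable, use assms in simp)
  also have "\<dots> = \<bar>1 - s\<bar> * (\<integral>\<^sup>+ x. (\<integral>\<^sup>+ y. f (corner_map t s (x, y)) \<partial>lborel) \<partial>lborel)"
    by (subst nn_integral_cmult[symmetric], measurable) (simp add: corner_map_def algebra_simps)
  also have "(\<integral>\<^sup>+ x. (\<integral>\<^sup>+ y. f (corner_map t s (x, y)) \<partial>lborel) \<partial>lborel) = (\<integral>\<^sup>+ p. f (corner_map t s p) \<partial>lborel)"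
    by (rule nn_integral_lborel_real_prod[symmetric]) measurable
  finally show ?thesis using assms by (simp add: ennreal_mult mult.assoc)
qed

lemma nn_integral_uniform_corner:
  assumes f: "f \<in> borel_measurable borel" and "t < 1" "s < 1" and B [measurable]: "B \<in> sets borel"
    and "B \<subseteq> open_triangle" "\<And>p. corner_map t s p \<in> B \<longleftrightarrow> p \<in> open_triangle"
  shows "(\<integral>\<^sup>+ p. indicator B p * f p \<partial>uniform_triangle)
    = ennreal ((1 - t) * (1 - s)) * (\<integral>\<^sup>+ p. f (corner_map t s p) \<partial>uniform_triangle)"
proof -
  note [measurable] = f
  have "(\<integral>\<^sup>+ p. indicator B p * f p \<partial>uniform_triangle)
      = 2 * (\<integral>\<^sup>+ p. (indicator B p * f p) * indicator open_triangle p \<partial>lborel)"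
    by (rule nn_integral_uniform_triangle) measurable
  also have "(\<lambda>p. (indicator B p * f p) * indicator open_triangle p) = (\<lambda>p. indicator B p * f p)"
    using assms(5) by (auto simp: fun_eq_iff indicator_def)
  also have "(\<integral>\<^sup>+ p. indicator B p * f p \<partial>lborel)
      = ennreal ((1 - t) * (1 - s)) * (\<integral>\<^sup>+ p. indicator B (corner_map t s p) * f (corner_map t s p) \<partial>lborel)"
    by (rule nn_integral_corner_map) (measurable, use assms in auto)
  also have "(\<lambda>p. indicator B (corner_map t s p) * f (corner_map t s p))
      = (\<lambda>p. f (corner_map t s p) * indicator open_triangle p)"
    using assms(6) by (auto simp: fun_eq_iff indicator_def)
  also have "2 * (ennreal ((1 - t) * (1 - s)) * (\<integral>\<^sup>+ p. f (corner_map t s p) * indicator open_triangle p \<partial>lborel))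
      = ennreal ((1 - t) * (1 - s)) * (\<integral>\<^sup>+ p. f (corner_map t s p) \<partial>uniform_triangle)"
    by (subst nn_integral_uniform_triangle) (auto simp: mult_ac)
  finally show ?thesis .
qed


text \<open>The set \<open>D\<close> is the part of the triangle above the line through \<open>(1, 0)\<close> and \<open>(0, s)\<close>. The
  inequality in the definition of \<open>A\<close> says that a point is on or above the line through
  \<open>(1 - t, t s)\<close> and \<open>(0, 1)\<close>, so \<open>A\<close> is the part of \<open>D\<close> inside the hull of \<open>(1, 0)\<close>, \<open>(1 - t, t s)\<close>
  and \<open>(0, 1)\<close>, and the rest is the image of the open triangle under the corner map.\<close>

lemma uniform_triangle_split:
  assumes "0 < t" "t < 1" "0 < s" "s < 1"
  defines "D \<equiv> {p \<in> open_triangle. s * (1 - fst p) < snd p}"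
  defines "A \<equiv> {p \<in> D. 1 - t \<le> snd p * (1 - t) + fst p * (1 - t * s)}"
  shows "A \<in> sets borel" "D \<in> sets borel"
    and "\<And>f. f \<in> borel_measurable borel \<Longrightarrow>
      (\<integral>\<^sup>+ x. indicator D x * f x \<partial>uniform_triangle) = (\<integral>\<^sup>+ x. indicator A x * f x \<partial>uniform_triangle)
        + ennreal ((1 - t) * (1 - s)) * (\<integral>\<^sup>+ x. f (corner_map t s x) \<partial>uniform_triangle)"
    and "emeasure uniform_triangle A = ennreal (t * (1 - s))"
    and "\<And>p. p \<in> open_triangle \<Longrightarrow> corner_map t s p \<in> D"
    and "\<And>p. p \<in> A \<Longrightarrow> p \<in> convex hull {(1, 0), (1 - t, t * s), (0, 1)}"
proof -
  have half: "{p. s * (1 - fst p) < snd p} \<in> sets borel"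
    by (intro borel_open open_Collect_less continuous_intros)
  have D_eq: "D = open_triangle \<inter> {p. s * (1 - fst p) < snd p}" by (auto simp: D_def)
  show D [measurable]: "D \<in> sets borel"
    unfolding D_eq by (intro sets.Int open_triangle_borel half)
  have half': "{p. 1 - t \<le> snd p * (1 - t) + fst p * (1 - t * s)} \<in> sets borel"
    by (intro borel_closed closed_Collect_le continuous_intros)
  have A_eq: "A = D \<inter> {p. 1 - t \<le> snd p * (1 - t) + fst p * (1 - t * s)}" by (auto simp: A_def)
  show A [measurable]: "A \<in> sets borel"
    unfolding A_eq by (intro sets.Int D half')
  \<comment> \<open>The case \<open>t' = 0\<close> is used below: the corner map with parameter \<open>0\<close> maps the triangle onto \<open>D\<close>,
    which gives the mass of \<open>D\<close> and then, by subtraction, that of \<open>A\<close>.\<close>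
  have D_iff: "corner_map t' s p \<in> D \<longleftrightarrow> 0 < fst p \<and> 0 < snd p \<and> fst p * (1 - t') * (1 - s) + snd p * (1 - s) < 1 - s"
    if "0 \<le> t'" "t' < 1" for t' p
  proof -
    have 1: "s * (1 - fst (corner_map t' s p)) < snd (corner_map t' s p) \<longleftrightarrow> 0 < snd p * (1 - s)"
      by (simp add: corner_map_def algebra_simps)
    have 2: "0 < fst (corner_map t' s p) \<longleftrightarrow> 0 < fst p"
      using that by (simp add: corner_map_def zero_less_mult_iff)
    have 3: "fst (corner_map t' s p) + snd (corner_map t' s p) < 1
        \<longleftrightarrow> fst p * (1 - t') * (1 - s) + snd p * (1 - s) < 1 - s"
      by (simp add: corner_map_def algebra_simps)
    have "0 < snd (corner_map t' s p)"
      if "s * (1 - fst (corner_map t' s p)) < snd (corner_map t' s p)"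
        "fst (corner_map t' s p) + snd (corner_map t' s p) < 1"
    proof -
      let ?x = "fst (corner_map t' s p)" and ?y = "snd (corner_map t' s p)"
      have "s * ?y < s * (1 - ?x)" using that assms(3) by simp
      then have "s * ?y < ?y" using that by linarith
      then have "?y * (1 - s) > 0" by (simp add: algebra_simps)
      then show "0 < ?y" using assms(4) by (simp add: zero_less_mult_iff)
    qed
    with 1 2 3 assms(4) show ?thesis
      unfolding D_def open_triangle_def by (auto simp: zero_less_mult_iff)
  qed
  have sum_lt: "fst p * (1 - t') * (1 - s) + snd p * (1 - s) < 1 - s"
    if p: "p \<in> open_triangle" and t': "0 \<le> t'" "t' < 1" for p t'
  proof -
    have "fst p * (1 - t') \<le> fst p * 1"
      using that by (intro mult_left_mono) (auto simp: open_triangle_def)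
    moreover have "fst p + snd p < 1" using p by (simp add: open_triangle_def)
    ultimately have "fst p * (1 - t') + snd p < 1" by linarith
    then have "(fst p * (1 - t') + snd p) * (1 - s) < 1 * (1 - s)"
      using assms(4) by (intro mult_strict_right_mono) auto
    then show ?thesis by (simp add: algebra_simps)
  qed
  show in_D: "corner_map t s p \<in> D" if p: "p \<in> open_triangle" for p
    using D_iff[of t p] sum_lt[OF p, of t] p assms by (auto simp: open_triangle_def)
  have B_iff: "corner_map t s p \<in> D - A \<longleftrightarrow> p \<in> open_triangle" for p
  proof -
    have "1 - t \<le> snd (corner_map t s p) * (1 - t) + fst (corner_map t s p) * (1 - t * s)
        \<longleftrightarrow> 0 \<le> (1 - t) * (1 - s) * (fst p + snd p - 1)"
      by (simp add: corner_map_def algebra_simps)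
    also have "\<dots> \<longleftrightarrow> 1 \<le> fst p + snd p"
      using assms zero_le_mult_iff[of "(1 - t) * (1 - s)" "fst p + snd p - 1"]
      by (smt (verit) mult_pos_pos)
    finally show ?thesis
      using in_D[of p] D_iff[of t p] assms(1-4) by (auto simp: A_def open_triangle_def)
  qed
  have D0_iff: "corner_map 0 s p \<in> D \<longleftrightarrow> p \<in> open_triangle" for p
  proof -
    have "fst p * (1 - 0) * (1 - s) + snd p * (1 - s) < 1 - s \<longleftrightarrow> (fst p + snd p) * (1 - s) < 1 * (1 - s)"
      by (simp add: algebra_simps)
    then show ?thesis
      using D_iff[of 0 p] assms(4) by (auto simp: open_triangle_def mult_less_cancel_right)
  qed
  show split: "(\<integral>\<^sup>+ x. indicator D x * f x \<partial>uniform_triangle) = (\<integral>\<^sup>+ x. indicator A x * f x \<partial>uniform_triangle)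
        + ennreal ((1 - t) * (1 - s)) * (\<integral>\<^sup>+ x. f (corner_map t s x) \<partial>uniform_triangle)"
    if f [measurable]: "f \<in> borel_measurable borel" for f
  proof -
    have "(\<integral>\<^sup>+ x. indicator D x * f x \<partial>uniform_triangle)
        = (\<integral>\<^sup>+ x. indicator A x * f x + indicator (D - A) x * f x \<partial>uniform_triangle)"
      by (intro nn_integral_cong) (auto simp: indicator_def A_def)
    also have "\<dots> = (\<integral>\<^sup>+ x. indicator A x * f x \<partial>uniform_triangle)
        + (\<integral>\<^sup>+ x. indicator (D - A) x * f x \<partial>uniform_triangle)"
      by (rule nn_integral_add) measurable
    also have "(\<integral>\<^sup>+ x. indicator (D - A) x * f x \<partial>uniform_triangle)
        = ennreal ((1 - t) * (1 - s)) * (\<integral>\<^sup>+ x. f (corner_map t s x) \<partial>uniform_triangle)"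
    proof (rule nn_integral_uniform_corner[OF f assms(2,4) _ _ B_iff])
      show "D - A \<in> sets borel" by measurable
      show "D - A \<subseteq> open_triangle" by (auto simp: D_def)
    qed
    finally show ?thesis .
  qed
  have "ennreal ((1 - 0) * (1 - s)) * (\<integral>\<^sup>+ x. 1 \<partial>uniform_triangle)
      = (\<integral>\<^sup>+ x. indicator D x * 1 \<partial>uniform_triangle)"
  proof (rule nn_integral_uniform_corner[OF _ _ assms(4) D _ D0_iff, symmetric])
    show "D \<subseteq> open_triangle" by (auto simp: D_def)
  qed auto
  also have "\<dots> = (\<integral>\<^sup>+ x. indicator A x * 1 \<partial>uniform_triangle)
        + ennreal ((1 - t) * (1 - s)) * (\<integral>\<^sup>+ x. 1 \<partial>uniform_triangle)"
    by (rule split) simp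
  also have "(\<integral>\<^sup>+ x. 1 \<partial>uniform_triangle) = 1"
    using uniform_triangle.emeasure_space_1 by simp
  finally have "ennreal (1 - s) = emeasure uniform_triangle A + ennreal ((1 - t) * (1 - s))"
    by simp
  also have "ennreal (1 - s) = ennreal (t * (1 - s)) + ennreal ((1 - t) * (1 - s))"
  proof -
    have "1 - s = t * (1 - s) + (1 - t) * (1 - s)" by (simp add: algebra_simps)
    moreover have "0 \<le> t * (1 - s)" "0 \<le> (1 - t) * (1 - s)" using assms by simp_all
    ultimately show ?thesis by (metis ennreal_plus)
  qed
  finally show "emeasure uniform_triangle A = ennreal (t * (1 - s))"
    by (metis add.commute ennreal_add_left_cancel ennreal_neq_top infinity_ennreal_def)
  show "p \<in> convex hull {(1, 0), (1 - t, t * s), (0, 1)}" if "p \<in> A" for p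
  proof -
    \<comment> \<open>\<open>u\<close>, \<open>v\<close>, \<open>w\<close> are the barycentric coordinates of \<open>p\<close>: each numerator is an affine function that
      vanishes on the opposite side.\<close>
    define d where "d = t * (1 - s)"
    define u where "u = (snd p * (1 - t) + fst p * (1 - t * s) - (1 - t)) / d"
    define v where "v = (1 - fst p - snd p) / d"
    define w where "w = (snd p - s * (1 - fst p)) / (1 - s)"
    have d: "d > 0" using assms by (simp add: d_def)
    have nonneg: "0 \<le> u" "0 \<le> v" "0 \<le> w"
      using that d assms(4) by (auto simp: A_def D_def open_triangle_def u_def v_def w_def)
    have ud: "u * d = snd p * (1 - t) + fst p * (1 - t * s) - (1 - t)"
      and vd: "v * d = 1 - fst p - snd p" and w1: "w * (1 - s) = snd p - s * (1 - fst p)"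
      using d assms(4) by (auto simp: u_def v_def w_def)
    have wd: "w * d = t * (snd p - s * (1 - fst p))"
      unfolding w1[symmetric] d_def by (simp add: mult_ac)
    have "(u + v + w) * d = u * d + v * d + w * d" by (simp add: algebra_simps)
    also have "\<dots> = 1 * d" unfolding ud vd wd by (simp add: d_def algebra_simps)
    finally have "u + v + w = 1" using d by simp
    moreover have "(u + v * (1 - t)) * d = u * d + v * d * (1 - t)" by (simp add: algebra_simps)
    then have "(u + v * (1 - t)) * d = fst p * d" unfolding ud vd by (simp add: d_def algebra_simps)
    then have "fst p = u + v * (1 - t)" using d by simp
    moreover have "(v * (t * s) + w) * d = v * d * (t * s) + w * d" by (simp add: algebra_simps)
    then have "(v * (t * s) + w) * d = snd p * d" unfolding wd vd by (simp add: d_def algebra_simps)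
    then have "snd p = v * (t * s) + w" using d by simp
    ultimately show ?thesis
      using nonneg unfolding convex_hull_3
      by (intro CollectI exI[of _ u] exI[of _ v] exI[of _ w]) (simp add: prod_eq_iff)
  qed
qed


section \<open>The law of the number of vertices\<close>

definition chain_indicator :: "nat \<Rightarrow> (real \<times> real) set \<Rightarrow> ennreal" where
  "chain_indicator k = indicator {S. num_vertices (convex hull ({(1, 0), (0, 1)} \<union> S)) = k + 2}"

definition chain_prob :: "nat \<Rightarrow> nat \<Rightarrow> ennreal" where
  "chain_prob n k = set_expectation uniform_triangle n (chain_indicator k)"

lemma measurable_chain_indicator: "measurable_functional (chain_indicator k)"
  unfolding measurable_set_functional_def
proof
  fix n :: nat
  let ?N = "borel \<Otimes>\<^sub>M (\<Pi>\<^sub>M i\<in>{..<n}. borel) :: ((real \<times> real) \<times> (nat \<Rightarrow> real \<times> real)) measure"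
  have "Measurable.pred ?N (\<lambda>w. num_vertices (convex hull ({(1, 0), (0, 1)} \<union> (\<lambda>i. snd w i) ` {..<n})) = k + 2)"
    by (rule measurable_num_vertices_eq) (simp, measurable)
  note P = this
  have "(\<lambda>w. if num_vertices (convex hull ({(1, 0), (0, 1)} \<union> (\<lambda>i. snd w i) ` {..<n})) = k + 2 then 1 else 0 :: ennreal)
      \<in> borel_measurable ?N"
    by (rule measurable_If[OF measurable_const measurable_const predE[OF P]]) auto
  also have "(\<lambda>w. if num_vertices (convex hull ({(1, 0), (0, 1)} \<union> (\<lambda>i. snd w i) ` {..<n})) = k + 2 then 1 else 0 :: ennreal)
      = (\<lambda>(p, x). chain_indicator k (x ` {..<n}))"
    by (auto simp: chain_indicator_def fun_eq_iff)
  finally show "(\<lambda>(p, x). chain_indicator k (x ` {..<n})) \<in> borel_measurable ?N" .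
qed

text \<open>Under the corner map the points \<open>(1 - t, t s)\<close>, \<open>(0, 1)\<close> and \<open>(1, 0)\<close> come from \<open>(1, 0)\<close>,
  \<open>(0, 1)\<close> and \<open>(1 / (1 - t), 0)\<close>, and the last of these adds exactly one vertex.\<close>

lemma chain_indicator_insert_corner:
  assumes "finite S" "S \<subseteq> open_triangle" "0 < t" "t < 1" "s < 1"
  shows "chain_indicator k (insert (1 - t, t * s) (corner_map t s ` S))
    = (if k = 0 then 0 else chain_indicator (k - 1) S)"
proof -
  define L where "L p = (fst p * (1 - t), snd p * (1 - s) - fst p * (s * (1 - t)))" for p
  have corner: "corner_map t s = (\<lambda>p. (0, s) + L p)" by (simp add: fun_eq_iff corner_map_def L_def)
  have "linear L" by (rule linearI) (auto simp: L_def algebra_simps)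
  moreover have "inj L" using assms by (auto simp: inj_on_def L_def prod_eq_iff)
  moreover have e: "(0, s) + L (1 / (1 - t), 0) = (1, 0)" "(0, s) + L (1, 0) = (1 - t, t * s)"
    "(0, s) + L (0, 1) = (0, 1)"
    using assms by (simp_all add: L_def) (simp add: algebra_simps)
  have "{(1, 0), (0, 1)} \<union> insert (1 - t, t * s) (corner_map t s ` S)
      = (\<lambda>p. (0, s) + L p) ` insert (1 / (1 - t), 0) ({(1, 0), (0, 1)} \<union> S)"
    unfolding corner image_insert image_Un image_empty e by auto
  ultimately have "num_vertices (convex hull ({(1, 0), (0, 1)} \<union> insert (1 - t, t * s) (corner_map t s ` S)))
      = num_vertices (convex hull (insert (1 / (1 - t), 0) ({(1, 0), (0, 1)} \<union> S)))"
    by (simp only: num_vertices_affine_image)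
  also have "\<dots> = Suc (num_vertices (convex hull ({(1, 0), (0, 1)} \<union> S)))"
    using assms by (intro num_vertices_insert_on_axis) auto
  finally show ?thesis
    using num_vertices_ge_2[OF assms(1,2)]
    by (auto simp: chain_indicator_def indicator_def insert_commute)
qed

text \<open>Up to sign, the slope of the line through \<open>(1, 0)\<close>; the value at \<open>(1 - t, t s)\<close> is \<open>s\<close>.\<close>

definition slope :: "real \<times> real \<Rightarrow> real" where
  "slope p = snd p / (1 - fst p)"

lemma slope_measurable [measurable]: "slope \<in> borel_measurable borel"
  unfolding slope_def[abs_def]
  by (intro borel_measurable_divide borel_measurable_diff borel_measurable_const
      borel_measurable_continuous_onI continuous_intros)

lemma AE_slope_neq: "AE p in uniform_triangle. slope p \<noteq> c"
proof -
  have "AE p in uniform_triangle. c * fst p + 1 * snd p \<noteq> c"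
    by (intro AE_uniform_triangleI AE_lborel_not_on_line) simp
  with AE_uniform_triangle_open show ?thesis
    by eventually_elim (auto simp: slope_def open_triangle_def field_simps)
qed

text \<open>Given that the lowest point is \<open>(1 - t, t s)\<close>, the remaining points are thinned: \<open>m\<close> of them fall
  into the affine copy of the triangle and form a chain with one vertex less, and the others are
  irrelevant.\<close>

lemma chain_expectation_given_lowest:
  assumes "0 < t" "t < 1" "0 < s" "s < 1"
  shows "set_expectation uniform_triangle n
      (\<lambda>S. indicator {S. \<forall>x\<in>S. slope x > slope (1 - t, t * s)} S * chain_indicator k (insert (1 - t, t * s) S))
    = (\<Sum>m\<le>n. of_nat (n choose m) * ennreal (t * (1 - s)) ^ (n - m) * ennreal ((1 - t) * (1 - s)) ^ m
        * (if k = 0 then 0 else chain_prob m (k - 1)))"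
proof -
  define D where "D = {p \<in> open_triangle. s * (1 - fst p) < snd p}"
  define A where "A = {p \<in> D. 1 - t \<le> snd p * (1 - t) + fst p * (1 - t * s)}"
  note split = uniform_triangle_split[OF assms, folded D_def, folded A_def]
  define y where "y = (1 - t, t * s)"
  have slope_y: "slope y = s" using assms by (simp add: slope_def y_def)
  have g: "measurable_functional (\<lambda>S. chain_indicator k (insert y S))"
    using measurable_set_functional_insert'[OF measurable_chain_indicator, of "\<lambda>x. x" borel "\<lambda>_. y"] by simp
  have A_hull: "chain_indicator k (insert y (insert x S)) = chain_indicator k (insert y S)" if "x \<in> A" for x S
  proof -
    have "x \<in> convex hull {(1, 0), y, (0, 1)}" using split(6)[OF that] by (simp add: y_def)
    also have "\<dots> \<subseteq> convex hull ({(1, 0), (0, 1)} \<union> insert y S)" by (rule hull_mono) auto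
    finally have "convex hull (insert x ({(1, 0), (0, 1)} \<union> insert y S)) = convex hull ({(1, 0), (0, 1)} \<union> insert y S)"
      by (rule hull_redundant)
    moreover have "{(1, 0), (0, 1)} \<union> insert y (insert x S) = insert x ({(1, 0), (0, 1)} \<union> insert y S)" by auto
    ultimately show ?thesis by (simp only: chain_indicator_def indicator_def mem_Collect_eq)
  qed
  have "set_expectation uniform_triangle n
      (\<lambda>S. indicator {S. \<forall>x\<in>S. slope x > slope y} S * chain_indicator k (insert y S))
    = set_expectation uniform_triangle n (\<lambda>S. indicator (Pow D) S * chain_indicator k (insert y S))"
  proof (rule uniform_triangle.set_expectation_cong_AE[OF AE_uniform_triangle_open])
    fix S assume S: "S \<subseteq> open_triangle"
    have "slope x > s \<longleftrightarrow> s * (1 - fst x) < snd x" if "x \<in> S" for x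
      using that S by (subst slope_def, subst pos_less_divide_eq) (auto simp: open_triangle_def)
    then have "(\<forall>x\<in>S. slope x > slope y) \<longleftrightarrow> S \<subseteq> D"
      using S unfolding slope_y D_def by auto
    then show "indicator {S. \<forall>x\<in>S. slope x > slope y} S * chain_indicator k (insert y S)
        = indicator (Pow D) S * chain_indicator k (insert y S)"
      by (simp add: indicator_def)
  qed
  also have "\<dots> = (\<Sum>m\<le>n. of_nat (n choose m) * emeasure uniform_triangle A ^ (n - m) * ennreal ((1 - t) * (1 - s)) ^ m
      * set_expectation uniform_triangle m (\<lambda>S. chain_indicator k (insert y (corner_map t s ` S))))"
  proof (rule uniform_triangle.set_expectation_thinning[OF split(1,2) corner_map_measurable _ _ split(3) g A_hull])
    show "AE x in uniform_triangle. corner_map t s x \<in> D"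
      using AE_uniform_triangle_open by eventually_elim (rule split(5))
  qed (auto simp: A_def)
  moreover have E: "set_expectation uniform_triangle m (\<lambda>S. chain_indicator k (insert y (corner_map t s ` S)))
      = (if k = 0 then 0 else chain_prob m (k - 1))" for m
  proof -
    have "set_expectation uniform_triangle m (\<lambda>S. chain_indicator k (insert y (corner_map t s ` S)))
        = set_expectation uniform_triangle m (\<lambda>S. if k = 0 then 0 else chain_indicator (k - 1) S)"
      by (rule uniform_triangle.set_expectation_cong_AE[OF AE_uniform_triangle_open])
        (use chain_indicator_insert_corner assms in \<open>auto simp: y_def\<close>)
    then show ?thesis by (simp add: chain_prob_def uniform_triangle.set_expectation_zero)
  qed
  ultimately show ?thesis unfolding split(4) E unfolding y_def by simp
qed

lemma binomial_beta_weight: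
  assumes "m \<le> n"
  shows "2 * real (n choose m) * (fact (n - m + 1) * fact m / fact (n + 2))
    = 2 * real (n - m + 1) / (real (n + 1) * real (n + 2))"
proof -
  have "real (n choose m) * (fact (n - m) * fact m) = fact n"
    using binomial_fact[OF assms, where 'a = real] by (simp add: field_simps)
  then have 1: "real (n choose m) * (fact (n - m + 1) * fact m) = real (n - m + 1) * fact n"
    by (simp add: mult_ac distrib_left)
  have 2: "fact (n + 2) = (real (n + 1) * real (n + 2)) * fact n"
    by (simp add: mult_ac)
  have "2 * real (n choose m) * (fact (n - m + 1) * fact m / fact (n + 2))
      = 2 * (real (n choose m) * (fact (n - m + 1) * fact m)) / fact (n + 2)"
    by (simp only: times_divide_eq_right mult.assoc)
  also have "\<dots> = (2 * real (n - m + 1)) * fact n / ((real (n + 1) * real (n + 2)) * fact n)"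
    unfolding 1 2 by (simp only: mult.assoc)
  also have "\<dots> = 2 * real (n - m + 1) / (real (n + 1) * real (n + 2))"
    by (rule nonzero_mult_divide_mult_cancel_right) simp
  finally show ?thesis .
qed

text \<open>The sum over the position of the lowest point. The factor \<open>n + 1\<close> from the choice of the lowest
  point cancels against the integral of \<open>(1 - s)\<^sup>n\<close>, and the integral over \<open>t\<close> is a Beta integral.\<close>

lemma chain_prob_Suc:
  "chain_prob (Suc n) k = (\<Sum>m\<le>n. ennreal (2 * real (n - m + 1) / (real (n + 1) * real (n + 2)))
     * (if k = 0 then 0 else chain_prob m (k - 1)))"
proof -
  define w where "w m = (if k = 0 then 0 else chain_prob m (k - 1))" for m
  define h where "h y = set_expectation uniform_triangle n
      (\<lambda>S. indicator {S. \<forall>x\<in>S. slope x > slope y} S * chain_indicator k (insert y S))" for y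
  have h: "h \<in> borel_measurable borel"
    unfolding h_def
  proof (intro uniform_triangle.borel_measurable_set_expectation measurable_set_functional_mult
      uniform_triangle.measurable_functional_insert measurable_chain_indicator measurable_set_functional_all)
    fix n :: nat
    show "Measurable.pred (borel \<Otimes>\<^sub>M (\<Pi>\<^sub>M i\<in>{..<n}. borel)) (\<lambda>w. \<forall>i<n. slope (fst w) < slope (snd w i))"
      by measurable
  qed
  define c where "c m = of_nat (n choose m) * w m" for m
  have "chain_prob (Suc n) k = of_nat (Suc n) * (\<integral>\<^sup>+ y. h y \<partial>uniform_triangle)"
    unfolding chain_prob_def h_def
    by (rule uniform_triangle.set_expectation_select_min[OF slope_measurable AE_slope_neq measurable_chain_indicator])
  also have "(\<integral>\<^sup>+ y. h y \<partial>uniform_triangle) = 2 * (\<integral>\<^sup>+ t. \<integral>\<^sup>+ s. ennreal t * indicator {0<..<1} t *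
      (indicator {0<..<1} s * h (1 - t, t * s)) \<partial>lborel \<partial>lborel)"
    unfolding nn_integral_uniform_triangle[OF h] nn_integral_open_triangle[OF h] ..
  also have "(\<integral>\<^sup>+ t. \<integral>\<^sup>+ s. ennreal t * indicator {0<..<1} t * (indicator {0<..<1} s * h (1 - t, t * s)) \<partial>lborel \<partial>lborel)
      = (\<integral>\<^sup>+ t. \<integral>\<^sup>+ s. (\<Sum>m\<le>n. c m * ((ennreal (t ^ (n - m + 1) * (1 - t) ^ m) * indicator {0<..<1} t)
          * (ennreal (s ^ 0 * (1 - s) ^ n) * indicator {0<..<1} s))) \<partial>lborel \<partial>lborel)"
  proof (intro nn_integral_cong)
    fix t s :: real
    show "ennreal t * indicator {0<..<1} t * (indicator {0<..<1} s * h (1 - t, t * s))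
      = (\<Sum>m\<le>n. c m * ((ennreal (t ^ (n - m + 1) * (1 - t) ^ m) * indicator {0<..<1} t)
          * (ennreal (s ^ 0 * (1 - s) ^ n) * indicator {0<..<1} s)))"
    proof (cases "t \<in> {0<..<1} \<and> s \<in> {0<..<1}")
      case True
      have "ennreal t * (ennreal (t * (1 - s)) ^ (n - m) * ennreal ((1 - t) * (1 - s)) ^ m)
          = ennreal (t ^ (n - m + 1) * (1 - t) ^ m) * ennreal (s ^ 0 * (1 - s) ^ n)" if "m \<le> n" for m
      proof -
        have "t * ((t * (1 - s)) ^ (n - m) * ((1 - t) * (1 - s)) ^ m)
            = t ^ (n - m + 1) * (1 - t) ^ m * ((1 - s) ^ (n - m) * (1 - s) ^ m)"
          by (simp add: power_mult_distrib mult_ac)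
        also have "(1 - s) ^ (n - m) * (1 - s) ^ m = s ^ 0 * (1 - s) ^ n"
          using that by (simp flip: power_add)
        finally show ?thesis using True by (simp add: ennreal_power flip: ennreal_mult)
      qed
      note E = this
      have "ennreal t * (of_nat (n choose m) * ennreal (t * (1 - s)) ^ (n - m) * ennreal ((1 - t) * (1 - s)) ^ m * w m)
          = c m * (ennreal (t ^ (n - m + 1) * (1 - t) ^ m) * ennreal (s ^ 0 * (1 - s) ^ n))" if "m \<le> n" for m
        unfolding c_def E[OF that, symmetric] by (simp only: mult_ac)
      then show ?thesis
        using True chain_expectation_given_lowest[of t s n k]
        by (simp add: h_def w_def sum_distrib_left)
    qed auto
  qed
  also have "\<dots> = (\<Sum>m\<le>n. c m * (ennreal (fact (n - m + 1) * fact m / fact (n - m + 1 + m + 1))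
        * ennreal (fact 0 * fact n / fact (0 + n + 1))))"
    unfolding nn_integral_power_mult_power[symmetric]
    by (simp add: nn_integral_sum nn_integral_cmult nn_integral_multc)
  also have "of_nat (Suc n) * (2 * \<dots>) = (\<Sum>m\<le>n. ennreal (2 * real (n - m + 1) / (real (n + 1) * real (n + 2))) * w m)"
    unfolding sum_distrib_left
  proof (intro sum.cong refl)
    fix m assume m: "m \<in> {..n}"
    have 1: "fact 0 * fact n / fact (0 + n + 1) = 1 / (real (Suc n))" by simp
    have 2: "n - m + 1 + m + 1 = n + 2" using m by simp
    have 3: "(of_nat j :: ennreal) = ennreal (real j)" for j by (simp add: ennreal_of_nat_eq_real_of_nat)
    have "real (Suc n) * (2 * (real (n choose m) * (fact (n - m + 1) * fact m / fact (n + 2) * (1 / real (Suc n)))))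
        = 2 * real (n choose m) * (fact (n - m + 1) * fact m / fact (n + 2))" by simp
    also have "\<dots> = 2 * real (n - m + 1) / (real (n + 1) * real (n + 2))"
      by (rule binomial_beta_weight) (use m in simp)
    finally have R: "real (Suc n) * (2 * (real (n choose m) * (fact (n - m + 1) * fact m / fact (n + 2) * (1 / real (Suc n)))))
        = 2 * real (n - m + 1) / (real (n + 1) * real (n + 2))" .
    have M: "ennreal a * (ennreal b * (ennreal c * (ennreal d * ennreal e))) = ennreal (a * (b * (c * (d * e))))"
      if "0 \<le> a" "0 \<le> b" "0 \<le> c" "0 \<le> d" "0 \<le> e" for a b c d e
      using that by (simp add: ennreal_mult)
    have "of_nat (Suc n) * (2 * (of_nat (n choose m) * w m * (F * G)))
        = (ennreal (real (Suc n)) * (ennreal 2 * (ennreal (real (n choose m)) * (F * G)))) * w m" for F G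
      by (simp only: 3 ennreal_numeral mult_ac)
    then have "of_nat (Suc n) * (2 * (c m * (ennreal (fact (n - m + 1) * fact m / fact (n + 2)) * ennreal (1 / real (Suc n)))))
        = ennreal (real (Suc n)) * (ennreal 2 * (ennreal (real (n choose m)) *
          (ennreal (fact (n - m + 1) * fact m / fact (n + 2)) * ennreal (1 / real (Suc n))))) * w m"
      unfolding c_def .
    also have "\<dots> = ennreal (2 * real (n - m + 1) / (real (n + 1) * real (n + 2))) * w m"
      unfolding R[symmetric] by (subst M) simp_all
    finally show "of_nat (Suc n) * (2 * (c m * (ennreal (fact (n - m + 1) * fact m / fact (n - m + 1 + m + 1))
        * ennreal (fact 0 * fact n / fact (0 + n + 1)))))
        = ennreal (2 * real (n - m + 1) / (real (n + 1) * real (n + 2))) * w m"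
      unfolding 1 2 .
  qed
  finally show ?thesis unfolding w_def .
qed

lemma chain_prob_0: "chain_prob 0 k = (if k = 0 then 1 else 0)"
  by (simp add: chain_prob_def uniform_triangle.set_expectation_0 chain_indicator_def num_vertices_segment indicator_def)

section \<open>The generating polynomials\<close>

lemma vertex_prob_eq_chain_prob:
  assumes "uniform_points M X" "n \<noteq> 0"
  shows "ennreal (vertex_prob (M n) (X n) n k) = chain_prob n k"
proof -
  interpret prob_space "M n" using assms(1) by (simp add: uniform_points_def)
  let ?I = "{1..n}"
  let ?Y = "\<lambda>\<omega>. \<lambda>i\<in>?I. X n i \<omega>"
  have indep: "indep_vars (\<lambda>_. borel) (X n) ?I"
    and distr: "\<And>i. i \<in> ?I \<Longrightarrow> distr (M n) borel (X n i) = uniform_triangle"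
    using assms(1) by (auto simp: uniform_points_def)
  have rv: "random_variable borel (X n i)" if "i \<in> ?I" for i
    using indep that by (auto simp: indep_vars_def)
  have joint: "distr (M n) (\<Pi>\<^sub>M i\<in>?I. borel) ?Y = (\<Pi>\<^sub>M i\<in>?I. uniform_triangle)"
  proof -
    have "distr (M n) (\<Pi>\<^sub>M i\<in>?I. borel) ?Y = (\<Pi>\<^sub>M i\<in>?I. distr (M n) borel (X n i))"
      using indep_vars_iff_distr_eq_PiM'[where I = ?I and X = "X n" and M' = "\<lambda>_. borel"] indep rv assms(2) by simp
    also have "\<dots> = (\<Pi>\<^sub>M i\<in>?I. uniform_triangle)"
      by (rule PiM_cong) (auto simp: distr)
    finally show ?thesis .
  qed
  have Y: "?Y \<in> measurable (M n) (\<Pi>\<^sub>M i\<in>?I. borel)"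
    by (rule measurable_restrict) (use rv in auto)
  have ind: "(\<lambda>x. chain_indicator k (x ` J)) \<in> borel_measurable (\<Pi>\<^sub>M i\<in>J. borel)" if "finite J" for J :: "nat set"
  proof -
    have P: "Measurable.pred (\<Pi>\<^sub>M i\<in>J. borel)
        (\<lambda>x. num_vertices (convex hull ({(1, 0), (0, 1)} \<union> (\<lambda>i. x i) ` J)) = k + 2)"
      by (rule measurable_num_vertices_eq) (use that in auto)
    have "(\<lambda>x. if num_vertices (convex hull ({(1, 0), (0, 1)} \<union> (\<lambda>i. x i) ` J)) = k + 2 then 1 else 0 :: ennreal)
        \<in> borel_measurable (\<Pi>\<^sub>M i\<in>J. borel)"
      by (rule measurable_If[OF measurable_const measurable_const predE[OF P]]) auto
    then show ?thesis by (simp only: chain_indicator_def indicator_def mem_Collect_eq of_bool_def)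
  qed
  have img: "?Y \<omega> ` ?I = (\<lambda>i. X n i \<omega>) ` ?I" for \<omega> by auto
  let ?E = "{\<omega> \<in> space (M n). num_vertices (chain_hull (X n) n \<omega>) = k + 2}"
  have E: "?E \<in> sets (M n)"
    unfolding chain_hull_def
    using measurable_num_vertices_eq[of ?I "X n" "M n" "k + 2"] rv by (simp add: pred_def)
  have "ennreal (vertex_prob (M n) (X n) n k) = emeasure (M n) ?E"
    by (simp add: vertex_prob_def emeasure_eq_measure)
  also have "\<dots> = (\<integral>\<^sup>+ \<omega>. indicator ?E \<omega> \<partial>M n)" using E by simp
  also have "\<dots> = (\<integral>\<^sup>+ \<omega>. chain_indicator k (?Y \<omega> ` ?I) \<partial>M n)"
    unfolding img by (intro nn_integral_cong) (auto simp: chain_indicator_def chain_hull_def indicator_def)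
  also have "\<dots> = (\<integral>\<^sup>+ x. chain_indicator k (x ` ?I) \<partial>distr (M n) (\<Pi>\<^sub>M i\<in>?I. borel) ?Y)"
    by (rule nn_integral_distr[symmetric, OF Y]) (use ind[of ?I] in simp)
  also have "\<dots> = set_expectation uniform_triangle (card ?I) (chain_indicator k)"
    unfolding joint by (rule uniform_triangle.nn_integral_PiM_image) (auto intro: ind)
  finally show ?thesis by (simp add: chain_prob_def)
qed

definition chain_coeff :: "nat \<Rightarrow> nat \<Rightarrow> real" where
  "chain_coeff n k = enn2real (chain_prob n k)"

lemma chain_prob_finite: "chain_prob n k < top"
proof (induction n arbitrary: k rule: less_induct)
  case (less n)
  show ?case
  proof (cases n)
    case 0
    then show ?thesis by (simp add: chain_prob_0)
  next
    case (Suc j)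
    have "ennreal c * (if k = 0 then 0 else chain_prob m (k - 1)) < top" if "m \<le> j" for m c
      using less[of m "k - 1"] Suc that by (auto simp: ennreal_mult_less_top)
    then show ?thesis unfolding Suc chain_prob_Suc by simp
  qed
qed

lemma chain_coeff_nonneg: "chain_coeff n k \<ge> 0"
  by (simp add: chain_coeff_def)

lemma chain_coeff_0: "chain_coeff 0 k = (if k = 0 then 1 else 0)"
  by (simp add: chain_coeff_def chain_prob_0)

lemma chain_coeff_Suc_0: "chain_coeff (Suc n) 0 = 0"
  by (simp add: chain_coeff_def chain_prob_Suc)

lemma chain_coeff_Suc_Suc:
  "real (n + 1) * real (n + 2) * chain_coeff (Suc n) (Suc k) = (\<Sum>m\<le>n. 2 * real (n - m + 1) * chain_coeff m k)"
proof -
  have A: "chain_coeff (Suc n) (Suc k)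
      = (\<Sum>m\<le>n. 2 * real (n - m + 1) / (real (n + 1) * real (n + 2)) * chain_coeff m k)"
    unfolding chain_coeff_def chain_prob_Suc
    using chain_prob_finite
    by (subst enn2real_sum) (auto simp: ennreal_mult_less_top enn2real_mult)
  have "real (n + 1) * real (n + 2) * chain_coeff (Suc n) (Suc k)
      = (\<Sum>m\<le>n. real (n + 1) * real (n + 2) * (2 * real (n - m + 1) / (real (n + 1) * real (n + 2)) * chain_coeff m k))"
    unfolding A by (rule sum_distrib_left)
  also have "\<dots> = (\<Sum>m\<le>n. 2 * real (n - m + 1) * chain_coeff m k)"
  proof (intro sum.cong refl)
    fix m
    have cancel: "c * (x / c * y) = x * y" if "c \<noteq> 0" for c x y :: real
      using that by simp
    show "real (n + 1) * real (n + 2) * (2 * real (n - m + 1) / (real (n + 1) * real (n + 2)) * chain_coeff m k)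
        = 2 * real (n - m + 1) * chain_coeff m k"
      by (rule cancel) simp
  qed
  finally show ?thesis .
qed

text \<open>The partial sums \<open>S\<close> below have weights that are linear in \<open>n\<close>, so their second difference is a
  single term.\<close>

lemma chain_coeff_recurrence:
  "real (n + 2) * real (n + 3) * chain_coeff (n + 2) (Suc k)
   = 2 * real (n + 1) * real (n + 2) * chain_coeff (n + 1) (Suc k)
     - real n * real (n + 1) * chain_coeff n (Suc k) + 2 * chain_coeff (n + 1) k"
proof -
  define S where "S n = (\<Sum>m\<le>n. 2 * real (n - m + 1) * chain_coeff m k)" for n
  define T where "T n = (\<Sum>m\<le>n. 2 * chain_coeff m k)" for n
  have S_Suc: "S (Suc n) = S n + T (Suc n)" for n
  proof -
    have "S (Suc n) = (\<Sum>m\<le>n. 2 * real (Suc n - m + 1) * chain_coeff m k) + 2 * chain_coeff (Suc n) k"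
      by (simp add: S_def)
    also have "(\<Sum>m\<le>n. 2 * real (Suc n - m + 1) * chain_coeff m k) = S n + T n"
      unfolding S_def T_def sum.distrib[symmetric]
      by (intro sum.cong refl) (simp add: Suc_diff_le algebra_simps)
    finally show ?thesis by (simp add: T_def)
  qed
  have c: "real (n + 1) * real (n + 2) * chain_coeff (Suc n) (Suc k) = S n" for n
    unfolding S_def by (rule chain_coeff_Suc_Suc)
  have e: "Suc n + 1 = n + 2" "Suc n + 2 = n + 3" "Suc (Suc n) = n + 2" by simp_all
  have c2: "real (n + 2) * real (n + 3) * chain_coeff (n + 2) (Suc k) = S (Suc n)"
    using c[of "Suc n"] unfolding e .
  have c1: "2 * real (n + 1) * real (n + 2) * chain_coeff (n + 1) (Suc k) = 2 * S n"
    unfolding c[of n, symmetric] by (simp only: mult.assoc Suc_eq_plus1)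
  show ?thesis
  proof (cases n)
    case 0
    have "S (Suc n) = S n + T (Suc n)" by (rule S_Suc)
    moreover have "S n = 2 * chain_coeff 0 k" "T (Suc n) = 2 * chain_coeff 0 k + 2 * chain_coeff (n + 1) k"
      using 0 by (simp_all add: S_def T_def)
    ultimately show ?thesis unfolding c2 c1 using 0 by simp
  next
    case (Suc j)
    have c0: "real n * real (n + 1) * chain_coeff n (Suc k) = S j"
      using c[of j] Suc by simp
    have "T (Suc n) = T n + 2 * chain_coeff (n + 1) k" by (simp add: T_def)
    then have "S (Suc n) = 2 * S n - S j + 2 * chain_coeff (n + 1) k"
      using S_Suc[of n] S_Suc[of j] Suc by simp
    then show ?thesis unfolding c2 c1 c0 .
  qed
qed

lemma chain_coeff_eq_0: "n < k \<Longrightarrow> chain_coeff n k = 0"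
proof (induction n arbitrary: k rule: less_induct)
  case (less n)
  then obtain k' where k: "k = Suc k'" by (cases k) auto
  show ?case
  proof (cases n)
    case 0
    then show ?thesis using k by (simp add: chain_coeff_0)
  next
    case (Suc j)
    have "(\<Sum>m\<le>j. 2 * real (j - m + 1) * chain_coeff m k') = 0"
      using less.IH[of _ k'] less.prems Suc k by (intro sum.neutral) auto
    then have "real (j + 1) * real (j + 2) * chain_coeff n k = 0"
      unfolding Suc k chain_coeff_Suc_Suc .
    moreover have "real (j + 1) * real (j + 2) \<noteq> 0" by simp
    ultimately show ?thesis by (metis mult_eq_0_iff)
  qed
qed

text \<open>The cases \<open>n = 0\<close> and \<open>n = 1\<close> of the polynomials are set by convention; the recursion for the law
  of the number of vertices gives the same values.\<close>

lemma coeff_chain_poly: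
  assumes "uniform_points M X"
  shows "coeff (chain_poly M X n) k = of_real (chain_coeff n k)"
proof -
  consider "n = 0" | "n = 1" | "n \<ge> 2" by linarith
  then show ?thesis
  proof cases
    case 1
    then show ?thesis by (simp add: chain_poly_def chain_coeff_0)
  next
    case 2
    have "chain_coeff 1 1 = 1" using chain_coeff_Suc_Suc[of 0 0] by (simp add: chain_coeff_0)
    then show ?thesis
      using 2 chain_coeff_eq_0[of 1 k] chain_coeff_Suc_0[of 0]
      by (auto simp: chain_poly_def coeff_pCons split: nat.split)
  next
    case 3
    have p: "vertex_prob (M n) (X n) n j = chain_coeff n j" for j
      using vertex_prob_eq_chain_prob[OF assms, of n j] 3
      by (metis chain_coeff_def enn2real_ennreal measure_nonneg not_numeral_le_zero vertex_prob_def)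
    have "coeff (chain_poly M X n) k = (\<Sum>j=1..n. if j = k then of_real (chain_coeff n j) else 0)"
      using 3 by (simp add: chain_poly_def coeff_sum p)
    also have "\<dots> = (if k \<in> {1..n} then of_real (chain_coeff n k) else 0)" by simp
    also have "\<dots> = of_real (chain_coeff n k)"
    proof (cases "k = 0")
      case True
      then show ?thesis using 3 chain_coeff_Suc_0[of "n - 1"] by simp
    next
      case False
      then show ?thesis using chain_coeff_eq_0[of n k] by auto
    qed
    finally show ?thesis .
  qed
qed

text \<open>The three-term recurrence satisfied by the coefficients of a solution of the differential
  equation with parameter \<open>c\<close>, over any coefficient ring: formal power series in \<open>z\<close> with \<open>c = z\<close>,
  polynomials, and complex numbers are all needed.\<close>

definition chain_recurrence :: "'a::comm_ring_1 \<Rightarrow> (nat \<Rightarrow> 'a) \<Rightarrow> bool" where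
  "chain_recurrence c a \<longleftrightarrow> 2 * a 1 = 2 * c * a 0 \<and>
     (\<forall>n. of_nat ((n + 2) * (n + 3)) * a (n + 2)
        = (of_nat (2 * (n + 1) * (n + 2)) + 2 * c) * a (n + 1) - of_nat (n * (n + 1)) * a n)"

lemma chain_recurrence_iff_fps_ode:
  fixes H :: "'a::comm_ring_1 fps"
  shows "fps_X * (fps_X - 1)\<^sup>2 * fps_deriv (fps_deriv H) + 2 * (fps_X - 1)\<^sup>2 * fps_deriv H
       - 2 * fps_const c * H = 0 \<longleftrightarrow> chain_recurrence c (fps_nth H)" (is "?O = 0 \<longleftrightarrow> _")
proof -
  define D1 where "D1 = fps_deriv H"
  define D2 where "D2 = fps_deriv (fps_deriv H)"
  have "?O = fps_X ^ 3 * D2 - fps_const 2 * (fps_X ^ 2 * D2) + fps_X ^ 1 * D2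
      + fps_const 2 * (fps_X ^ 2 * D1) - fps_const 4 * (fps_X ^ 1 * D1) + fps_const 2 * D1 - fps_const (2 * c) * H"
    unfolding D1_def D2_def
    by (simp add: power2_eq_square power3_eq_cube algebra_simps flip: fps_const_mult numeral_fps_const)
  then have nth: "?O $ n = (if n < 3 then 0 else D2 $ (n - 3)) - 2 * (if n < 2 then 0 else D2 $ (n - 2))
      + (if n < 1 then 0 else D2 $ (n - 1)) + 2 * (if n < 2 then 0 else D1 $ (n - 2))
      - 4 * (if n < 1 then 0 else D1 $ (n - 1)) + 2 * D1 $ n - 2 * c * H $ n" for n
    by (simp only: fps_add_nth fps_sub_nth fps_mult_left_const_nth fps_X_power_mult_nth)
  have D1: "D1 $ n = of_nat (n + 1) * H $ (n + 1)" for n by (simp add: D1_def)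
  have D2: "D2 $ n = of_nat (n + 1) * (of_nat (n + 2) * H $ (n + 2))" for n by (simp add: D2_def)
  have z: "?O $ 0 = 2 * H $ 1 - 2 * c * H $ 0" unfolding nth D1 by simp
  have s: "?O $ (n + 1) = of_nat ((n + 2) * (n + 3)) * H $ (n + 2)
      - ((of_nat (2 * (n + 1) * (n + 2)) + 2 * c) * H $ (n + 1) - of_nat (n * (n + 1)) * H $ n)" for n
  proof -
    consider "n = 0" | "n = 1" | m where "n = Suc (Suc m)" by (metis One_nat_def not0_implies_Suc)
    then show ?thesis
    proof cases
      case 1
      show ?thesis unfolding nth D1 D2 1 by (simp add: algebra_simps numeral_eq_Suc)
    next
      case 2
      show ?thesis unfolding nth D1 D2 2 by (simp add: algebra_simps numeral_eq_Suc)
    next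
      case 3
      show ?thesis unfolding nth D1 D2 3 by (simp add: algebra_simps numeral_eq_Suc)
    qed
  qed
  have "?O = 0 \<longleftrightarrow> ?O $ 0 = 0 \<and> (\<forall>n. ?O $ (n + 1) = 0)"
    by (metis Suc_eq_plus1 fps_ext fps_zero_nth not0_implies_Suc)
  then show ?thesis unfolding z s chain_recurrence_def by simp
qed

lemma chain_recurrence_unique:
  fixes a b :: "nat \<Rightarrow> 'a::idom"
  assumes char_0: "\<And>n. of_nat (Suc n) \<noteq> (0 :: 'a)"
    and "chain_recurrence c a" "chain_recurrence c b" "a 0 = b 0"
  shows "a n = b n"
proof (induction n rule: less_induct)
  case (less n)
  consider "n = 0" | "n = 1" | m where "n = m + 2"
    by (metis One_nat_def Suc_1 add_2_eq_Suc' not0_implies_Suc)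
  then show ?case
  proof cases
    case 1
    then show ?thesis using assms(4) by simp
  next
    case 2
    have "2 * a 1 = 2 * c * a 0" "2 * b 1 = 2 * c * b 0"
      using assms unfolding chain_recurrence_def by blast+
    then have "2 * a 1 = 2 * b 1" by (simp only: assms(4))
    then show ?thesis using 2 char_0[of 1] by simp
  next
    case 3
    then have "a (m + 1) = b (m + 1)" "a m = b m" using less by auto
    then have "of_nat ((m + 2) * (m + 3)) * a (m + 2) = of_nat ((m + 2) * (m + 3)) * b (m + 2)"
      using assms(2,3) unfolding chain_recurrence_def by presburger
    moreover have "of_nat ((m + 2) * (m + 3)) \<noteq> (0 :: 'a)"
    proof -
      have "(m + 2) * (m + 3) = Suc ((m + 2) * (m + 3) - 1)" by simp
      then show ?thesis using char_0 by metis
    qed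
    ultimately show ?thesis using 3 by (metis mult_left_cancel)
  qed
qed

context
  fixes M :: "nat \<Rightarrow> 'w measure" and X :: "nat \<Rightarrow> nat \<Rightarrow> 'w \<Rightarrow> real \<times> real"
  assumes up: "uniform_points M X"
begin

lemma chain_recurrence_poly:
  "chain_recurrence [:0, 1:] (chain_poly M X)"
  unfolding chain_recurrence_def
proof (intro conjI allI)
  have "chain_coeff 1 1 = 1" using chain_coeff_Suc_Suc[of 0 0] by (simp add: chain_coeff_0)
  show "2 * chain_poly M X 1 = 2 * [:0, 1:] * chain_poly M X 0"
    by (simp add: chain_poly_def)
  fix n
  show "of_nat ((n + 2) * (n + 3)) * chain_poly M X (n + 2)
     = (of_nat (2 * (n + 1) * (n + 2)) + 2 * [:0, 1:]) * chain_poly M X (n + 1) - of_nat (n * (n + 1)) * chain_poly M X n"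
  proof (rule poly_eqI)
    fix k
    have c: "coeff (of_nat j * p) l = of_nat j * coeff p l" for j l and p :: "complex poly"
      by (simp add: of_nat_poly)
    have t: "(of_nat j + 2 * [:0, 1:]) * p = of_nat j * p + pCons 0 (smult 2 p)" for j and p :: "complex poly"
      by (simp add: algebra_simps numeral_poly)
    show "coeff (of_nat ((n + 2) * (n + 3)) * chain_poly M X (n + 2)) k
       = coeff ((of_nat (2 * (n + 1) * (n + 2)) + 2 * [:0, 1:]) * chain_poly M X (n + 1)
           - of_nat (n * (n + 1)) * chain_poly M X n) k"
    proof (cases k)
      case 0
      then show ?thesis
        unfolding t coeff_add coeff_diff c coeff_chain_poly[OF up]
        by (cases n) (simp_all add: chain_coeff_Suc_0)
    next
      case (Suc j)
      have "complex_of_real (real (n + 2) * real (n + 3) * chain_coeff (n + 2) (Suc j))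
        = complex_of_real (2 * real (n + 1) * real (n + 2) * chain_coeff (n + 1) (Suc j)
            - real n * real (n + 1) * chain_coeff n (Suc j) + 2 * chain_coeff (n + 1) j)"
        by (simp only: chain_coeff_recurrence)
      then show ?thesis
        unfolding t coeff_add coeff_diff c Suc coeff_pCons_Suc coeff_smult coeff_chain_poly[OF up]
        by (simp add: algebra_simps)
    qed
  qed
qed

lemma chain_recurrence_poly_eval: "chain_recurrence z (\<lambda>n. poly (chain_poly M X n) z)"
  unfolding chain_recurrence_def
proof (intro conjI allI)
  show "2 * poly (chain_poly M X 1) z = 2 * z * poly (chain_poly M X 0) z"
    by (simp add: chain_poly_def)
  fix n
  have pz: "poly [:0, 1:] z = z" by simp
  from chain_recurrence_poly
  have "poly (of_nat ((n + 2) * (n + 3)) * chain_poly M X (n + 2)) z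
     = poly ((of_nat (2 * (n + 1) * (n + 2)) + 2 * [:0, 1:]) * chain_poly M X (n + 1)
         - of_nat (n * (n + 1)) * chain_poly M X n) z"
    unfolding chain_recurrence_def by metis
  then show "of_nat ((n + 2) * (n + 3)) * poly (chain_poly M X (n + 2)) z
     = (of_nat (2 * (n + 1) * (n + 2)) + 2 * z) * poly (chain_poly M X (n + 1)) z
       - of_nat (n * (n + 1)) * poly (chain_poly M X n) z"
    by (simp only: poly_mult poly_add poly_diff poly_of_nat poly_numeral pz)
qed

lemma formal_chain_ode_chain_gf: "formal_chain_ode (chain_gf M X)"
proof -
  have nth: "fps_nth (chain_gf M X) = (\<lambda>n. fps_of_poly (chain_poly M X n))"
    by (simp add: chain_gf_def fun_eq_iff)
  have "chain_recurrence fps_X (fps_nth (chain_gf M X))"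
    unfolding chain_recurrence_def nth
  proof (intro conjI allI)
    show "2 * fps_of_poly (chain_poly M X 1) = 2 * fps_X * fps_of_poly (chain_poly M X 0)"
      by (simp add: chain_poly_def fps_of_poly_pCons)
    fix n
    have E: "of_nat ((n + 2) * (n + 3)) * chain_poly M X (n + 2)
       = (of_nat (2 * (n + 1) * (n + 2)) + 2 * [:0, 1:]) * chain_poly M X (n + 1)
           - of_nat (n * (n + 1)) * chain_poly M X n"
      using chain_recurrence_poly unfolding chain_recurrence_def by blast
    have X: "fps_of_poly [:0, 1:] = (fps_X :: complex fps)" by (simp add: fps_of_poly_pCons)
    have N: "fps_of_poly (of_nat j :: complex poly) = of_nat j" for j
      by (simp only: of_nat_poly fps_of_poly_const fps_of_nat)
    show "of_nat ((n + 2) * (n + 3)) * fps_of_poly (chain_poly M X (n + 2))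
       = (of_nat (2 * (n + 1) * (n + 2)) + 2 * fps_X) * fps_of_poly (chain_poly M X (n + 1))
         - of_nat (n * (n + 1)) * fps_of_poly (chain_poly M X n)"
      using arg_cong[OF E, of fps_of_poly]
      unfolding fps_of_poly_mult fps_of_poly_add fps_of_poly_diff fps_of_poly_numeral N X .
  qed
  then show ?thesis
    unfolding formal_chain_ode_def chain_recurrence_iff_fps_ode
    by (simp add: nth chain_poly_def fps_of_poly_pCons)
qed

end

lemma formal_chain_ode_unique:
  assumes "formal_chain_ode F" "formal_chain_ode G"
  shows "F = G"
proof (rule fps_ext)
  fix n
  have "of_nat (Suc j) \<noteq> (0 :: complex fps)" for j
    unfolding fps_of_nat[symmetric] by (simp only: fps_const_eq_0_iff of_nat_eq_0_iff)
  moreover have "chain_recurrence fps_X (fps_nth F)" "chain_recurrence fps_X (fps_nth G)"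
    "fps_nth F 0 = fps_nth G 0"
    using assms unfolding formal_chain_ode_def chain_recurrence_iff_fps_ode by simp_all
  ultimately show "fps_nth F n = fps_nth G n"
    by (rule chain_recurrence_unique)
qed

section \<open>The solution as a power series in z\<close>

lemma open_u_domain: "open u_domain"
  unfolding u_domain_def
  by (intro open_Compl closed_injective_linear_image closed_atLeast
      bounded_linear.linear[OF bounded_linear_of_real]) (auto intro: inj_of_real)

lemma ball_subset_u_domain: "ball 0 1 \<subseteq> u_domain"
  by (auto simp: u_domain_def)

lemma zero_in_u_domain [simp]: "0 \<in> u_domain"
  by (auto simp: u_domain_def)

lemma one_notin_u_domain [simp]: "1 \<notin> u_domain"
  by (auto simp: u_domain_def intro!: image_eqI[of _ _ 1])

lemma u_domain_iff: "u \<in> u_domain \<longleftrightarrow> 1 - u \<notin> \<real>\<^sub>\<le>\<^sub>0"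
  by (auto simp: u_domain_def complex_nonpos_Reals_iff complex_eq_iff image_iff)

lemma scaleR_in_u_domain:
  assumes "u \<in> u_domain" "0 \<le> r" "r \<le> 1"
  shows "of_real r * u \<in> u_domain"
proof (cases "r = 0")
  case False
  show ?thesis
  proof (rule ccontr)
    assume "of_real r * u \<notin> u_domain"
    then obtain x where x: "x \<ge> 1" "of_real r * u = complex_of_real x" by (auto simp: u_domain_def)
    then have "u = complex_of_real (x / r)" using False by (simp add: field_simps)
    moreover have "x / r \<ge> 1" using x assms False by (simp add: field_simps)
    ultimately have "u \<in> complex_of_real ` {1..}" by blast
    then show False using assms(1) by (simp add: u_domain_def)
  qed
qed simp

lemma starlike_u_domain: "starlike u_domain"
  unfolding starlike_def
proof (intro bexI ballI)
  fix u assume "u \<in> u_domain"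
  then show "closed_segment 0 u \<subseteq> u_domain"
    by (auto simp: closed_segment_def scaleR_conv_of_real intro: scaleR_in_u_domain)
qed simp

lemma primitive_u_domain:
  assumes "f holomorphic_on u_domain"
  obtains g where "g 0 = 0" "\<And>u. u \<in> u_domain \<Longrightarrow> (g has_field_derivative f u) (at u)"
proof -
  obtain g where g: "\<forall>u\<in>u_domain. (g has_field_derivative f u) (at u)"
    using holomorphic_starlike_primitive[OF holomorphic_on_imp_continuous_on[OF assms]
        starlike_u_domain open_u_domain finite.emptyI] assms open_u_domain
    by (auto simp: holomorphic_on_imp_differentiable_at)
  show ?thesis
    by (rule that[of "\<lambda>u. g u - g 0"]) (use g in \<open>auto intro!: derivative_eq_intros\<close>)
qed

text \<open>A bound that decays like \<open>r\<^sup>k\<close> along the ray gains the factor \<open>1 / (k + 1)\<close> under integration; this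
  is the source of the factorials in the estimate of the Picard increments.\<close>

lemma norm_primitive_le:
  assumes g: "g 0 = 0" "\<And>u. u \<in> u_domain \<Longrightarrow> (g has_field_derivative f u) (at u)"
    and u: "u \<in> u_domain" and f: "\<And>r. 0 \<le> r \<Longrightarrow> r \<le> 1 \<Longrightarrow> norm (f (of_real r * u)) \<le> c * r ^ k"
  shows "norm (g u) \<le> norm u * c / real (k + 1)"
proof -
  have "((\<lambda>r. u * f (of_real r * u)) has_integral g (of_real 1 * u) - g (of_real 0 * u)) {0..1}"
  proof (rule fundamental_theorem_of_calculus)
    fix r :: real assume r: "r \<in> {0..1}"
    have "((\<lambda>r. of_real r * u) has_vector_derivative u) (at r)"
      by (auto intro!: derivative_eq_intros simp: has_vector_derivative_def scaleR_conv_of_real)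
    from field_vector_diff_chain_at[OF this g(2)] r u
    have "(g \<circ> (\<lambda>r. of_real r * u) has_vector_derivative u * f (of_real r * u)) (at r)"
      by (simp add: scaleR_in_u_domain)
    then show "((\<lambda>r. g (of_real r * u)) has_vector_derivative u * f (of_real r * u)) (at r within {0..1})"
      by (simp add: o_def has_vector_derivative_at_within)
  qed simp
  then have I: "((\<lambda>r. u * f (of_real r * u)) has_integral g u) {0..1}" using g(1) by simp
  have "((\<lambda>r. norm u * c * (r ^ (k + 1) / real (k + 1))) has_vector_derivative norm u * c * r ^ k) (at r within {0..1})" for r
    unfolding has_real_derivative_iff_has_vector_derivative[symmetric]
    by (auto intro!: derivative_eq_intros simp del: power_Suc of_nat_Suc)
  then have J: "((\<lambda>r. norm u * c * r ^ k) has_integral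
      norm u * c * (1 ^ (k + 1) / real (k + 1)) - norm u * c * (0 ^ (k + 1) / real (k + 1))) {0..1}"
    by (intro fundamental_theorem_of_calculus) auto
  have "norm (integral {0..1} (\<lambda>r. u * f (of_real r * u))) \<le> integral {0..1} (\<lambda>r. norm u * c * r ^ k)"
  proof (rule integral_norm_bound_integral)
    fix r :: real assume "r \<in> {0..1}"
    then show "norm (u * f (of_real r * u)) \<le> norm u * c * r ^ k"
      using f[of r] by (simp add: norm_mult mult.assoc mult_left_mono)
  qed (use I J in \<open>auto intro: has_integral_integrable\<close>)
  then show ?thesis
    using integral_unique[OF I] integral_unique[OF J] by simp
qed

text \<open>One step of the iteration. Since \<open>u \<phi>'' + 2 \<phi>' = (u \<phi>)''\<close>, the right-hand side is integrated twice
  and the result divided by \<open>u\<close>; the singularity at the origin is removable.\<close>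

lemma second_order_step:
  assumes "f holomorphic_on u_domain"
  obtains \<phi> where "\<phi> holomorphic_on u_domain" "\<phi> 0 = 0"
    "\<And>u. u \<in> u_domain \<Longrightarrow> u * deriv (deriv \<phi>) u + 2 * deriv \<phi> u = f u"
    "\<And>u c k. u \<in> u_domain \<Longrightarrow> (\<And>r. 0 \<le> r \<Longrightarrow> r \<le> 1 \<Longrightarrow> norm (f (of_real r * u)) \<le> c * r ^ k)
        \<Longrightarrow> norm (\<phi> u) \<le> norm u * c / real (k + 1)"
proof -
  obtain g1 where g1: "g1 0 = 0" "\<And>u. u \<in> u_domain \<Longrightarrow> (g1 has_field_derivative f u) (at u)"
    using primitive_u_domain[OF assms] by blast
  have hol1: "g1 holomorphic_on u_domain"
    using g1(2) by (auto simp: holomorphic_on_open[OF open_u_domain])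
  obtain g2 where g2: "g2 0 = 0" "\<And>u. u \<in> u_domain \<Longrightarrow> (g2 has_field_derivative g1 u) (at u)"
    using primitive_u_domain[OF hol1] by blast
  have hol2: "g2 holomorphic_on u_domain"
    using g2(2) by (auto simp: holomorphic_on_open[OF open_u_domain])
  define \<phi> where "\<phi> u = (if u = 0 then 0 else g2 u / u)" for u
  have "deriv g2 0 = 0" using DERIV_imp_deriv[OF g2(2)[of 0]] g1(1) by simp
  then have hol: "\<phi> holomorphic_on u_domain"
    by (intro pole_theorem_open_0[OF hol2 open_u_domain, of 0]) (auto simp: \<phi>_def g2(1))
  have d: "(\<phi> has_field_derivative deriv \<phi> u) (at u)" "(deriv \<phi> has_field_derivative deriv (deriv \<phi>) u) (at u)"
    if "u \<in> u_domain" for u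
    using holomorphic_derivI[OF hol open_u_domain that]
      holomorphic_derivI[OF holomorphic_deriv[OF hol open_u_domain] open_u_domain that] by auto
  have g2_eq: "g2 u = u * \<phi> u" for u by (simp add: \<phi>_def g2(1))
  have e1: "g1 u = \<phi> u + u * deriv \<phi> u" if "u \<in> u_domain" for u
  proof -
    have "((\<lambda>u. u * \<phi> u) has_field_derivative (\<phi> u + u * deriv \<phi> u)) (at u)"
      by (rule derivative_eq_intros refl d(1)[OF that])+ simp
    moreover have "((\<lambda>u. u * \<phi> u) has_field_derivative g1 u) (at u)"
      using g2(2)[OF that] by (simp add: g2_eq[abs_def])
    ultimately show ?thesis by (metis DERIV_unique)
  qed
  have e2: "u * deriv (deriv \<phi>) u + 2 * deriv \<phi> u = f u" if u: "u \<in> u_domain" for u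
  proof -
    have "((\<lambda>u. \<phi> u + u * deriv \<phi> u) has_field_derivative (deriv \<phi> u + (deriv \<phi> u + u * deriv (deriv \<phi>) u))) (at u)"
      by (rule derivative_eq_intros refl d[OF that])+ simp
    moreover have "((\<lambda>u. \<phi> u + u * deriv \<phi> u) has_field_derivative f u) (at u)"
      using g1(2)[OF u] by (rule DERIV_cong_ev[THEN iffD1, rotated -1])
        (use e1 u open_u_domain in \<open>auto intro!: eventually_mono[OF eventually_nhds_in_open[of u_domain]]\<close>)
    ultimately have "deriv \<phi> u + (deriv \<phi> u + u * deriv (deriv \<phi>) u) = f u" by (rule DERIV_unique)
    then show ?thesis by (simp add: algebra_simps)
  qed
  have bound: "norm (\<phi> u) \<le> norm u * c / real (k + 1)"
    if u: "u \<in> u_domain" and f: "\<And>r. 0 \<le> r \<Longrightarrow> r \<le> 1 \<Longrightarrow> norm (f (of_real r * u)) \<le> c * r ^ k" for u c k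
  proof -
    have c: "c \<ge> 0" using f[of 1] by (metis le_numeral_extra(4) mult.right_neutral norm_ge_zero order_trans power_one zero_le_one)
    have B: "norm (g1 (of_real r * u)) \<le> norm u * c / real (k + 1) * r ^ (k + 1)" if r: "0 \<le> r" "r \<le> 1" for r
    proof -
      have "norm (g1 (of_real r * u)) \<le> norm (of_real r * u) * (c * r ^ k) / real (k + 1)"
      proof (rule norm_primitive_le[OF g1 scaleR_in_u_domain[OF u r]])
        fix s :: real assume s: "0 \<le> s" "s \<le> 1"
        then have "norm (f (of_real (s * r) * u)) \<le> c * (s * r) ^ k"
          using r by (intro f) (auto simp: mult_le_one)
        then show "norm (f (of_real s * (of_real r * u))) \<le> c * r ^ k * s ^ k"
          by (simp add: power_mult_distrib mult_ac)
      qed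
      then show ?thesis using r by (simp add: norm_mult mult_ac)
    qed
    have "norm (g2 u) \<le> norm u * (norm u * c / real (k + 1)) / real (k + 1 + 1)"
      by (rule norm_primitive_le[OF g2 u B])
    \<comment> \<open>One factor \<open>1 / (k + 1)\<close> per step is enough, so the second one is given away.\<close>
    also have "\<dots> \<le> norm u * (norm u * c / real (k + 1)) / 1"
      using c by (intro divide_left_mono) auto
    finally have le: "norm u * norm (\<phi> u) \<le> norm u * (norm u * c / real (k + 1))"
      by (simp add: g2_eq norm_mult)
    show ?thesis
    proof (cases "u = 0")
      case False
      then show ?thesis using le by (metis mult_le_cancel_left_pos zero_less_norm_iff)
    qed (simp add: \<phi>_def)
  qed
  show ?thesis by (rule that[OF hol _ e2 bound]) (auto simp: \<phi>_def)
qed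

definition ode_step :: "(complex \<Rightarrow> complex) \<Rightarrow> (complex \<Rightarrow> complex)" where
  "ode_step f = (SOME \<phi>. \<phi> holomorphic_on u_domain \<and> \<phi> 0 = 0 \<and>
    (\<forall>u\<in>u_domain. u * deriv (deriv \<phi>) u + 2 * deriv \<phi> u = f u) \<and>
    (\<forall>u\<in>u_domain. \<forall>c k. (\<forall>r. 0 \<le> r \<longrightarrow> r \<le> 1 \<longrightarrow> norm (f (of_real r * u)) \<le> c * r ^ k)
        \<longrightarrow> norm (\<phi> u) \<le> norm u * c / real (k + 1)))"

lemma ode_step:
  assumes "f holomorphic_on u_domain"
  shows "ode_step f holomorphic_on u_domain" "ode_step f 0 = 0"
    "\<And>u. u \<in> u_domain \<Longrightarrow> u * deriv (deriv (ode_step f)) u + 2 * deriv (ode_step f) u = f u"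
    "\<And>u c k. u \<in> u_domain \<Longrightarrow> (\<And>r. 0 \<le> r \<Longrightarrow> r \<le> 1 \<Longrightarrow> norm (f (of_real r * u)) \<le> c * r ^ k)
        \<Longrightarrow> norm (ode_step f u) \<le> norm u * c / real (k + 1)"
proof -
  obtain \<phi> where "\<phi> holomorphic_on u_domain" "\<phi> 0 = 0"
    "\<And>u. u \<in> u_domain \<Longrightarrow> u * deriv (deriv \<phi>) u + 2 * deriv \<phi> u = f u"
    "\<And>u c k. u \<in> u_domain \<Longrightarrow> (\<And>r. 0 \<le> r \<Longrightarrow> r \<le> 1 \<Longrightarrow> norm (f (of_real r * u)) \<le> c * r ^ k)
        \<Longrightarrow> norm (\<phi> u) \<le> norm u * c / real (k + 1)"
    using second_order_step[OF assms] by blast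
  then have "\<exists>\<phi>. \<phi> holomorphic_on u_domain \<and> \<phi> 0 = 0 \<and>
    (\<forall>u\<in>u_domain. u * deriv (deriv \<phi>) u + 2 * deriv \<phi> u = f u) \<and>
    (\<forall>u\<in>u_domain. \<forall>c k. (\<forall>r. 0 \<le> r \<longrightarrow> r \<le> 1 \<longrightarrow> norm (f (of_real r * u)) \<le> c * r ^ k)
        \<longrightarrow> norm (\<phi> u) \<le> norm u * c / real (k + 1))" by blast
  from someI_ex[OF this, folded ode_step_def]
  show "ode_step f holomorphic_on u_domain" "ode_step f 0 = 0"
    "\<And>u. u \<in> u_domain \<Longrightarrow> u * deriv (deriv (ode_step f)) u + 2 * deriv (ode_step f) u = f u"
    "\<And>u c k. u \<in> u_domain \<Longrightarrow> (\<And>r. 0 \<le> r \<Longrightarrow> r \<le> 1 \<Longrightarrow> norm (f (of_real r * u)) \<le> c * r ^ k)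
        \<Longrightarrow> norm (ode_step f u) \<le> norm u * c / real (k + 1)"
    by blast+
qed

text \<open>The coefficients \<open>\<phi>\<^sub>k\<close> of \<open>z\<^sup>k\<close> in the solution; the partial sums of \<open>z\<^sup>k \<phi>\<^sub>k\<close> are the Picard
  iterates.\<close>

primrec sol_coeff :: "nat \<Rightarrow> complex \<Rightarrow> complex" where
  "sol_coeff 0 = (\<lambda>_. 1)"
| "sol_coeff (Suc k) = ode_step (\<lambda>u. 2 / (1 - u)\<^sup>2 * sol_coeff k u)"

lemma holomorphic_sol_coeff: "sol_coeff k holomorphic_on u_domain"
proof (induction k)
  case (Suc k)
  have "(\<lambda>u. 2 / (1 - u)\<^sup>2 * sol_coeff k u) holomorphic_on u_domain"
    by (intro holomorphic_intros Suc) auto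
  then show ?case by (simp add: ode_step(1))
qed (simp add: holomorphic_on_const)

lemma holomorphic_sol_coeff_rhs: "(\<lambda>u. 2 / (1 - u)\<^sup>2 * sol_coeff k u) holomorphic_on u_domain"
  by (intro holomorphic_intros holomorphic_sol_coeff) auto

lemma norm_sol_coeff_le:
  assumes u: "u \<in> u_domain" and m: "\<And>r. 0 \<le> r \<Longrightarrow> r \<le> 1 \<Longrightarrow> norm (2 / (1 - of_real r * u)\<^sup>2) \<le> m"
    and "0 \<le> r" "r \<le> 1"
  shows "norm (sol_coeff k (of_real r * u)) \<le> (m * norm u) ^ k / fact k * r ^ k"
  using assms(3,4)
proof (induction k arbitrary: r)
  case (Suc k)
  have m0: "m \<ge> 0" using m[of 0] by (simp add: order_trans[OF norm_ge_zero])
  have "norm (sol_coeff (Suc k) (of_real r * u))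
      \<le> norm (of_real r * u) * (m * ((m * norm u) ^ k / fact k * r ^ k)) / real (k + 1)"
    unfolding sol_coeff.simps
  proof (rule ode_step(4)[OF holomorphic_sol_coeff_rhs scaleR_in_u_domain[OF u Suc.prems]])
    fix s :: real assume s: "0 \<le> s" "s \<le> 1"
    have sr: "0 \<le> s * r" "s * r \<le> 1" using s Suc.prems by (auto simp: mult_le_one)
    have "norm (2 / (1 - of_real (s * r) * u)\<^sup>2 * sol_coeff k (of_real (s * r) * u))
        \<le> m * ((m * norm u) ^ k / fact k * (s * r) ^ k)"
      unfolding norm_mult using m[OF sr] Suc.IH[OF sr] m0 by (intro mult_mono) auto
    then show "norm (2 / (1 - of_real s * (of_real r * u))\<^sup>2 * sol_coeff k (of_real s * (of_real r * u)))
        \<le> m * ((m * norm u) ^ k / fact k * r ^ k) * s ^ k"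
      by (simp add: power_mult_distrib mult_ac)
  qed
  also have "\<dots> = (m * norm u) ^ Suc k / fact (Suc k) * r ^ Suc k"
    using Suc.prems by (simp add: norm_mult field_simps)
  finally show ?case .
qed simp

lemma sol_coeff_bound_compact:
  assumes "compact K" "K \<subseteq> u_domain"
  obtains B where "B \<ge> 0" "\<And>u k. u \<in> K \<Longrightarrow> norm (sol_coeff k u) \<le> B ^ k / fact k"
proof -
  let ?f = "\<lambda>p :: real \<times> complex. 2 / (1 - of_real (fst p) * snd p)\<^sup>2"
  have "compact (?f ` ({0..1} \<times> K))"
  proof (intro compact_continuous_image compact_Times assms(1) compact_Icc)
    have "1 - of_real (fst p) * snd p \<noteq> 0" if p: "p \<in> {0..1} \<times> K" for p :: "real \<times> complex"
    proof
      assume "1 - of_real (fst p) * snd p = 0"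
      then have "of_real (fst p) * snd p = 1" by simp
      then show False using scaleR_in_u_domain[of "snd p" "fst p"] p assms(2) by auto
    qed
    then show "continuous_on ({0..1} \<times> K) ?f" by (intro continuous_intros) auto
  qed
  from compact_imp_bounded[OF this] obtain m where m': "\<forall>y\<in>?f ` ({0..1} \<times> K). norm y \<le> m"
    unfolding bounded_iff by blast
  have m: "norm (?f p) \<le> m" if "p \<in> {0..1} \<times> K" for p
    using m' that by blast
  obtain R where R: "\<And>u. u \<in> K \<Longrightarrow> norm u \<le> R"
    using compact_imp_bounded[OF assms(1)] unfolding bounded_iff by blast
  show ?thesis
  proof (rule that[of "\<bar>m\<bar> * \<bar>R\<bar>"])
    fix u k assume u: "u \<in> K"
    have m': "norm (2 / (1 - of_real r * u)\<^sup>2) \<le> \<bar>m\<bar>" if "0 \<le> r" "r \<le> 1" for r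
      using m[of "(r, u)"] that u by (simp add: order_trans[OF _ abs_ge_self])
    have "norm (sol_coeff k (of_real 1 * u)) \<le> (\<bar>m\<bar> * norm u) ^ k / fact k * 1 ^ k"
      by (rule norm_sol_coeff_le) (use u assms(2) m' in auto)
    also have "\<dots> \<le> (\<bar>m\<bar> * \<bar>R\<bar>) ^ k / fact k"
      using R[OF u] by (auto intro!: divide_right_mono power_mono mult_left_mono)
    finally show "norm (sol_coeff k u) \<le> (\<bar>m\<bar> * \<bar>R\<bar>) ^ k / fact k" by simp
  qed simp
qed

definition sol :: "complex \<Rightarrow> complex \<Rightarrow> complex" where
  "sol u z = (\<Sum>k. z ^ k * sol_coeff k u)"

lemma uniform_limit_sol:
  assumes "compact K" "K \<subseteq> u_domain"
  shows "uniform_limit K (\<lambda>n u. \<Sum>k<n. z ^ k * sol_coeff k u) (\<lambda>u. sol u z) sequentially"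
proof -
  obtain B where B: "B \<ge> 0" "\<And>u k. u \<in> K \<Longrightarrow> norm (sol_coeff k u) \<le> B ^ k / fact k"
    using sol_coeff_bound_compact[OF assms] by blast
  show ?thesis unfolding sol_def
  proof (rule Weierstrass_m_test)
    show "summable (\<lambda>k. (norm z * B) ^ k / fact k)"
      using summable_exp[of "norm z * B"] by (simp add: field_simps)
    fix k u assume "u \<in> K"
    then have "norm z ^ k * norm (sol_coeff k u) \<le> norm z ^ k * (B ^ k / fact k)"
      by (intro mult_left_mono B) auto
    then show "norm (z ^ k * sol_coeff k u) \<le> (norm z * B) ^ k / fact k"
      by (simp add: norm_mult norm_power power_mult_distrib)
  qed
qed

lemma holomorphic_sol: "(\<lambda>u. sol u z) holomorphic_on u_domain"
proof (rule holomorphic_uniform_sequence[OF open_u_domain])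
  show "(\<lambda>u. \<Sum>k<n. z ^ k * sol_coeff k u) holomorphic_on u_domain" for n
    by (intro holomorphic_intros holomorphic_sol_coeff)
  fix u assume "u \<in> u_domain"
  then obtain d where "d > 0" "cball u d \<subseteq> u_domain"
    using open_u_domain open_contains_cball by blast
  then show "\<exists>d>0. cball u d \<subseteq> u_domain \<and>
      uniform_limit (cball u d) (\<lambda>n u. \<Sum>k<n. z ^ k * sol_coeff k u) (\<lambda>u. sol u z) sequentially"
    by (intro exI[of _ d] conjI uniform_limit_sol compact_cball)
qed

lemma higher_deriv_partial_sum:
  assumes "u \<in> u_domain"
  shows "(deriv ^^ j) (\<lambda>u. \<Sum>k<n. z ^ k * sol_coeff k u) u = (\<Sum>k<n. z ^ k * (deriv ^^ j) (sol_coeff k) u)"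
proof (induction n)
  case (Suc n)
  have "(deriv ^^ j) (\<lambda>u. (\<Sum>k<n. z ^ k * sol_coeff k u) + z ^ n * sol_coeff n u) u
     = (deriv ^^ j) (\<lambda>u. \<Sum>k<n. z ^ k * sol_coeff k u) u + (deriv ^^ j) (\<lambda>u. z ^ n * sol_coeff n u) u"
    by (rule higher_deriv_add[OF _ _ open_u_domain assms]) (intro holomorphic_intros holomorphic_sol_coeff)+
  also have "(deriv ^^ j) (\<lambda>u. z ^ n * sol_coeff n u) u = z ^ n * (deriv ^^ j) (sol_coeff n) u"
    by (rule higher_deriv_cmult[OF holomorphic_sol_coeff assms open_u_domain])
  finally show ?case by (simp add: Suc)
qed simp

text \<open>The series converges locally uniformly, so all its derivatives in \<open>u\<close> may be taken term by term.\<close>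

lemma higher_deriv_sol_sums:
  assumes "u \<in> u_domain"
  shows "(\<lambda>k. z ^ k * (deriv ^^ j) (sol_coeff k) u) sums (deriv ^^ j) (\<lambda>u. sol u z) u"
proof -
  obtain d where d: "d > 0" "cball u d \<subseteq> u_domain"
    using assms open_u_domain open_contains_cball by blast
  have "((\<lambda>n. (deriv ^^ j) (\<lambda>u. \<Sum>k<n. z ^ k * sol_coeff k u) u) \<longlongrightarrow> (deriv ^^ j) (\<lambda>u. sol u z) u) sequentially"
  proof (rule higher_deriv_complex_uniform_limit)
    show "uniform_limit (ball u d) (\<lambda>n u. \<Sum>k<n. z ^ k * sol_coeff k u) (\<lambda>u. sol u z) sequentially"
      by (rule uniform_limit_on_subset[OF uniform_limit_sol[OF compact_cball d(2)] ball_subset_cball])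
    show "\<forall>\<^sub>F n in sequentially. (\<lambda>u. \<Sum>k<n. z ^ k * sol_coeff k u) holomorphic_on ball u d"
      using d ball_subset_cball[of u d]
      by (intro always_eventually allI holomorphic_intros holomorphic_on_subset[OF holomorphic_sol_coeff]) auto
  qed (use d in auto)
  then show ?thesis by (simp add: sums_def higher_deriv_partial_sum[OF assms])
qed

lemma sol_ode:
  assumes "u \<in> u_domain"
  shows "u * deriv (deriv (\<lambda>u. sol u z)) u + 2 * deriv (\<lambda>u. sol u z) u = 2 * z / (1 - u)\<^sup>2 * sol u z"
proof -
  have S: "(\<lambda>k. z ^ k * sol_coeff k u) sums sol u z"
    and S1: "(\<lambda>k. z ^ k * deriv (sol_coeff k) u) sums deriv (\<lambda>u. sol u z) u"
    and S2: "(\<lambda>k. z ^ k * deriv (deriv (sol_coeff k)) u) sums deriv (deriv (\<lambda>u. sol u z)) u"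
    using higher_deriv_sol_sums[OF assms, of z 0] higher_deriv_sol_sums[OF assms, of z 1]
      higher_deriv_sol_sums[OF assms, of z 2] by (simp_all add: numeral_2_eq_2)
  have "(\<lambda>k. u * (z ^ k * deriv (deriv (sol_coeff k)) u) + 2 * (z ^ k * deriv (sol_coeff k) u))
      sums (u * deriv (deriv (\<lambda>u. sol u z)) u + 2 * deriv (\<lambda>u. sol u z) u)"
    by (intro sums_add sums_mult S1 S2)
  then have L: "(\<lambda>k. z ^ k * (u * deriv (deriv (sol_coeff k)) u + 2 * deriv (sol_coeff k) u))
      sums (u * deriv (deriv (\<lambda>u. sol u z)) u + 2 * deriv (\<lambda>u. sol u z) u)"
    by (simp add: algebra_simps)
  have "(\<lambda>k. (2 * z / (1 - u)\<^sup>2) * (z ^ k * sol_coeff k u)) sums (2 * z / (1 - u)\<^sup>2 * sol u z)"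
    by (intro sums_mult S)
  moreover have "(2 * z / (1 - u)\<^sup>2) * (z ^ k * sol_coeff k u)
      = z ^ Suc k * (u * deriv (deriv (sol_coeff (Suc k))) u + 2 * deriv (sol_coeff (Suc k)) u)" for k
    unfolding sol_coeff.simps ode_step(3)[OF holomorphic_sol_coeff_rhs assms] by simp
  ultimately have "(\<lambda>k. z ^ Suc k * (u * deriv (deriv (sol_coeff (Suc k))) u + 2 * deriv (sol_coeff (Suc k)) u))
      sums (2 * z / (1 - u)\<^sup>2 * sol u z)" by simp
  from sums_Suc[OF this] have "(\<lambda>k. z ^ k * (u * deriv (deriv (sol_coeff k)) u + 2 * deriv (sol_coeff k) u))
      sums (2 * z / (1 - u)\<^sup>2 * sol u z)" by simp
  then show ?thesis using L sums_unique2 by blast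
qed

lemma sol_0: "sol 0 z = 1"
proof -
  have "sol_coeff (Suc k) 0 = 0" for k
    unfolding sol_coeff.simps by (rule ode_step(2)[OF holomorphic_sol_coeff_rhs])
  then have "z ^ k * sol_coeff k 0 = (if k = 0 then 1 else 0)" for k
    by (cases k) (simp_all del: sol_coeff.simps(2))
  then have "sol 0 z = (\<Sum>k. if k = 0 then 1 else 0)" by (simp add: sol_def)
  also have "\<dots> = (1 :: complex)" using suminf_finite[of "{0}" "\<lambda>k. if k = 0 then 1 else 0 :: complex"] by simp
  finally show ?thesis .
qed

lemma chain_ode_sol: "chain_ode z u_domain (\<lambda>u. sol u z)"
  unfolding chain_ode_def
proof (intro conjI ballI holomorphic_sol sol_0)
  show "deriv (\<lambda>u. sol u z) 0 = z" using sol_ode[of 0 z] by (simp add: sol_0)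
  fix u assume u: "u \<in> u_domain - {0}"
  then have ne: "u \<noteq> 0" "1 - u \<noteq> 0" "u - 1 \<noteq> 0" by auto
  have "u * (deriv (deriv (\<lambda>u. sol u z)) u + 2 / u * deriv (\<lambda>u. sol u z) u - 2 * z / (u * (u - 1)\<^sup>2) * sol u z)
      = u * deriv (deriv (\<lambda>u. sol u z)) u + 2 * deriv (\<lambda>u. sol u z) u - 2 * z / (1 - u)\<^sup>2 * sol u z"
    using ne by (simp add: algebra_simps power2_commute[of 1 u])
  also have "\<dots> = 0" using sol_ode[of u z] u by simp
  finally show "deriv (deriv (\<lambda>u. sol u z)) u + 2 / u * deriv (\<lambda>u. sol u z) u - 2 * z / (u * (u - 1)\<^sup>2) * sol u z = 0"
    using ne(1) by (metis mult_eq_0_iff)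
qed

section \<open>Taylor coefficients at the origin\<close>

text \<open>The equation multiplied by \<open>u (u - 1)\<^sup>2\<close> holds on a neighbourhood of the origin, hence also for the
  Taylor series, and there it is equivalent to the recurrence.\<close>

lemma chain_recurrence_of_chain_ode:
  assumes "open S" "0 \<in> S" "S \<subseteq> u_domain" "chain_ode z S f" "f has_fps_expansion H"
  shows "chain_recurrence z (fps_nth H)"
proof -
  have d: "deriv f has_fps_expansion fps_deriv H" "deriv (deriv f) has_fps_expansion fps_deriv (fps_deriv H)"
    using assms(5) by (auto intro: has_fps_expansion_deriv)
  define L where "L u = u * (u - 1)\<^sup>2 * deriv (deriv f) u + 2 * (u - 1)\<^sup>2 * deriv f u - 2 * z * f u" for u
  have "L has_fps_expansion fps_X * (fps_X - 1)\<^sup>2 * fps_deriv (fps_deriv H) + 2 * (fps_X - 1)\<^sup>2 * fps_deriv H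
       - 2 * fps_const z * H"
    unfolding L_def[abs_def]
    by (intro fps_expansion_intros has_fps_expansion_power d assms(5))
  moreover have "L u = 0" if u: "u \<in> S" for u
  proof (cases "u = 0")
    case True
    then show ?thesis using assms(4) by (simp add: L_def chain_ode_def)
  next
    case False
    have "u \<noteq> 1" using u assms(3) by auto
    with False have "L u = u * (u - 1)\<^sup>2 * (deriv (deriv f) u + 2 / u * deriv f u - 2 * z / (u * (u - 1)\<^sup>2) * f u)"
      by (simp add: L_def algebra_simps)
    also have "\<dots> = 0" using assms(4) u False by (simp add: chain_ode_def)
    finally show ?thesis .
  qed
  then have "L has_fps_expansion 0"
    using assms(1,2) unfolding has_fps_expansion_0_iff by (auto simp: eventually_nhds)
  ultimately have "fps_X * (fps_X - 1)\<^sup>2 * fps_deriv (fps_deriv H) + 2 * (fps_X - 1)\<^sup>2 * fps_deriv H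
       - 2 * fps_const z * H = 0"
    by (rule fps_expansion_unique_complex)
  then show ?thesis by (simp only: chain_recurrence_iff_fps_ode)
qed

definition sol_fps :: "complex \<Rightarrow> complex fps" where
  "sol_fps z = fps_expansion (\<lambda>u. sol u z) 0"

lemma sol_has_fps_expansion: "(\<lambda>u. sol u z) has_fps_expansion sol_fps z"
  unfolding sol_fps_def
  by (rule has_fps_expansion_fps_expansion[OF open_u_domain zero_in_u_domain holomorphic_sol])

lemma chain_recurrence_complex_unique:
  fixes a b :: "nat \<Rightarrow> complex"
  shows "chain_recurrence z a \<Longrightarrow> chain_recurrence z b \<Longrightarrow> a 0 = b 0 \<Longrightarrow> a n = b n"
  by (rule chain_recurrence_unique) (simp_all del: of_nat_Suc)

lemma chain_recurrence_sol_fps: "chain_recurrence z (fps_nth (sol_fps z))"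
  by (rule chain_recurrence_of_chain_ode[OF open_u_domain zero_in_u_domain order_refl
        chain_ode_sol sol_has_fps_expansion])

lemma fps_nth_has_fps_expansion_0: "f has_fps_expansion H \<Longrightarrow> fps_nth H 0 = f 0"
  by (drule has_fps_expansion_imp_0_eq_fps_nth_0) simp

text \<open>The recurrence fixes the Taylor series at the origin, and the identity theorem does the rest.\<close>

lemma chain_ode_unique:
  assumes "open S" "connected S" "0 \<in> S" "S \<subseteq> u_domain" "chain_ode z S f" "u \<in> S"
  shows "f u = sol u z"
proof -
  have hol: "f holomorphic_on S" and f0: "f 0 = 1" using assms(5) by (auto simp: chain_ode_def)
  define H where "H = fps_expansion f 0"
  have H: "f has_fps_expansion H"
    unfolding H_def by (rule has_fps_expansion_fps_expansion[OF assms(1,3) hol])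
  have "H = sol_fps z"
  proof (rule fps_ext)
    fix n
    show "fps_nth H n = fps_nth (sol_fps z) n"
      using chain_recurrence_of_chain_ode[OF assms(1,3,4,5) H] chain_recurrence_sol_fps
      by (rule chain_recurrence_complex_unique)
        (simp add: fps_nth_has_fps_expansion_0[OF H] fps_nth_has_fps_expansion_0[OF sol_has_fps_expansion] f0 sol_0)
  qed
  then have "(\<lambda>u. f u - sol u z) has_fps_expansion H - H"
    using H sol_has_fps_expansion[of z] by (intro fps_expansion_intros) auto
  then have "(\<lambda>u. f u - sol u z) has_fps_expansion 0" by simp
  then have "f u - sol u z = 0"
    by (rule has_fps_expansion_0_analytic_continuation[OF _ _ assms(1,2,3,6)])
      (intro holomorphic_intros hol holomorphic_on_subset[OF holomorphic_sol assms(4)])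
  then show ?thesis by simp
qed

lemma sums_fps_unit_disc:
  assumes "f has_fps_expansion H" "f holomorphic_on u_domain" "norm u < 1"
  shows "(\<lambda>n. fps_nth H n * u ^ n) sums f u"
proof (rule has_fps_expansion_imp_sums_complex[OF assms(1)])
  have "eball (0 :: complex) 1 = ball 0 1" by (auto simp: eball_def one_ereal_def)
  then show "f holomorphic_on eball 0 1"
    using holomorphic_on_subset[OF assms(2) ball_subset_u_domain] by simp
qed (use assms(3) in \<open>simp add: one_ereal_def\<close>)

section \<open>The hypergeometric representation\<close>

lemma gauss_recurrence_imp_coeff:
  fixes c :: "nat \<Rightarrow> complex"
  assumes "c 0 = 1" "\<And>n. of_nat ((n + 1) * (n + 2)) * c (Suc n) = (of_nat n + a) * (of_nat n + b) * c n"
  shows "c n = pochhammer a n * pochhammer b n / pochhammer 2 n / fact n"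
proof (induction n)
  case (Suc n)
  have p2: "pochhammer (2 :: complex) m = fact (Suc m)" for m
    by (induction m) (simp_all add: pochhammer_rec' algebra_simps)
  have ne: "of_nat ((n + 1) * (n + 2)) \<noteq> (0 :: complex)"
    by (simp only: of_nat_eq_0_iff) simp
  have "of_nat ((n + 1) * (n + 2)) * c (Suc n)
      = (of_nat n + a) * (of_nat n + b) * (pochhammer a n * pochhammer b n / (fact (Suc n) * fact n))"
    unfolding assms(2) Suc p2 by simp
  also have "\<dots> = of_nat ((n + 1) * (n + 2)) * (pochhammer a (Suc n) * pochhammer b (Suc n) / (fact (Suc (Suc n)) * fact (Suc n)))"
  proof -
    define F where "F = (fact n :: complex)"
    have F: "F \<noteq> 0" by (simp add: F_def)
    define N where "N = (of_nat n :: complex)"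
    have f1: "fact (Suc n) = (N + 1) * F" and f2: "fact (Suc (Suc n)) = (N + 2) * ((N + 1) * F)"
      by (simp_all add: F_def N_def algebra_simps)
    have e: "of_nat ((n + 1) * (n + 2)) = (N + 1) * (N + 2)" by (simp add: N_def algebra_simps)
    have nz: "N + 1 \<noteq> 0" "N + 2 \<noteq> 0"
      using ne unfolding e by auto
    show ?thesis
      unfolding f1 f2 F_def[symmetric] e pochhammer_rec' N_def[symmetric]
      using nz F by (simp add: divide_simps) (simp add: algebra_simps)
  qed
  finally have "c (Suc n) = pochhammer a (Suc n) * pochhammer b (Suc n) / (fact (Suc (Suc n)) * fact (Suc n))"
    using mult_left_cancel[OF ne] by blast
  then show ?case by (simp only: p2 divide_divide_eq_left)
qed (simp add: assms)

text \<open>The hypothesis on \<open>B\<close> says that \<open>B\<close> is a multiple of \<open>(1 - u)\<^sup>\<alpha>\<close>. Multiplied by \<open>1 - u\<close>, the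
  hypergeometric expression in \<open>A B\<close> contains \<open>B'\<close>, \<open>B''\<close> and \<open>A''\<close> only in combinations that the
  hypotheses allow to eliminate. What remains is a multiple of \<open>A'\<close> that vanishes identically and a
  multiple of \<open>A\<close> that vanishes because \<open>\<alpha> (\<alpha> + 1) = 2 z\<close>.\<close>

lemma fps_gauss_ode:
  fixes A B :: "complex fps"
  assumes A: "fps_X * (fps_X - 1)\<^sup>2 * fps_deriv (fps_deriv A) + 2 * (fps_X - 1)\<^sup>2 * fps_deriv A
       - 2 * fps_const z * A = 0"
    and B: "(1 - fps_X) * fps_deriv B = - (fps_const \<alpha> * B)" and \<alpha>: "\<alpha> * (\<alpha> + 1) = 2 * z"
  defines "h \<equiv> A * B"
  shows "fps_X * (1 - fps_X) * fps_deriv (fps_deriv h) + (2 - fps_const (2 - 2 * \<alpha>) * fps_X) * fps_deriv h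
     - fps_const ((1 - \<alpha>) * (- \<alpha>)) * h = 0" (is "?G = 0")
proof -
  define X where "X = (fps_X :: complex fps)"
  define a where "a = fps_const \<alpha>"
  define A1 where "A1 = fps_deriv A"
  define A2 where "A2 = fps_deriv (fps_deriv A)"
  define B1 where "B1 = fps_deriv B"
  define B2 where "B2 = fps_deriv (fps_deriv B)"
  have zc: "2 * fps_const z = a * (a + 1)"
  proof -
    have "2 * fps_const z = fps_const (2 * z)" by (simp add: numeral_fps_const)
    also have "\<dots> = fps_const (\<alpha> * (\<alpha> + 1))" unfolding \<alpha> ..
    also have "\<dots> = a * (a + 1)"
      unfolding a_def fps_const_1_eq_1[symmetric] by (simp only: fps_const_add fps_const_mult)
    finally show ?thesis .
  qed
  have eA: "X * (X - 1)\<^sup>2 * A2 + 2 * (X - 1)\<^sup>2 * A1 - a * (a + 1) * A = 0"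
    using A unfolding zc A1_def A2_def X_def .
  have eB: "(1 - X) * B1 = - (a * B)" using B unfolding X_def a_def B1_def .
  have "fps_deriv ((1 - X) * B1) = fps_deriv (- (a * B))" unfolding eB ..
  then have eB2: "(1 - X) * B2 = B1 - a * B1"
    by (simp add: X_def a_def B1_def B2_def algebra_simps)
  have h1: "fps_deriv h = A1 * B + A * B1" by (simp add: h_def A1_def B1_def algebra_simps)
  have h2: "fps_deriv (fps_deriv h) = A2 * B + 2 * A1 * B1 + A * B2"
    by (simp add: h_def A1_def B1_def A2_def B2_def algebra_simps)
  have c1: "fps_const (2 - 2 * \<alpha>) = 2 - 2 * a" and c2: "fps_const ((1 - \<alpha>) * (- \<alpha>)) = (1 - a) * (- a)"
    by (simp_all add: a_def numeral_fps_const flip: fps_const_sub fps_const_mult fps_const_neg)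
  have G: "?G = X * (1 - X) * (A2 * B + 2 * A1 * B1 + A * B2) + (2 - (2 - 2 * a) * X) * (A1 * B + A * B1)
      - (1 - a) * (- a) * (A * B)"
    unfolding h2 unfolding h1 c1 c2 X_def[symmetric] by (simp add: h_def)
  have "(1 - X) * ?G = B * (X * (X - 1)\<^sup>2 * A2) + 2 * X * (1 - X) * A1 * ((1 - X) * B1) + X * A * (1 - X) * ((1 - X) * B2)
      + (1 - X) * (2 - (2 - 2 * a) * X) * A1 * B + (2 - (2 - 2 * a) * X) * A * ((1 - X) * B1)
      - (1 - X) * ((1 - a) * (- a) * (A * B))"
    unfolding G by (simp add: power2_eq_square algebra_simps)
  also have "X * A * (1 - X) * ((1 - X) * B2) = X * A * (1 - a) * ((1 - X) * B1)"
    unfolding eB2 by (simp add: algebra_simps)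
  also have "X * (X - 1)\<^sup>2 * A2 = a * (a + 1) * A - 2 * (X - 1)\<^sup>2 * A1"
    using eA by (simp add: algebra_simps)
  finally have "(1 - X) * ?G = 0"
    unfolding eB by (simp add: power2_eq_square algebra_simps)
  moreover have "1 - X \<noteq> 0"
  proof
    assume "1 - X = 0"
    then have "fps_nth (1 - X) 0 = 0" by simp
    then show False by (simp add: X_def)
  qed
  ultimately show ?thesis by (metis mult_eq_0_iff)
qed

lemma fps_gauss_ode_coeff:
  fixes h :: "complex fps"
  assumes "fps_X * (1 - fps_X) * fps_deriv (fps_deriv h) + (2 - fps_const (a + b + 1) * fps_X) * fps_deriv h
     - fps_const (a * b) * h = 0"
  shows "of_nat ((n + 1) * (n + 2)) * fps_nth h (Suc n) = (of_nat n + a) * (of_nat n + b) * fps_nth h n"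
proof -
  define D1 where "D1 = fps_deriv h"
  define D2 where "D2 = fps_deriv (fps_deriv h)"
  have "fps_X ^ 1 * D2 - fps_X ^ 2 * D2 + fps_const 2 * D1 - fps_const (a + b + 1) * (fps_X ^ 1 * D1) - fps_const (a * b) * h = 0"
    using assms unfolding D2_def[symmetric] unfolding D1_def[symmetric]
    by (simp add: power2_eq_square algebra_simps numeral_fps_const)
  then have "fps_nth (fps_X ^ 1 * D2 - fps_X ^ 2 * D2 + fps_const 2 * D1 - fps_const (a + b + 1) * (fps_X ^ 1 * D1)
      - fps_const (a * b) * h) n = 0" by simp
  then have nth: "(if n < 1 then 0 else D2 $ (n - 1)) - (if n < 2 then 0 else D2 $ (n - 2)) + 2 * D1 $ n
      - (a + b + 1) * (if n < 1 then 0 else D1 $ (n - 1)) - a * b * h $ n = 0"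
    by (simp only: fps_add_nth fps_sub_nth fps_mult_left_const_nth fps_X_power_mult_nth)
  have D1: "D1 $ n = of_nat (n + 1) * h $ (n + 1)" for n by (simp add: D1_def)
  have D2: "D2 $ n = of_nat (n + 1) * (of_nat (n + 2) * h $ (n + 2))" for n by (simp add: D2_def)
  consider "n = 0" | "n = 1" | m where "n = Suc (Suc m)" by (metis One_nat_def not0_implies_Suc)
  then show ?thesis
  proof cases
    case 1
    then show ?thesis using nth unfolding D1 D2 1 by (simp add: algebra_simps numeral_eq_Suc)
  next
    case 2
    then show ?thesis using nth unfolding D1 D2 2 by (simp add: algebra_simps numeral_eq_Suc)
  next
    case 3
    then show ?thesis using nth unfolding D1 D2 3 by (simp add: algebra_simps numeral_eq_Suc)
  qed
qed

text \<open>The product is holomorphic on the whole slit plane and its Taylor series at the origin is the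
  hypergeometric one, so it is the analytic continuation of the hypergeometric function.\<close>

lemma is_hypergeo_sol:
  assumes \<alpha>: "\<alpha> * (\<alpha> + 1) = 2 * z"
  shows "is_hypergeo_2F1 (1 - \<alpha>) (- \<alpha>) 2 (\<lambda>u. sol u z * (1 - u) powr \<alpha>)"
proof -
  define p where "p u = (1 - u) powr \<alpha>" for u :: complex
  have p_deriv: "(p has_field_derivative - \<alpha> * p u / (1 - u)) (at u)" if "u \<in> u_domain" for u
  proof -
    have "1 - u \<notin> \<real>\<^sub>\<le>\<^sub>0" "1 - u \<noteq> 0" using that u_domain_iff by auto
    then show ?thesis unfolding p_def[abs_def]
      by (auto intro!: derivative_eq_intros simp: powr_diff field_simps)
  qed
  then have p_hol: "p holomorphic_on u_domain"
    unfolding holomorphic_on_open[OF open_u_domain] by blast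
  define B where "B = fps_expansion p 0"
  have B: "p has_fps_expansion B"
    unfolding B_def by (rule has_fps_expansion_fps_expansion[OF open_u_domain zero_in_u_domain p_hol])
  have "(\<lambda>u. (1 - u) * deriv p u - - (\<alpha> * p u)) has_fps_expansion (1 - fps_X) * fps_deriv B - - (fps_const \<alpha> * B)"
    by (intro fps_expansion_intros has_fps_expansion_deriv B)
  moreover have "(\<lambda>u. (1 - u) * deriv p u - - (\<alpha> * p u)) has_fps_expansion 0"
  proof -
    have "(1 - u) * deriv p u - - (\<alpha> * p u) = 0" if "u \<in> u_domain" for u
    proof -
      have "1 - u \<noteq> 0" using that by auto
      then show ?thesis using DERIV_imp_deriv[OF p_deriv[OF that]] by simp
    qed
    then show ?thesis
      unfolding has_fps_expansion_0_iff
      by (intro eventually_mono[OF eventually_nhds_in_open[OF open_u_domain zero_in_u_domain]])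
  qed
  ultimately have "(1 - fps_X) * fps_deriv B - - (fps_const \<alpha> * B) = 0"
    by (rule fps_expansion_unique_complex)
  then have B_ode: "(1 - fps_X) * fps_deriv B = - (fps_const \<alpha> * B)"
    by (rule eq_iff_diff_eq_0[THEN iffD2])
  define h where "h = sol_fps z * B"
  have h: "(\<lambda>u. sol u z * p u) has_fps_expansion h"
    unfolding h_def by (intro fps_expansion_intros sol_has_fps_expansion B)
  have hol: "(\<lambda>u. sol u z * p u) holomorphic_on u_domain"
    by (intro holomorphic_intros holomorphic_sol p_hol)
  have ode: "fps_X * (fps_X - 1)\<^sup>2 * fps_deriv (fps_deriv (sol_fps z)) + 2 * (fps_X - 1)\<^sup>2 * fps_deriv (sol_fps z)
       - 2 * fps_const z * sol_fps z = 0"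
    using chain_recurrence_sol_fps unfolding chain_recurrence_iff_fps_ode .
  have "fps_X * (1 - fps_X) * fps_deriv (fps_deriv h)
      + (2 - fps_const ((1 - \<alpha>) + (- \<alpha>) + 1) * fps_X) * fps_deriv h - fps_const ((1 - \<alpha>) * (- \<alpha>)) * h = 0"
    using fps_gauss_ode[OF ode B_ode \<alpha>] by (simp add: h_def algebra_simps)
  note rec = fps_gauss_ode_coeff[OF this]
  have "fps_nth h 0 = 1"
    using fps_nth_has_fps_expansion_0[OF h] by (simp add: sol_0 p_def)
  note coeff = gauss_recurrence_imp_coeff[of "fps_nth h", OF this rec]
  show ?thesis
    unfolding is_hypergeo_2F1_def p_def[symmetric]
  proof (intro conjI allI impI hol)
    fix u :: complex assume "norm u < 1"
    from sums_fps_unit_disc[OF h hol this] have "(\<lambda>n. fps_nth h n * u ^ n) sums (sol u z * p u)" .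
    then show "sol u z * p u = (\<Sum>n. pochhammer (1 - \<alpha>) n * pochhammer (- \<alpha>) n / pochhammer 2 n * (u ^ n / fact n))"
      unfolding coeff by (simp add: sums_iff field_simps)
  qed
qed

lemma chain_fun_eq_sol:
  assumes "u \<in> u_domain"
  shows "chain_fun u z = sol u z"
proof -
  define \<alpha> where "\<alpha> = (csqrt (8 * z + 1) - 1) / 2"
  have "csqrt (8 * z + 1) = 2 * \<alpha> + 1" by (simp add: \<alpha>_def field_simps)
  then have "(2 * \<alpha> + 1)\<^sup>2 = 8 * z + 1" by (metis power2_csqrt)
  then have "4 * (\<alpha> * (\<alpha> + 1)) = 4 * (2 * z)" by (simp add: power2_eq_square algebra_simps)
  then have \<alpha>: "\<alpha> * (\<alpha> + 1) = 2 * z" by (simp only: mult_cancel_left) simp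
  note H = is_hypergeo_sol[OF \<alpha>]
  have "is_hypergeo_2F1 (1 - \<alpha>) (- \<alpha>) 2 (hypergeo_2F1 (1 - \<alpha>) (- \<alpha>) 2)"
    unfolding hypergeo_2F1_def
    by (rule someI_ex[where P = "is_hypergeo_2F1 (1 - \<alpha>) (- \<alpha>) 2"]) (rule exI, rule H)
  from is_hypergeo_2F1_unique[OF this H assms]
  have "chain_fun u z = sol u z * (1 - u) powr \<alpha> / (1 - u) powr \<alpha>"
    by (simp add: chain_fun_def \<alpha>_def)
  moreover have "1 - u \<noteq> 0" using assms by auto
  ultimately show ?thesis by simp
qed


section \<open>Joint analyticity\<close>

lemma norm_higher_deriv_sol_coeff_le:
  assumes "cball u0 \<rho> \<subseteq> u_domain" "\<rho> > 0"
    and B: "\<And>u k. u \<in> cball u0 \<rho> \<Longrightarrow> norm (sol_coeff k u) \<le> B ^ k / fact k"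
  shows "norm ((deriv ^^ j) (sol_coeff k) u0) \<le> fact j * (B ^ k / fact k) / \<rho> ^ j"
proof (rule Cauchy_inequality[OF _ _ assms(2)])
  show "sol_coeff k holomorphic_on ball u0 \<rho>"
    by (rule holomorphic_on_subset[OF holomorphic_sol_coeff]) (use assms(1) ball_subset_cball[of u0 \<rho>] in blast)
  show "continuous_on (cball u0 \<rho>) (sol_coeff k)"
    by (rule continuous_on_subset[OF holomorphic_on_imp_continuous_on[OF holomorphic_sol_coeff] assms(1)])
  show "norm (sol_coeff k u) \<le> B ^ k / fact k" if "norm (u0 - u) = \<rho>" for u
    by (rule B) (use that in \<open>simp add: dist_norm\<close>)
qed

lemma sums_exp_real: "(\<lambda>k. x ^ k / fact k) sums exp (x :: real)"
  using exp_converges[of x] by (simp add: divide_inverse mult.commute)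

text \<open>The function is expanded in \<open>u\<close> first. Its Taylor coefficients \<open>A j z\<close> at \<open>u0\<close> are entire in \<open>z\<close>, and
  Cauchy's inequalities applied to the functions \<open>\<phi>\<^sub>k\<close> bound them by \<open>C / \<rho>\<^sup>j\<close> near \<open>z0\<close>. Applying the
  inequalities again to \<open>A j\<close> bounds the coefficients of the double series by \<open>C / \<rho>\<^bsup>j+l\<^esup>\<close>, so it
  converges absolutely within half the radius and may be summed in either way.\<close>

lemma jointly_analytic_sol_at:
  assumes "u0 \<in> u_domain"
  obtains r a where "r > 0" "ball u0 r \<subseteq> u_domain"
    "\<And>u z. u \<in> ball u0 r \<Longrightarrow> z \<in> ball z0 r \<Longrightarrow>
      ((\<lambda>(j, k). a j k * (u - u0) ^ j * (z - z0) ^ k) has_sum sol u z) (UNIV :: (nat \<times> nat) set)"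
proof -
  obtain \<rho> where \<rho>: "\<rho> > 0" "cball u0 \<rho> \<subseteq> u_domain"
    using assms open_u_domain open_contains_cball by blast
  then have ball_sub: "ball u0 \<rho> \<subseteq> u_domain" using ball_subset_cball by blast
  obtain B where B: "B \<ge> 0" "\<And>u k. u \<in> cball u0 \<rho> \<Longrightarrow> norm (sol_coeff k u) \<le> B ^ k / fact k"
    using sol_coeff_bound_compact[OF compact_cball \<rho>(2)] by blast
  define A where "A j z = (deriv ^^ j) (\<lambda>u. sol u z) u0 / fact j" for j z
  define C where "C = exp ((norm z0 + \<rho>) * B)"
  have A_sums: "(\<lambda>k. ((deriv ^^ j) (sol_coeff k) u0 / fact j) * z ^ k) sums A j z" for j z
    using sums_divide[OF higher_deriv_sol_sums[OF assms, of z j], of "fact j"]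
    by (simp add: A_def mult_ac)
  have A_hol: "A j holomorphic_on UNIV" for j
  proof -
    have "A j field_differentiable at z" for z
    proof -
      have "((\<lambda>z. \<Sum>k. ((deriv ^^ j) (sol_coeff k) u0 / fact j) * z ^ k) has_field_derivative
          (\<Sum>k. diffs (\<lambda>k. (deriv ^^ j) (sol_coeff k) u0 / fact j) k * z ^ k)) (at z)"
      proof (rule termdiffs_strong)
        show "summable (\<lambda>k. ((deriv ^^ j) (sol_coeff k) u0 / fact j) * complex_of_real (norm z + 1) ^ k)"
          by (rule sums_summable[OF A_sums])
        show "norm z < norm (complex_of_real (norm z + 1))" by (subst norm_of_real) simp
      qed
      moreover have "(\<lambda>z. \<Sum>k. ((deriv ^^ j) (sol_coeff k) u0 / fact j) * z ^ k) = A j"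
        using A_sums by (auto simp: sums_iff fun_eq_iff)
      ultimately show ?thesis by (auto simp: field_differentiable_def)
    qed
    then show ?thesis by (simp add: holomorphic_on_def field_differentiable_at_within)
  qed
  have A_bound: "norm (A j z) \<le> C / \<rho> ^ j" if z: "norm (z0 - z) \<le> \<rho>" for j z
  proof -
    have zn: "norm z \<le> norm z0 + \<rho>" using z norm_triangle_ineq4[of z0 "z0 - z"] by simp
    have bnd: "norm (((deriv ^^ j) (sol_coeff k) u0 / fact j) * z ^ k) \<le> ((norm z0 + \<rho>) * B) ^ k / fact k / \<rho> ^ j" for k
    proof -
      have "norm (((deriv ^^ j) (sol_coeff k) u0 / fact j) * z ^ k)
          = norm ((deriv ^^ j) (sol_coeff k) u0) / fact j * norm z ^ k"
        by (simp add: norm_mult norm_divide norm_power)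
      also have "\<dots> \<le> (fact j * (B ^ k / fact k) / \<rho> ^ j) / fact j * (norm z0 + \<rho>) ^ k"
        using norm_higher_deriv_sol_coeff_le[OF \<rho>(2,1) B(2), of j k] zn B(1) \<rho>(1)
        by (intro mult_mono divide_right_mono power_mono) auto
      also have "\<dots> = ((norm z0 + \<rho>) * B) ^ k / fact k / \<rho> ^ j"
      proof -
        have "(fact j * (b / c) / d) / fact j * e = e * b / c / d" for b c d e :: real
          by simp
        then show ?thesis unfolding power_mult_distrib .
      qed
      finally show ?thesis .
    qed
    have dom: "(\<lambda>k. ((norm z0 + \<rho>) * B) ^ k / fact k / \<rho> ^ j) sums (C / \<rho> ^ j)"
      unfolding C_def by (intro sums_divide sums_exp_real)
    have "norm (\<Sum>k. ((deriv ^^ j) (sol_coeff k) u0 / fact j) * z ^ k)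
        \<le> (\<Sum>k. ((norm z0 + \<rho>) * B) ^ k / fact k / \<rho> ^ j)"
      by (rule norm_suminf_le[OF bnd]) (use dom in \<open>simp add: sums_iff\<close>)
    then show ?thesis using A_sums[of j z] dom by (simp add: sums_iff)
  qed
  define a where "a j l = (deriv ^^ l) (A j) z0 / fact l" for j l
  have a_bound: "norm (a j l) \<le> C / \<rho> ^ j / \<rho> ^ l" for j l
  proof -
    have "norm ((deriv ^^ l) (A j) z0) \<le> fact l * (C / \<rho> ^ j) / \<rho> ^ l"
      by (rule Cauchy_inequality[OF holomorphic_on_subset[OF A_hol]
          continuous_on_subset[OF holomorphic_on_imp_continuous_on[OF A_hol]] \<rho>(1)])
        (rule subset_UNIV | (rule A_bound, simp))+
    then show ?thesis by (simp add: a_def norm_divide field_simps)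
  qed
  define r where "r = \<rho> / 2"
  have r: "r > 0" "r < \<rho>" using \<rho>(1) by (auto simp: r_def)
  show ?thesis
  proof (rule that[OF r(1)])
    show "ball u0 r \<subseteq> u_domain" using ball_sub r subset_ball[of r \<rho> u0] by (meson less_imp_le order_trans)
    fix u z assume u: "u \<in> ball u0 r" and z: "z \<in> ball z0 r"
    let ?t = "\<lambda>(j, l). a j l * (u - u0) ^ j * (z - z0) ^ l"
    have half: "norm (?t (j, l)) \<le> C * (1 / 2) ^ j * (1 / 2) ^ l" for j l
    proof -
      have "norm (?t (j, l)) = norm (a j l) * norm (u - u0) ^ j * norm (z - z0) ^ l"
        by (simp add: norm_mult norm_power)
      also have "\<dots> \<le> (C / \<rho> ^ j / \<rho> ^ l) * r ^ j * r ^ l"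
        using a_bound[of j l] u z r \<rho>(1)
        by (intro mult_mono power_mono) (auto simp: dist_norm norm_minus_commute C_def)
      also have "\<dots> = C * (r / \<rho>) ^ j * (r / \<rho>) ^ l" by (simp add: power_divide)
      also have "r / \<rho> = 1 / 2" using \<rho>(1) by (simp add: r_def)
      finally show ?thesis .
    qed
    have geom: "((\<lambda>l. (1 / 2 :: real) ^ l) has_sum 2) UNIV"
      by (rule norm_summable_imp_has_sum) (use geometric_sums[of "1/2 :: real"] in \<open>auto simp: summable_geometric\<close>)
    have "(\<lambda>(j, l). C * (1 / 2) ^ j * (1 / 2) ^ l) summable_on Sigma (UNIV :: nat set) (\<lambda>_. UNIV :: nat set)"
    proof (rule summable_on_SigmaI)
      show "((\<lambda>l. case (j, l) of (j, l) \<Rightarrow> C * (1 / 2) ^ j * (1 / 2) ^ l) has_sum C * (1 / 2) ^ j * 2) UNIV" for j :: nat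
        using has_sum_cmult_right[OF geom] by simp
      show "(\<lambda>j. C * (1 / 2) ^ j * 2) summable_on (UNIV :: nat set)"
        using has_sum_cmult_right[OF has_sum_cmult_left[OF geom, of 2], of C] by (auto simp: mult_ac summable_on_def)
    qed (auto simp: C_def)
    then have "(\<lambda>p. norm (?t p)) summable_on Sigma UNIV (\<lambda>_. UNIV)"
      by (rule Infinite_Sum.abs_summable_on_comparison_test') (use half in auto)
    then have summable: "?t summable_on Sigma UNIV (\<lambda>_. UNIV)"
      by (rule abs_summable_summable)
    have inner: "((\<lambda>l. ?t (j, l)) has_sum A j z * (u - u0) ^ j) UNIV" for j
    proof -
      have "(\<lambda>l. a j l * (z - z0) ^ l) sums A j z"
        unfolding a_def by (rule holomorphic_power_series[OF holomorphic_on_subset[OF A_hol] z]) simp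
      from sums_mult[OF this, of "(u - u0) ^ j"]
      have s: "(\<lambda>l. ?t (j, l)) sums (A j z * (u - u0) ^ j)" by (simp add: mult_ac)
      have "summable (\<lambda>l. norm (?t (j, l)))"
        by (rule summable_comparison_test'[of "\<lambda>l. C * (1 / 2) ^ j * (1 / 2) ^ l"])
          (use half in \<open>auto intro: summable_mult simp: summable_geometric\<close>)
      then show ?thesis using s by (rule norm_summable_imp_has_sum)
    qed
    have outer: "((\<lambda>j. A j z * (u - u0) ^ j) has_sum sol u z) UNIV"
    proof (rule norm_summable_imp_has_sum)
      have ur: "u \<in> ball u0 \<rho>" using u r by auto
      show "(\<lambda>j. A j z * (u - u0) ^ j) sums sol u z"
        unfolding A_def
        by (rule holomorphic_power_series[OF holomorphic_on_subset[OF holomorphic_sol ball_sub] ur])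
      have bnd: "norm (A j z * (u - u0) ^ j) \<le> C * (1 / 2) ^ j" for j
      proof -
        have "norm (A j z * (u - u0) ^ j) \<le> C / \<rho> ^ j * r ^ j"
          unfolding norm_mult norm_power using A_bound[of z j] u z r \<rho>(1)
          by (intro mult_mono power_mono) (auto simp: dist_norm norm_minus_commute C_def)
        also have "\<dots> = C * (r / \<rho>) ^ j" by (simp add: power_divide)
        also have "r / \<rho> = 1 / 2" using \<rho>(1) by (simp add: r_def)
        finally show ?thesis .
      qed
      show "summable (\<lambda>j. norm (A j z * (u - u0) ^ j))"
      proof (rule summable_comparison_test'[where N = 0])
        show "summable (\<lambda>j. C * (1 / 2) ^ j)" by (intro summable_mult summable_geometric) simp
        show "norm (norm (A j z * (u - u0) ^ j)) \<le> C * (1 / 2) ^ j" for j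
          unfolding real_norm_def abs_norm_cancel by (rule bnd)
      qed
    qed
    from has_sum_SigmaI[OF inner outer summable]
    show "(?t has_sum sol u z) (UNIV :: (nat \<times> nat) set)" by (simp only: UNIV_Times_UNIV)
  qed
qed

lemma jointly_analytic_chain_fun: "jointly_analytic_on chain_fun (u_domain \<times> z_domain)"
  unfolding jointly_analytic_on_def
proof clarify
  fix u0 z0 assume u0: "u0 \<in> u_domain"
  show "\<exists>r>0. \<exists>a. \<forall>u\<in>ball u0 r. \<forall>z\<in>ball z0 r.
      ((\<lambda>(j, k). a j k * (u - u0) ^ j * (z - z0) ^ k) has_sum chain_fun u z) (UNIV :: (nat \<times> nat) set)"
  proof (rule jointly_analytic_sol_at[OF u0])
    fix r a
    assume "r > 0" and sub: "ball u0 r \<subseteq> u_domain"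
      and sum: "\<And>u z. u \<in> ball u0 r \<Longrightarrow> z \<in> ball z0 r \<Longrightarrow>
        ((\<lambda>(j, k). a j k * (u - u0) ^ j * (z - z0) ^ k) has_sum sol u z) (UNIV :: (nat \<times> nat) set)"
    show ?thesis
    proof (intro exI[of _ r] conjI \<open>r > 0\<close> exI[of _ a] ballI)
      fix u z assume u: "u \<in> ball u0 r" and z: "z \<in> ball z0 r"
      have eq: "chain_fun u z = sol u z" by (rule chain_fun_eq_sol) (use u sub in blast)
      show "((\<lambda>(j, k). a j k * (u - u0) ^ j * (z - z0) ^ k) has_sum chain_fun u z) (UNIV :: (nat \<times> nat) set)"
        unfolding eq by (rule sum[OF u z])
    qed
  qed
qed

section \<open>The generating function\<close>

lemma chain_ode_cong:
  assumes "open S" "\<And>u. u \<in> S \<Longrightarrow> f u = g u" "0 \<in> S" "chain_ode z S g"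
  shows "chain_ode z S f"
proof -
  have ev: "eventually (\<lambda>v. v \<in> S) (nhds u)" if "u \<in> S" for u
    using that assms(1) by (rule eventually_nhds_in_open[rotated])
  have d1: "deriv f u = deriv g u" if "u \<in> S" for u
    by (rule deriv_cong_ev[OF eventually_mono[OF ev[OF that]] refl]) (rule assms(2))
  have d2: "deriv (deriv f) u = deriv (deriv g) u" if "u \<in> S" for u
    by (rule deriv_cong_ev[OF eventually_mono[OF ev[OF that]] refl]) (rule d1)
  have "f holomorphic_on S \<longleftrightarrow> g holomorphic_on S"
    by (rule holomorphic_cong) (auto simp: assms(2))
  then show ?thesis
    using assms(3,4) unfolding chain_ode_def by (simp add: d1 d2 assms(2))
qed

lemma poly_chain_poly_eq_sol_fps:
  assumes "uniform_points M X"
  shows "poly (chain_poly M X n) z = fps_nth (sol_fps z) n"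
  using chain_recurrence_poly_eval[OF assms] chain_recurrence_sol_fps
  by (rule chain_recurrence_complex_unique[of z "\<lambda>n. poly (chain_poly M X n) z"])
    (simp add: chain_poly_def fps_nth_has_fps_expansion_0[OF sol_has_fps_expansion] sol_0)

lemma chain_poly_sums:
  assumes "uniform_points M X" "norm u < 1"
  shows "(\<lambda>n. poly (chain_poly M X n) z * u ^ n) sums sol u z"
  unfolding poly_chain_poly_eq_sol_fps[OF assms(1)]
  by (rule sums_fps_unit_disc[OF sol_has_fps_expansion holomorphic_sol assms(2)])

lemma degree_chain_poly: "uniform_points M X \<Longrightarrow> degree (chain_poly M X n) \<le> n"
  by (rule degree_le) (simp add: coeff_chain_poly chain_coeff_eq_0)

lemma poly_chain_poly:
  assumes "uniform_points M X"
  shows "poly (chain_poly M X n) z = (\<Sum>k\<le>n. of_real (chain_coeff n k) * z ^ k)"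
proof -
  have "poly (chain_poly M X n) z = (\<Sum>k\<le>n. coeff (chain_poly M X n) k * z ^ k)"
    unfolding poly_altdef
    by (rule sum.mono_neutral_left) (use degree_chain_poly[OF assms, of n] in \<open>auto simp: coeff_eq_0\<close>)
  then show ?thesis by (simp only: coeff_chain_poly[OF assms])
qed

text \<open>All coefficients are nonnegative, so the double series at \<open>(u, z)\<close> is dominated by the one at
  \<open>(\<bar>u\<bar>, \<bar>z\<bar>)\<close>. The latter converges because the series in \<open>u\<close> converges for every value of \<open>z\<close>.\<close>

lemma chain_gf_has_sum:
  assumes "uniform_points M X" "norm u < 1"
  shows "((\<lambda>(n, k). fps_nth (fps_nth (chain_gf M X) n) k * u ^ n * z ^ k) has_sum sol u z) UNIV"
proof -
  let ?t = "\<lambda>(n, k). fps_nth (fps_nth (chain_gf M X) n) k * u ^ n * z ^ k"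
  have t: "fps_nth (fps_nth (chain_gf M X) n) k = of_real (chain_coeff n k)" for n k
    by (simp add: chain_gf_def coeff_chain_poly[OF assms(1)])
  have inner: "((\<lambda>k. ?t (n, k)) has_sum poly (chain_poly M X n) z * u ^ n) UNIV" for n
  proof -
    have "((\<lambda>k. ?t (n, k)) has_sum (\<Sum>k\<le>n. ?t (n, k))) UNIV"
      by (rule has_sum_finite_neutralI) (auto simp: t chain_coeff_eq_0)
    also have "(\<Sum>k\<le>n. ?t (n, k)) = poly (chain_poly M X n) z * u ^ n"
      unfolding poly_chain_poly[OF assms(1)] by (simp add: t sum_distrib_left sum_distrib_right mult_ac)
    finally show ?thesis .
  qed
  define w where "w n = (\<Sum>k\<le>n. chain_coeff n k * norm z ^ k) * norm u ^ n" for n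
  have w_nonneg: "w n \<ge> 0" for n
    unfolding w_def by (intro mult_nonneg_nonneg sum_nonneg chain_coeff_nonneg) auto
  have "(\<lambda>n. poly (chain_poly M X n) (of_real (norm z)) * of_real (norm u) ^ n) sums sol (of_real (norm u)) (of_real (norm z))"
    by (rule chain_poly_sums[OF assms(1)]) (use assms(2) in simp)
  moreover have "poly (chain_poly M X n) (of_real (norm z)) * of_real (norm u) ^ n = complex_of_real (w n)" for n
    unfolding poly_chain_poly[OF assms(1)] w_def by simp
  ultimately have "summable (\<lambda>n. complex_of_real (w n))" by (simp add: sums_iff)
  then have w_sum: "summable w" by (simp only: summable_complex_of_real)
  have w_on: "w summable_on UNIV"
    using norm_summable_imp_summable_on[of w] w_sum w_nonneg by simp
  have "(\<lambda>(n, k). norm (?t (n, k))) summable_on Sigma (UNIV :: nat set) (\<lambda>_. UNIV :: nat set)"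
  proof (rule summable_on_SigmaI[OF _ w_on])
    fix n
    have "((\<lambda>k. norm (?t (n, k))) has_sum (\<Sum>k\<le>n. norm (?t (n, k)))) UNIV"
      by (rule has_sum_finite_neutralI) (auto simp: t chain_coeff_eq_0)
    also have "(\<Sum>k\<le>n. norm (?t (n, k))) = w n"
      unfolding w_def by (simp add: t norm_mult norm_power chain_coeff_nonneg sum_distrib_left mult_ac)
    finally show "((\<lambda>k. case (n, k) of (n, k) \<Rightarrow> norm (?t (n, k))) has_sum w n) UNIV" by simp
  qed auto
  then have "(\<lambda>p. norm (?t p)) summable_on Sigma UNIV (\<lambda>_. UNIV)"
    by (simp add: case_prod_beta')
  then have summable: "?t summable_on Sigma UNIV (\<lambda>_. UNIV)"
    by (rule abs_summable_summable)
  have outer: "((\<lambda>n. poly (chain_poly M X n) z * u ^ n) has_sum sol u z) UNIV"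
  proof (rule norm_summable_imp_has_sum[OF _ chain_poly_sums[OF assms]])
    have "norm (poly (chain_poly M X n) z * u ^ n) \<le> w n" for n
    proof -
      have "norm (poly (chain_poly M X n) z) \<le> (\<Sum>k\<le>n. chain_coeff n k * norm z ^ k)"
        unfolding poly_chain_poly[OF assms(1)]
        by (rule sum_norm_le) (simp add: norm_mult norm_power chain_coeff_nonneg)
      then show ?thesis by (simp add: w_def norm_mult norm_power mult_right_mono)
    qed
    then show "summable (\<lambda>n. norm (poly (chain_poly M X n) z * u ^ n))"
      by (intro summable_comparison_test'[OF w_sum, of 0]) simp
  qed
  from has_sum_SigmaI[OF inner outer summable] show ?thesis by (simp only: UNIV_Times_UNIV)
qed

theorem theorem2p3:
  fixes M :: "nat \<Rightarrow> 'w measure" and X :: "nat \<Rightarrow> nat \<Rightarrow> 'w \<Rightarrow> real \<times> real"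
  assumes "uniform_points M X"
  shows
    "(formal_chain_ode (chain_gf M X) \<and>
      (\<forall>H. formal_chain_ode H \<longrightarrow> H = chain_gf M X)) \<and>
     (\<forall>z\<in>z_domain. chain_ode z u_domain (\<lambda>u. chain_fun u z) \<and>
       (\<forall>S f. open S \<and> connected S \<and> 0 \<in> S \<and> S \<subseteq> u_domain \<and> chain_ode z S f \<longrightarrow>
          (\<forall>u\<in>S. f u = chain_fun u z))) \<and>
     (\<forall>z\<in>z_domain. \<forall>u. norm u < 1 \<longrightarrow>
       (\<lambda>n. poly (chain_poly M X n) z * u ^ n) sums chain_fun u z \<and>
       ((\<lambda>(n, k). fps_nth (fps_nth (chain_gf M X) n) k * u ^ n * z ^ k)
          has_sum chain_fun u z) UNIV) \<and>
     jointly_analytic_on chain_fun (u_domain \<times> z_domain)"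
proof (intro conjI ballI allI impI)
  show "formal_chain_ode (chain_gf M X)" by (rule formal_chain_ode_chain_gf[OF assms])
  then show "H = chain_gf M X" if "formal_chain_ode H" for H
    using that formal_chain_ode_unique by blast
  show "jointly_analytic_on chain_fun (u_domain \<times> z_domain)" by (rule jointly_analytic_chain_fun)
next
  fix z
  show "chain_ode z u_domain (\<lambda>u. chain_fun u z)"
    by (rule chain_ode_cong[OF open_u_domain chain_fun_eq_sol zero_in_u_domain chain_ode_sol])
next
  fix z S f u
  assume *: "open S \<and> connected S \<and> 0 \<in> S \<and> S \<subseteq> u_domain \<and> chain_ode z S f" and u: "u \<in> S"
  then have "f u = sol u z" by (intro chain_ode_unique) auto
  moreover have "u \<in> u_domain" using * u by blast
  ultimately show "f u = chain_fun u z" by (simp add: chain_fun_eq_sol)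
next
  fix z u :: complex
  assume u: "norm u < 1"
  then have eq: "chain_fun u z = sol u z"
    using ball_subset_u_domain by (intro chain_fun_eq_sol) auto
  show "(\<lambda>n. poly (chain_poly M X n) z * u ^ n) sums chain_fun u z"
    unfolding eq by (rule chain_poly_sums[OF assms u])
  show "((\<lambda>(n, k). fps_nth (fps_nth (chain_gf M X) n) k * u ^ n * z ^ k) has_sum chain_fun u z) UNIV"
    unfolding eq by (rule chain_gf_has_sum[OF assms u])
qed

end
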